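(* For all $\mu,\nu\in\mathbb{R}$, the $^*$-algebra $U_q(\mu,\nu)$, equipped with the maps $\Delta_{\mu\nu}^{\mu}:U_q(\mu,\nu)\to U_q(\mu)\otimes U_q(\mu,\nu)$ and $\Delta_{\mu\nu}^{\nu}:U_q(\mu,\nu)\to U_q(\mu,\nu)\otimes U_q(\nu)$, is a bi-$^*$-Galois object between the Hopf $^*$-algebras $U_q(\mu)$ and $U_q(\nu)$.
   Context: Fix a real number $0<q<1$ and put $\lambda=(q-q^{-1})^{-1}<0$. For $\mu,\nu\in\mathbb{R}$, $U_q(\mu,\nu)$ is the universal unital algebra over $\mathbb{C}$ generated by four elements $K,K^{-1},E,F$ (written $K_{\mu\nu}$, $E_{\mu\nu}$, etc. when the indices matter) with relations $K^{-1}K=1=KK^{-1}$, $KE=qEK$, $KF=q^{-1}FK$, $[E,F]=\lambda(\mu K^2-\nu K^{-2})$, with $^*$-structure determined by $K^*=K$, $E^*=F$. For $\mu,\upsilon,\nu\in\mathbb{R}$, $\Delta_{\mu\nu}^{\upsilon}:U_q(\mu,\nu)\to U_q(\mu,\upsilon)\otimes U_q(\upsilon,\nu)$ is the unital $^*$-homomorphism with $\Delta_{\mu\nu}^{\upsilon}(E_{\mu\nu})=E_{\mu\upsilon}\otimes K_{\upsilon\nu}+K_{\mu\upsilon}^{-1}\otimes E_{\upsilon\nu}$ and $\Delta_{\mu\nu}^{\upsilon}(K_{\mu\nu})=K_{\mu\upsilon}\otimes K_{\upsilon\nu}$. $U_q(\mu):=U_q(\mu,\mu)$ is a Hopf $^*$-algebra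 with comultiplication $\Delta_\mu=\Delta_{\mu\mu}^\mu$. Let $(H_0,\Delta_0)$, $(H_1,\Delta_1)$ be Hopf $^*$-algebras. A bi-$^*$-Galois object $(H_{01},\Delta_{01}^0,\Delta_{01}^1)$ between them consists of a non-trivial unital $^*$-algebra $H_{01}$ (i.e. $1\neq0$) with a left $H_0$-comodule $^*$-algebra structure $\Delta_{01}^0:H_{01}\to H_0\otimes H_{01}$ and a right $H_1$-comodule $^*$-algebra structure $\Delta_{01}^1:H_{01}\to H_{01}\otimes H_1$ (both unital $^*$-homomorphisms that are coassociative and counital) such that: the map $H_{01}\otimes H_{01}\to H_{01}\otimes H_1$, $x\otimes y\mapsto(x\otimes1)\Delta_{01}^1(y)$, is bijective; the map $H_{01}\otimes H_{01}\to H_0\otimes H_{01}$, $x\otimes y\mapsto\Delta_{01}^0(x)(1\otimes y)$, is bijective; and $(\iota\otimes\Delta_{01}^1)\Delta_{01}^0=(\Delta_{01}^0\otimes\iota)\Delta_{01}^1$. Here $\iota$ is the identity map and $\otimes$ is the algebraic tensor product over $\mathbb{C}$. *)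

theory Defs
  imports Complex_Main "HOL-Library.Poly_Mapping" "HOL-Library.FuncSet"
    "HOL-Algebra.Module" "HOL-Algebra.QuotRing"
begin

section \<open>Complex unital star-algebras\<close>

record 'a star_alg = "(complex, 'a) module" +
  star :: "'a \<Rightarrow> 'a"

definition complex_alg :: "complex star_alg" where
  "complex_alg = \<lparr>carrier = UNIV, mult = (*), one = 1, zero = 0, add = (+), smult = (*), star = cnj\<rparr>"

locale star_algebra = Module.module complex_alg A + ring A
  for A :: "'a star_alg" (structure) +
  assumes smult_mult_left:
      "x \<in> carrier A \<Longrightarrow> y \<in> carrier A \<Longrightarrow> (c \<odot> x) \<otimes> y = c \<odot> (x \<otimes> y)"
    and smult_mult_right:
      "x \<in> carrier A \<Longrightarrow> y \<in> carrier A \<Longrightarrow> x \<otimes> (c \<odot> y) = c \<odot> (x \<otimes> y)"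
    and star_closed: "x \<in> carrier A \<Longrightarrow> star A x \<in> carrier A"
    and star_add: "x \<in> carrier A \<Longrightarrow> y \<in> carrier A \<Longrightarrow> star A (x \<oplus> y) = star A x \<oplus> star A y"
    and star_smult: "x \<in> carrier A \<Longrightarrow> star A (c \<odot> x) = cnj c \<odot> star A x"
    and star_mult: "x \<in> carrier A \<Longrightarrow> y \<in> carrier A \<Longrightarrow> star A (x \<otimes> y) = star A y \<otimes> star A x"
    and star_star: "x \<in> carrier A \<Longrightarrow> star A (star A x) = x"

definition lin_map :: "'a star_alg \<Rightarrow> 'b star_alg \<Rightarrow> ('a \<Rightarrow> 'b) \<Rightarrow> bool" where
  "lin_map A B f \<longleftrightarrow> f \<in> carrier A \<rightarrow> carrier B \<and>
    (\<forall>x\<in>carrier A. \<forall>y\<in>carrier A. f (x \<oplus>\<^bsub>A\<^esub> y) = f x \<oplus>\<^bsub>B\<^esub> f y) \<and>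
    (\<forall>c. \<forall>x\<in>carrier A. f (c \<odot>\<^bsub>A\<^esub> x) = c \<odot>\<^bsub>B\<^esub> f x)"

text \<open>Recall that \<^const>\<open>ring_hom\<close> includes preservation of the unit.\<close>

definition alg_hom :: "'a star_alg \<Rightarrow> 'b star_alg \<Rightarrow> ('a \<Rightarrow> 'b) \<Rightarrow> bool" where
  "alg_hom A B f \<longleftrightarrow> lin_map A B f \<and> f \<in> ring_hom A B"

definition star_hom :: "'a star_alg \<Rightarrow> 'b star_alg \<Rightarrow> ('a \<Rightarrow> 'b) \<Rightarrow> bool" where
  "star_hom A B f \<longleftrightarrow> alg_hom A B f \<and> (\<forall>x\<in>carrier A. f (star A x) = star B (f x))"


section \<open>Monoid algebras and quotients\<close>

definition scale :: "complex \<Rightarrow> ('k \<Rightarrow>\<^sub>0 complex) \<Rightarrow> 'k \<Rightarrow>\<^sub>0 complex" where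
  "scale c p = Poly_Mapping.map (\<lambda>x. c * x) p"

lemma lookup_scale [simp]: "Poly_Mapping.lookup (scale c p) k = c * Poly_Mapping.lookup p k"
  by (simp add: scale_def map.rep_eq when_def)

global_interpretation pm: Vector_Spaces.vector_space scale
  defines pm_span = pm.span
  by unfold_locales (auto intro!: poly_mapping_eqI simp: lookup_add algebra_simps)

text \<open>The algebra of finitely supported functions on a monoid \<open>G\<close> under convolution. The star
  operation is the antilinear extension of a map \<open>s\<close> on \<open>G\<close>, to be thought of as an
  anti-multiplicative involution.\<close>

definition monoid_alg :: "'k monoid \<Rightarrow> ('k \<Rightarrow> 'k) \<Rightarrow> ('k \<Rightarrow>\<^sub>0 complex) star_alg" where
  "monoid_alg G s =
    \<lparr>carrier = {p. Poly_Mapping.keys p \<subseteq> carrier G},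
     mult = (\<lambda>p r. \<Sum>k\<in>Poly_Mapping.keys p. \<Sum>l\<in>Poly_Mapping.keys r.
       Poly_Mapping.single (k \<otimes>\<^bsub>G\<^esub> l) (Poly_Mapping.lookup p k * Poly_Mapping.lookup r l)),
     one = Poly_Mapping.single \<one>\<^bsub>G\<^esub> 1,
     zero = 0,
     add = (+),
     smult = scale,
     star = (\<lambda>p. \<Sum>k\<in>Poly_Mapping.keys p. Poly_Mapping.single (s k) (cnj (Poly_Mapping.lookup p k)))\<rparr>"

text \<open>The ring operations are those of \<^const>\<open>FactRing\<close>.\<close>

definition quot_alg :: "'a star_alg \<Rightarrow> 'a set \<Rightarrow> 'a set star_alg" where
  "quot_alg A I =
    \<lparr>carrier = a_rcosets\<^bsub>A\<^esub> I, mult = rcoset_mult A I, one = I +>\<^bsub>A\<^esub> \<one>\<^bsub>A\<^esub>, zero = I, add = set_add A,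
     smult = (\<lambda>c X. \<Union>x\<in>X. I +>\<^bsub>A\<^esub> (c \<odot>\<^bsub>A\<^esub> x)),
     star = (\<lambda>X. \<Union>x\<in>X. I +>\<^bsub>A\<^esub> star A x)\<rparr>"


section \<open>Algebraic tensor products\<close>

text \<open>The tensor product of \<open>A\<close> and \<open>B\<close> is the free vector space on
  \<open>carrier A \<times> carrier B\<close> modulo the span of the bilinearity relations. The products and
  adjoints \<open>(a, b) (a', b') = (a a', b b')\<close> and \<open>(a, b)* = (a*, b*)\<close> turn this free vector
  space into the monoid algebra of the product of the multiplicative monoids.\<close>

definition pre_tensor :: "'a star_alg \<Rightarrow> 'b star_alg \<Rightarrow> ('a \<times> 'b \<Rightarrow>\<^sub>0 complex) star_alg" where
  "pre_tensor A B = monoid_alg (A \<times>\<times> B) (map_prod (star A) (star B))"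

definition tensor_rels :: "'a star_alg \<Rightarrow> 'b star_alg \<Rightarrow> ('a \<times> 'b \<Rightarrow>\<^sub>0 complex) set" where
  "tensor_rels A B = pm_span (
    {Poly_Mapping.single (a \<oplus>\<^bsub>A\<^esub> a', b) 1 - Poly_Mapping.single (a, b) 1 - Poly_Mapping.single (a', b) 1
      | a a' b. a \<in> carrier A \<and> a' \<in> carrier A \<and> b \<in> carrier B} \<union>
    {Poly_Mapping.single (a, b \<oplus>\<^bsub>B\<^esub> b') 1 - Poly_Mapping.single (a, b) 1 - Poly_Mapping.single (a, b') 1
      | a b b'. a \<in> carrier A \<and> b \<in> carrier B \<and> b' \<in> carrier B} \<union>
    {Poly_Mapping.single (c \<odot>\<^bsub>A\<^esub> a, b) 1 - Poly_Mapping.single (a, b) c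
      | c a b. a \<in> carrier A \<and> b \<in> carrier B} \<union>
    {Poly_Mapping.single (a, c \<odot>\<^bsub>B\<^esub> b) 1 - Poly_Mapping.single (a, b) c
      | c a b. a \<in> carrier A \<and> b \<in> carrier B})"

definition tensor :: "'a star_alg \<Rightarrow> 'b star_alg \<Rightarrow> ('a \<times> 'b \<Rightarrow>\<^sub>0 complex) set star_alg"
    (infixr \<open>\<boxtimes>\<close> 70) where
  "A \<boxtimes> B = quot_alg (pre_tensor A B) (tensor_rels A B)"

definition pure_tensor :: "'a star_alg \<Rightarrow> 'b star_alg \<Rightarrow> 'a \<Rightarrow> 'b \<Rightarrow> ('a \<times> 'b \<Rightarrow>\<^sub>0 complex) set" where
  "pure_tensor A B a b = tensor_rels A B +>\<^bsub>pre_tensor A B\<^esub> Poly_Mapping.single (a, b) 1"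

text \<open>The linear map \<open>A \<boxtimes> B \<rightarrow> M\<close> induced by a bilinear map \<open>f\<close>: it sends the class of
  \<open>\<Sum>i. c\<^sub>i (a\<^sub>i, b\<^sub>i)\<close> to \<open>\<Sum>i. c\<^sub>i f(a\<^sub>i, b\<^sub>i)\<close>. If \<open>f\<close> is bilinear on the carriers, the image
  below is a singleton.\<close>

definition tensor_lift :: "'m star_alg \<Rightarrow> ('a \<Rightarrow> 'b \<Rightarrow> 'm) \<Rightarrow> ('a \<times> 'b \<Rightarrow>\<^sub>0 complex) set \<Rightarrow> 'm" where
  "tensor_lift M f X = the_elem ((\<lambda>p.
     finsum M (\<lambda>(a, b). Poly_Mapping.lookup p (a, b) \<odot>\<^bsub>M\<^esub> f a b) (Poly_Mapping.keys p)) ` X)"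

definition tensor_map :: "'c star_alg \<Rightarrow> 'd star_alg \<Rightarrow> ('a \<Rightarrow> 'c) \<Rightarrow> ('b \<Rightarrow> 'd) \<Rightarrow>
    ('a \<times> 'b \<Rightarrow>\<^sub>0 complex) set \<Rightarrow> ('c \<times> 'd \<Rightarrow>\<^sub>0 complex) set" where
  "tensor_map C D f g = tensor_lift (C \<boxtimes> D) (\<lambda>a b. pure_tensor C D (f a) (g b))"

text \<open>The canonical identification of \<open>(A \<boxtimes> B) \<boxtimes> C\<close> with \<open>A \<boxtimes> (B \<boxtimes> C)\<close>.\<close>

definition tensor_assoc :: "'a star_alg \<Rightarrow> 'b star_alg \<Rightarrow> 'c star_alg \<Rightarrow>
    (('a \<times> 'b \<Rightarrow>\<^sub>0 complex) set \<times> 'c \<Rightarrow>\<^sub>0 complex) set \<Rightarrow>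
    ('a \<times> ('b \<times> 'c \<Rightarrow>\<^sub>0 complex) set \<Rightarrow>\<^sub>0 complex) set" where
  "tensor_assoc A B C = tensor_lift (A \<boxtimes> (B \<boxtimes> C))
     (\<lambda>t c. tensor_lift (A \<boxtimes> (B \<boxtimes> C))
        (\<lambda>a b. pure_tensor A (B \<boxtimes> C) a (pure_tensor B C b c)) t)"


section \<open>Hopf star-algebras and bi-star-Galois objects\<close>

definition is_counit :: "'h star_alg \<Rightarrow> ('h \<Rightarrow> ('h \<times> 'h \<Rightarrow>\<^sub>0 complex) set) \<Rightarrow> ('h \<Rightarrow> complex) \<Rightarrow> bool" where
  "is_counit H \<Delta> \<epsilon> \<longleftrightarrow> alg_hom H complex_alg \<epsilon> \<and>
    (\<forall>h\<in>carrier H. tensor_lift H (\<lambda>x y. \<epsilon> x \<odot>\<^bsub>H\<^esub> y) (\<Delta> h) = h) \<and>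
    (\<forall>h\<in>carrier H. tensor_lift H (\<lambda>x y. \<epsilon> y \<odot>\<^bsub>H\<^esub> x) (\<Delta> h) = h)"

definition is_antipode :: "'h star_alg \<Rightarrow> ('h \<Rightarrow> ('h \<times> 'h \<Rightarrow>\<^sub>0 complex) set) \<Rightarrow> ('h \<Rightarrow> complex) \<Rightarrow>
    ('h \<Rightarrow> 'h) \<Rightarrow> bool" where
  "is_antipode H \<Delta> \<epsilon> S \<longleftrightarrow> lin_map H H S \<and>
    (\<forall>h\<in>carrier H. tensor_lift H (\<lambda>x y. S x \<otimes>\<^bsub>H\<^esub> y) (\<Delta> h) = \<epsilon> h \<odot>\<^bsub>H\<^esub> \<one>\<^bsub>H\<^esub>) \<and>
    (\<forall>h\<in>carrier H. tensor_lift H (\<lambda>x y. x \<otimes>\<^bsub>H\<^esub> S y) (\<Delta> h) = \<epsilon> h \<odot>\<^bsub>H\<^esub> \<one>\<^bsub>H\<^esub>)"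

text \<open>Counit and antipode are uniquely determined on the carrier by \<open>(H, \<Delta>)\<close>, so the
  existential quantifiers here and in the comodule definitions carry no choice.\<close>

definition hopf_star_algebra :: "'h star_alg \<Rightarrow> ('h \<Rightarrow> ('h \<times> 'h \<Rightarrow>\<^sub>0 complex) set) \<Rightarrow> bool" where
  "hopf_star_algebra H \<Delta> \<longleftrightarrow> star_algebra H \<and> star_hom H (H \<boxtimes> H) \<Delta> \<and>
    (\<forall>h\<in>carrier H. tensor_map H (H \<boxtimes> H) id \<Delta> (\<Delta> h) =
       tensor_assoc H H H (tensor_map (H \<boxtimes> H) H \<Delta> id (\<Delta> h))) \<and>
    (\<exists>\<epsilon> S. is_counit H \<Delta> \<epsilon> \<and> is_antipode H \<Delta> \<epsilon> S)"

definition left_comodule_star_algebra :: "'h star_alg \<Rightarrow> ('h \<Rightarrow> ('h \<times> 'h \<Rightarrow>\<^sub>0 complex) set) \<Rightarrow>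
    'a star_alg \<Rightarrow> ('a \<Rightarrow> ('h \<times> 'a \<Rightarrow>\<^sub>0 complex) set) \<Rightarrow> bool" where
  "left_comodule_star_algebra H \<Delta> A \<delta> \<longleftrightarrow> star_hom A (H \<boxtimes> A) \<delta> \<and>
    (\<forall>x\<in>carrier A. tensor_map H (H \<boxtimes> A) id \<delta> (\<delta> x) =
       tensor_assoc H H A (tensor_map (H \<boxtimes> H) A \<Delta> id (\<delta> x))) \<and>
    (\<exists>\<epsilon>. is_counit H \<Delta> \<epsilon> \<and>
      (\<forall>x\<in>carrier A. tensor_lift A (\<lambda>h a. \<epsilon> h \<odot>\<^bsub>A\<^esub> a) (\<delta> x) = x))"

definition right_comodule_star_algebra :: "'h star_alg \<Rightarrow> ('h \<Rightarrow> ('h \<times> 'h \<Rightarrow>\<^sub>0 complex) set) \<Rightarrow>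
    'a star_alg \<Rightarrow> ('a \<Rightarrow> ('a \<times> 'h \<Rightarrow>\<^sub>0 complex) set) \<Rightarrow> bool" where
  "right_comodule_star_algebra H \<Delta> A \<delta> \<longleftrightarrow> star_hom A (A \<boxtimes> H) \<delta> \<and>
    (\<forall>x\<in>carrier A. tensor_map A (H \<boxtimes> H) id \<Delta> (\<delta> x) =
       tensor_assoc A H H (tensor_map (A \<boxtimes> H) H \<delta> id (\<delta> x))) \<and>
    (\<exists>\<epsilon>. is_counit H \<Delta> \<epsilon> \<and>
      (\<forall>x\<in>carrier A. tensor_lift A (\<lambda>a h. \<epsilon> h \<odot>\<^bsub>A\<^esub> a) (\<delta> x) = x))"

definition bi_star_galois_object ::
  "'h star_alg \<Rightarrow> ('h \<Rightarrow> ('h \<times> 'h \<Rightarrow>\<^sub>0 complex) set) \<Rightarrow>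
   'k star_alg \<Rightarrow> ('k \<Rightarrow> ('k \<times> 'k \<Rightarrow>\<^sub>0 complex) set) \<Rightarrow>
   'a star_alg \<Rightarrow> ('a \<Rightarrow> ('h \<times> 'a \<Rightarrow>\<^sub>0 complex) set) \<Rightarrow> ('a \<Rightarrow> ('a \<times> 'k \<Rightarrow>\<^sub>0 complex) set) \<Rightarrow> bool" where
  "bi_star_galois_object H\<^sub>0 \<Delta>\<^sub>0 H\<^sub>1 \<Delta>\<^sub>1 A \<delta>\<^sub>0 \<delta>\<^sub>1 \<longleftrightarrow>
    hopf_star_algebra H\<^sub>0 \<Delta>\<^sub>0 \<and> hopf_star_algebra H\<^sub>1 \<Delta>\<^sub>1 \<and>
    star_algebra A \<and> \<one>\<^bsub>A\<^esub> \<noteq> \<zero>\<^bsub>A\<^esub> \<and>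
    left_comodule_star_algebra H\<^sub>0 \<Delta>\<^sub>0 A \<delta>\<^sub>0 \<and>
    right_comodule_star_algebra H\<^sub>1 \<Delta>\<^sub>1 A \<delta>\<^sub>1 \<and>
    bij_betw (tensor_lift (A \<boxtimes> H\<^sub>1) (\<lambda>x y. pure_tensor A H\<^sub>1 x \<one>\<^bsub>H\<^sub>1\<^esub> \<otimes>\<^bsub>A \<boxtimes> H\<^sub>1\<^esub> \<delta>\<^sub>1 y))
      (carrier (A \<boxtimes> A)) (carrier (A \<boxtimes> H\<^sub>1)) \<and>
    bij_betw (tensor_lift (H\<^sub>0 \<boxtimes> A) (\<lambda>x y. \<delta>\<^sub>0 x \<otimes>\<^bsub>H\<^sub>0 \<boxtimes> A\<^esub> pure_tensor H\<^sub>0 A \<one>\<^bsub>H\<^sub>0\<^esub> y))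
      (carrier (A \<boxtimes> A)) (carrier (H\<^sub>0 \<boxtimes> A)) \<and>
    (\<forall>x\<in>carrier A. tensor_map H\<^sub>0 (A \<boxtimes> H\<^sub>1) id \<delta>\<^sub>1 (\<delta>\<^sub>0 x) =
       tensor_assoc H\<^sub>0 A H\<^sub>1 (tensor_map (H\<^sub>0 \<boxtimes> A) H\<^sub>1 \<delta>\<^sub>0 id (\<delta>\<^sub>1 x)))"


section \<open>The algebras \<open>U\<^sub>q(\<mu>, \<nu>)\<close>\<close>

datatype gen = GenK | GenKinv | GenE | GenF

fun gen_star :: "gen \<Rightarrow> gen" where
  "gen_star GenK = GenK"
| "gen_star GenKinv = GenKinv"
| "gen_star GenE = GenF"
| "gen_star GenF = GenE"

text \<open>The free unital algebra on the generators, with the star operation that extends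
  \<^const>\<open>gen_star\<close>.\<close>

definition free_alg :: "(gen list \<Rightarrow>\<^sub>0 complex) star_alg" where
  "free_alg = monoid_alg \<lparr>carrier = UNIV, mult = (@), one = []\<rparr> (\<lambda>w. rev (map gen_star w))"

abbreviation word :: "gen list \<Rightarrow> complex \<Rightarrow> gen list \<Rightarrow>\<^sub>0 complex" where
  "word w c \<equiv> Poly_Mapping.single w c"

definition Uq_rels :: "real \<Rightarrow> real \<Rightarrow> real \<Rightarrow> (gen list \<Rightarrow>\<^sub>0 complex) set" where
  "Uq_rels q \<mu> \<nu> = (let lam = inverse (q - inverse q) in
    {word [GenKinv, GenK] 1 - word [] 1,
     word [GenK, GenKinv] 1 - word [] 1,
     word [GenK, GenE] 1 - word [GenE, GenK] (complex_of_real q),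
     word [GenK, GenF] 1 - word [GenF, GenK] (complex_of_real (inverse q)),
     (word [GenE, GenF] 1 - word [GenF, GenE] 1) -
       (word [GenK, GenK] (complex_of_real (lam * \<mu>)) -
        word [GenKinv, GenKinv] (complex_of_real (lam * \<nu>)))})"

text \<open>\<^const>\<open>genideal\<close> forms the two-sided ideal generated by a set. A two-sided ideal of a unital
  algebra is a linear subspace, and this one is stable under the star operation.\<close>

definition Uq_ideal :: "real \<Rightarrow> real \<Rightarrow> real \<Rightarrow> (gen list \<Rightarrow>\<^sub>0 complex) set" where
  "Uq_ideal q \<mu> \<nu> = genideal free_alg (Uq_rels q \<mu> \<nu>)"

type_synonym Uq_elem = "(gen list \<Rightarrow>\<^sub>0 complex) set"

definition Uq :: "real \<Rightarrow> real \<Rightarrow> real \<Rightarrow> Uq_elem star_alg" where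
  "Uq q \<mu> \<nu> = quot_alg free_alg (Uq_ideal q \<mu> \<nu>)"

definition Uq_gen :: "real \<Rightarrow> real \<Rightarrow> real \<Rightarrow> gen \<Rightarrow> Uq_elem" where
  "Uq_gen q \<mu> \<nu> g = Uq_ideal q \<mu> \<nu> +>\<^bsub>free_alg\<^esub> word [g] 1"

definition Uq_Delta :: "real \<Rightarrow> real \<Rightarrow> real \<Rightarrow> real \<Rightarrow> Uq_elem \<Rightarrow> (Uq_elem \<times> Uq_elem \<Rightarrow>\<^sub>0 complex) set" where
  "Uq_Delta q \<mu> \<upsilon> \<nu> = (let A = Uq q \<mu> \<upsilon>; B = Uq q \<upsilon> \<nu> in
    (THE f. f \<in> extensional (carrier (Uq q \<mu> \<nu>)) \<and> star_hom (Uq q \<mu> \<nu>) (A \<boxtimes> B) f \<and>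
      f (Uq_gen q \<mu> \<nu> GenE) =
        pure_tensor A B (Uq_gen q \<mu> \<upsilon> GenE) (Uq_gen q \<upsilon> \<nu> GenK) \<oplus>\<^bsub>A \<boxtimes> B\<^esub>
        pure_tensor A B (Uq_gen q \<mu> \<upsilon> GenKinv) (Uq_gen q \<upsilon> \<nu> GenE) \<and>
      f (Uq_gen q \<mu> \<nu> GenK) =
        pure_tensor A B (Uq_gen q \<mu> \<upsilon> GenK) (Uq_gen q \<upsilon> \<nu> GenK)))"

end

theory Submission
  imports Defs
begin

text \<open>The algebras \<open>U\<^sub>q(\<mu>, \<nu>)\<close> form a cogroupoid: besides the coassociative maps \<open>\<Delta>\<close> and the counits
  of the \<open>U\<^sub>q(\<mu>, \<mu>)\<close> there are antihomomorphisms \<open>S : U\<^sub>q(\<mu>, \<nu>) \<rightarrow> U\<^sub>q(\<nu>, \<mu>)\<close> given by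
  \<open>S(K) = K\<^sup>-\<^sup>1\<close>, \<open>S(E) = -q E\<close>, \<open>S(F) = -q\<^sup>-\<^sup>1 F\<close>. For \<open>\<mu> = \<nu>\<close> this is the antipode, and in general
  \<open>x \<otimes> h \<mapsto> (x \<otimes> 1) \<gamma>(h)\<close> with \<open>\<gamma> = (S \<otimes> \<iota>) \<Delta>\<close> inverts the right Galois map, and
  symmetrically on the left. All algebras are non-zero since they act on a Verma module.\<close>

section \<open>Complex algebras\<close>

text \<open>No basis of \<open>U_q(\<mu>, \<nu>)\<close> is used. Homomorphisms are built from the
  presentation and compared on generators, and bijectivity comes from explicit inverses. A
  presentation alone cannot exclude that everything collapses to zero, which is why one concrete
  representation is needed. In Sweedler notation the right Galois map is inverted because S(h1) h2
  \<otimes> h3 = 1 \<otimes> h and h1 S(h2) \<otimes> h3 = 1 \<otimes> h. The obstacle is that the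
  left sides mix the multiplicative \<Delta> with the antimultiplicative S, so they are not visibly
  homomorphisms in h and agreement on generators does not settle them at once. What saves the
  induction over products is that the right side commutes with the antimultiplicative part: its
  values are scalars, or they live in the other tensor leg. The indices of S are exchanged because
  an antihomomorphism turns [E, F] into a multiple of [F, E], while K and its inverse trade
  places.\<close>

lemma complex_alg_simps [simp]:
  "carrier complex_alg = UNIV" "mult complex_alg = (*)" "one complex_alg = 1"
  "zero complex_alg = 0" "add complex_alg = (+)" "smult complex_alg = (*)" "star complex_alg = cnj"
  by (simp_all add: complex_alg_def)

lemma cring_complex_alg: "cring complex_alg"
  by (intro cringI abelian_groupI comm_monoidI)
    (auto simp: algebra_simps intro: exI[of _ "- x" for x])

text \<open>The part of \<open>star_algebra\<close> without the star. Quotients, tensor products,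
  lifts and opposite algebras are handled at this level, and \<open>End_alg\<close> below is only an
  algebra: its \<open>star\<close> field is a filler that is not antilinear.\<close>

locale calgebra = Module.module complex_alg A + ring A
  for A :: "'a star_alg" (structure) +
  assumes csmult_mult_left:
      "x \<in> carrier A \<Longrightarrow> y \<in> carrier A \<Longrightarrow> (c \<odot> x) \<otimes> y = c \<odot> (x \<otimes> y)"
    and csmult_mult_right:
      "x \<in> carrier A \<Longrightarrow> y \<in> carrier A \<Longrightarrow> x \<otimes> (c \<odot> y) = c \<odot> (x \<otimes> y)"
begin

lemma csmult_closed [simp, intro]: "x \<in> carrier A \<Longrightarrow> c \<odot> x \<in> carrier A"
  by simp

lemma csmult_add: "x \<in> carrier A \<Longrightarrow> (c + d) \<odot> x = c \<odot> x \<oplus> d \<odot> x"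
  using smult_l_distr[of c d x] by simp

lemma csmult_distrib: "x \<in> carrier A \<Longrightarrow> y \<in> carrier A \<Longrightarrow> c \<odot> (x \<oplus> y) = c \<odot> x \<oplus> c \<odot> y"
  using smult_r_distr[of c x y] by simp

lemma csmult_csmult: "x \<in> carrier A \<Longrightarrow> c \<odot> (d \<odot> x) = (c * d) \<odot> x"
  using smult_assoc1[of c d x] by simp

lemma csmult_one [simp]: "x \<in> carrier A \<Longrightarrow> 1 \<odot> x = x"
  using smult_one[of x] by simp

lemma csmult_0_left [simp]: "x \<in> carrier A \<Longrightarrow> 0 \<odot> x = \<zero>"
  using smult_l_null[of x] by simp

lemma csmult_0_right [simp]: "c \<odot> \<zero> = \<zero>"
  using smult_r_null[of c] by simp

lemma csmult_minus_one: "x \<in> carrier A \<Longrightarrow> (- 1) \<odot> x = \<ominus> x"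
  using csmult_add[of x "-1" 1] by (simp add: minus_equality)

text \<open>Rewrite rules for sums nested to the right: the versions with \<open>y\<close> cancel a
  pair in front of a remaining sum. The variants with coefficient 1 follow separately, since a bare
  \<open>x\<close> does not match \<open>c \<odot> x\<close>.\<close>

lemma csmult_cancel:
  assumes "x \<in> carrier A"
  shows "c \<odot> x \<oplus> (- c) \<odot> x = \<zero>" "(- c) \<odot> x \<oplus> c \<odot> x = \<zero>"
    and "y \<in> carrier A \<Longrightarrow> c \<odot> x \<oplus> ((- c) \<odot> x \<oplus> y) = y"
    and "y \<in> carrier A \<Longrightarrow> (- c) \<odot> x \<oplus> (c \<odot> x \<oplus> y) = y"
proof -
  show 1: "c \<odot> x \<oplus> (- c) \<odot> x = \<zero>" "(- c) \<odot> x \<oplus> c \<odot> x = \<zero>"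
    using csmult_add[OF assms, of c "- c"] csmult_add[OF assms, of "- c" c] assms by simp_all
  show "c \<odot> x \<oplus> ((- c) \<odot> x \<oplus> y) = y" "(- c) \<odot> x \<oplus> (c \<odot> x \<oplus> y) = y" if "y \<in> carrier A"
    using assms that by (simp_all add: a_assoc[symmetric] 1)
qed

lemma csmult_cancel_one:
  assumes "x \<in> carrier A"
  shows "x \<oplus> (- 1) \<odot> x = \<zero>" "(- 1) \<odot> x \<oplus> x = \<zero>"
    and "y \<in> carrier A \<Longrightarrow> x \<oplus> ((- 1) \<odot> x \<oplus> y) = y"
    and "y \<in> carrier A \<Longrightarrow> (- 1) \<odot> x \<oplus> (x \<oplus> y) = y"
  using csmult_cancel[where x = x and c = 1] assms by simp_all

lemmas csmult_cancels = csmult_cancel csmult_cancel_one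

end

text \<open>Additive inverses come from the scalar action: (-1) x + 1 x = 0 x = 0.\<close>

lemma calgebraI:
  fixes A :: "'a star_alg" (structure)
  assumes "\<zero> \<in> carrier A" "\<one> \<in> carrier A"
    and "\<And>x y. x \<in> carrier A \<Longrightarrow> y \<in> carrier A \<Longrightarrow> x \<oplus> y \<in> carrier A"
    and "\<And>x y. x \<in> carrier A \<Longrightarrow> y \<in> carrier A \<Longrightarrow> x \<otimes> y \<in> carrier A"
    and "\<And>c x. x \<in> carrier A \<Longrightarrow> c \<odot> x \<in> carrier A"
    and "\<And>x y z. x \<in> carrier A \<Longrightarrow> y \<in> carrier A \<Longrightarrow> z \<in> carrier A \<Longrightarrow> (x \<oplus> y) \<oplus> z = x \<oplus> (y \<oplus> z)"
    and "\<And>x y. x \<in> carrier A \<Longrightarrow> y \<in> carrier A \<Longrightarrow> x \<oplus> y = y \<oplus> x"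
    and "\<And>x. x \<in> carrier A \<Longrightarrow> \<zero> \<oplus> x = x"
    and "\<And>x y z. x \<in> carrier A \<Longrightarrow> y \<in> carrier A \<Longrightarrow> z \<in> carrier A \<Longrightarrow> (x \<otimes> y) \<otimes> z = x \<otimes> (y \<otimes> z)"
    and "\<And>x. x \<in> carrier A \<Longrightarrow> \<one> \<otimes> x = x" "\<And>x. x \<in> carrier A \<Longrightarrow> x \<otimes> \<one> = x"
    and "\<And>x y z. x \<in> carrier A \<Longrightarrow> y \<in> carrier A \<Longrightarrow> z \<in> carrier A \<Longrightarrow> (x \<oplus> y) \<otimes> z = x \<otimes> z \<oplus> y \<otimes> z"
    and "\<And>x y z. x \<in> carrier A \<Longrightarrow> y \<in> carrier A \<Longrightarrow> z \<in> carrier A \<Longrightarrow> z \<otimes> (x \<oplus> y) = z \<otimes> x \<oplus> z \<otimes> y"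
    and "\<And>c d x. x \<in> carrier A \<Longrightarrow> (c + d) \<odot> x = c \<odot> x \<oplus> d \<odot> x"
    and "\<And>c x y. x \<in> carrier A \<Longrightarrow> y \<in> carrier A \<Longrightarrow> c \<odot> (x \<oplus> y) = c \<odot> x \<oplus> c \<odot> y"
    and "\<And>c d x. x \<in> carrier A \<Longrightarrow> c \<odot> (d \<odot> x) = (c * d) \<odot> x"
    and "\<And>x. x \<in> carrier A \<Longrightarrow> 1 \<odot> x = x" "\<And>x. x \<in> carrier A \<Longrightarrow> 0 \<odot> x = \<zero>"
    and "\<And>c x y. x \<in> carrier A \<Longrightarrow> y \<in> carrier A \<Longrightarrow> (c \<odot> x) \<otimes> y = c \<odot> (x \<otimes> y)"
    and "\<And>c x y. x \<in> carrier A \<Longrightarrow> y \<in> carrier A \<Longrightarrow> x \<otimes> (c \<odot> y) = c \<odot> (x \<otimes> y)"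
  shows "calgebra A"
proof -
  have ab: "abelian_group A"
  proof (rule abelian_groupI)
    fix x assume x: "x \<in> carrier A"
    have "(- 1) \<odot> x \<oplus> x = (- 1) \<odot> x \<oplus> 1 \<odot> x" using x assms by simp
    also have "\<dots> = \<zero>" using assms(14)[OF x, of "-1" 1] assms(18)[OF x] by simp
    finally show "\<exists>y\<in>carrier A. y \<oplus> x = \<zero>" using assms(5)[OF x] by blast
  qed (use assms in auto)
  have "ring A"
    by (rule ringI[OF ab monoidI]) (use assms in auto)
  moreover have "Module.module complex_alg A"
    by (intro module.intro module_axioms.intro cring_complex_alg ab) (use assms in auto)
  ultimately show ?thesis
    by (intro calgebra.intro calgebra_axioms.intro) (use assms in auto)
qed

sublocale star_algebra \<subseteq> calgebra A
  by unfold_locales (auto simp: smult_mult_left smult_mult_right)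

lemma (in star_algebra) star_one: "star A \<one> = \<one>"
  using star_mult[of \<one> "star A \<one>"] by (simp add: star_star star_closed)

section \<open>Linear maps, algebra homomorphisms and transport along surjections\<close>

lemma lin_mapI:
  assumes "\<And>x. x \<in> carrier A \<Longrightarrow> f x \<in> carrier B"
    and "\<And>x y. x \<in> carrier A \<Longrightarrow> y \<in> carrier A \<Longrightarrow> f (x \<oplus>\<^bsub>A\<^esub> y) = f x \<oplus>\<^bsub>B\<^esub> f y"
    and "\<And>c x. x \<in> carrier A \<Longrightarrow> f (c \<odot>\<^bsub>A\<^esub> x) = c \<odot>\<^bsub>B\<^esub> f x"
  shows "lin_map A B f"
  using assms by (auto simp: lin_map_def)

lemma lin_mapD:
  assumes "lin_map A B f"
  shows "x \<in> carrier A \<Longrightarrow> f x \<in> carrier B"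
    and "x \<in> carrier A \<Longrightarrow> y \<in> carrier A \<Longrightarrow> f (x \<oplus>\<^bsub>A\<^esub> y) = f x \<oplus>\<^bsub>B\<^esub> f y"
    and "x \<in> carrier A \<Longrightarrow> f (c \<odot>\<^bsub>A\<^esub> x) = c \<odot>\<^bsub>B\<^esub> f x"
  using assms by (auto simp: lin_map_def)

lemma lin_map_zero:
  assumes "calgebra A" "calgebra B" "lin_map A B f"
  shows "f \<zero>\<^bsub>A\<^esub> = \<zero>\<^bsub>B\<^esub>"
proof -
  interpret A: calgebra A by fact
  interpret B: calgebra B by fact
  show ?thesis
    using lin_mapD(1,3)[OF assms(3), of "\<zero>\<^bsub>A\<^esub>"] B.csmult_0_left by (metis A.csmult_0_right A.zero_closed)
qed

lemma lin_map_comp: "lin_map A B f \<Longrightarrow> lin_map B C g \<Longrightarrow> lin_map A C (\<lambda>x. g (f x))"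
  by (auto simp: lin_map_def Pi_iff)

lemma alg_homI:
  assumes "lin_map A B f" "f \<one>\<^bsub>A\<^esub> = \<one>\<^bsub>B\<^esub>"
    and "\<And>x y. x \<in> carrier A \<Longrightarrow> y \<in> carrier A \<Longrightarrow> f (x \<otimes>\<^bsub>A\<^esub> y) = f x \<otimes>\<^bsub>B\<^esub> f y"
  shows "alg_hom A B f"
  using assms by (auto simp: alg_hom_def lin_map_def ring_hom_def)

lemma alg_homD:
  assumes "alg_hom A B f"
  shows "lin_map A B f"
    and "f \<one>\<^bsub>A\<^esub> = \<one>\<^bsub>B\<^esub>"
    and "x \<in> carrier A \<Longrightarrow> y \<in> carrier A \<Longrightarrow> f (x \<otimes>\<^bsub>A\<^esub> y) = f x \<otimes>\<^bsub>B\<^esub> f y"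
    and "x \<in> carrier A \<Longrightarrow> f x \<in> carrier B"
    and "x \<in> carrier A \<Longrightarrow> y \<in> carrier A \<Longrightarrow> f (x \<oplus>\<^bsub>A\<^esub> y) = f x \<oplus>\<^bsub>B\<^esub> f y"
    and "x \<in> carrier A \<Longrightarrow> f (c \<odot>\<^bsub>A\<^esub> x) = c \<odot>\<^bsub>B\<^esub> f x"
  using assms by (auto simp: alg_hom_def lin_map_def ring_hom_def)

lemma alg_hom_comp: "alg_hom A B f \<Longrightarrow> alg_hom B C g \<Longrightarrow> alg_hom A C (\<lambda>x. g (f x))"
  by (auto simp: alg_hom_def lin_map_def ring_hom_def Pi_iff)

lemma lin_map_id [intro]: "lin_map A A id"
  by (simp add: lin_map_def)

lemma alg_hom_id [intro]: "alg_hom A A id"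
  by (auto simp: alg_hom_def ring_hom_def)

text \<open>Equational axioms pass to surjective images; this yields the axioms for quotients all at
  once. Preservation of zero is a hypothesis because \<open>B\<close> is still a bare record, whose
  \<open>zero\<close> is not yet tied to its addition.\<close>

lemma calgebra_image:
  assumes "calgebra A" "alg_hom A B f" and sur: "f ` carrier A = carrier B" and z: "f \<zero>\<^bsub>A\<^esub> = \<zero>\<^bsub>B\<^esub>"
  shows "calgebra B"
proof -
  interpret A: calgebra A by fact
  note h = alg_homD(2,3,5,6)[OF assms(2), symmetric]
  note c = alg_homD(4)[OF assms(2)]
  have [intro]: "f \<one>\<^bsub>A\<^esub> \<in> carrier B" "f \<zero>\<^bsub>A\<^esub> \<in> carrier B" by (auto intro: c)
  show ?thesis
    by (rule calgebraI; (unfold sur[symmetric])?; (elim imageE)?; (hypsubst)?)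
      (auto simp: h z[symmetric] A.csmult_add A.csmult_distrib A.csmult_csmult
        A.csmult_mult_left A.csmult_mult_right A.m_assoc A.a_assoc A.l_distr A.r_distr
        intro!: imageI arg_cong[where f = f] A.a_comm)
qed

lemma star_algebra_image:
  assumes "star_algebra A" "star_hom A B f" and sur: "f ` carrier A = carrier B" and z: "f \<zero>\<^bsub>A\<^esub> = \<zero>\<^bsub>B\<^esub>"
  shows "star_algebra B"
proof -
  interpret A: star_algebra A by fact
  have f: "alg_hom A B f" and s: "\<And>x. x \<in> carrier A \<Longrightarrow> star B (f x) = f (star A x)"
    using assms(2) by (auto simp: star_hom_def)
  interpret B: calgebra B
    by (rule calgebra_image[OF A.calgebra_axioms f sur z])
  note h = alg_homD(3,5,6)[OF f, symmetric]
  show ?thesis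
    by (intro star_algebra.intro B.module_axioms B.ring_axioms star_algebra_axioms.intro
          B.csmult_mult_left B.csmult_mult_right;
        (unfold sur[symmetric])?; (elim imageE)?; (hypsubst)?)
      (auto simp: h s A.star_closed A.star_add A.star_smult A.star_mult A.star_star)
qed

section \<open>Monoid algebras\<close>

lemma monoid_alg_simps [simp]:
  "carrier (monoid_alg G s) = {p. Poly_Mapping.keys p \<subseteq> carrier G}"
  "one (monoid_alg G s) = Poly_Mapping.single \<one>\<^bsub>G\<^esub> 1"
  "zero (monoid_alg G s) = 0" "add (monoid_alg G s) = (+)" "smult (monoid_alg G s) = scale"
  by (simp_all add: monoid_alg_def)

lemma scale_single [simp]: "scale c (Poly_Mapping.single k d) = Poly_Mapping.single k (c * d)"
  by (rule poly_mapping_eqI) (simp add: lookup_single when_def)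

lemma keys_scale: "Poly_Mapping.keys (scale c p) \<subseteq> Poly_Mapping.keys p"
  by (auto simp: in_keys_iff)

lemma keys_add_subset: "Poly_Mapping.keys p \<subseteq> K \<Longrightarrow> Poly_Mapping.keys r \<subseteq> K \<Longrightarrow>
    Poly_Mapping.keys (p + r) \<subseteq> K"
  using keys_add[of p r] by blast

lemma poly_mapping_sum_single: "(\<Sum>k\<in>Poly_Mapping.keys p. Poly_Mapping.single k (Poly_Mapping.lookup p k)) = p"
  by (rule poly_mapping_eqI)
    (auto simp: lookup_sum lookup_single when_def in_keys_iff sum.delta)

text \<open>Reduces statements linear in \<open>p\<close> to basis elements. The step adds two
  arbitrary mappings supported in \<open>K\<close>, so that additivity lemmas apply as they stand,
  with no bookkeeping of fresh keys.\<close>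

lemma poly_mapping_keys_induct [consumes 1, case_names zero single add]:
  fixes p :: "'k \<Rightarrow>\<^sub>0 complex"
  assumes "Poly_Mapping.keys p \<subseteq> K" and "P 0"
    and "\<And>k c. k \<in> K \<Longrightarrow> P (Poly_Mapping.single k c)"
    and "\<And>p r. Poly_Mapping.keys p \<subseteq> K \<Longrightarrow> Poly_Mapping.keys r \<subseteq> K \<Longrightarrow> P p \<Longrightarrow> P r \<Longrightarrow> P (p + r)"
  shows "P p"
proof -
  have "Poly_Mapping.keys (\<Sum>k\<in>L. Poly_Mapping.single k (f k)) \<subseteq> K \<and> P (\<Sum>k\<in>L. Poly_Mapping.single k (f k))"
    if "finite L" "L \<subseteq> K" for L and f :: "'k \<Rightarrow> complex"
    using that
  proof (induction L)
    case (insert k L)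
    have "Poly_Mapping.keys (Poly_Mapping.single k (f k)) \<subseteq> K" using insert.prems by simp
    with insert show ?case
      using assms(3)[of k "f k"] assms(4) by (simp add: keys_add_subset)
  qed (simp add: assms(2))
  from this[OF finite_keys assms(1), of "Poly_Mapping.lookup p"] show ?thesis
    by (simp add: poly_mapping_sum_single)
qed

text \<open>The convolutions of \<open>p\<close>, \<open>p'\<close> and \<open>p + p'\<close> sum
  over different supports. Padding with zero coefficients to a common finite set makes them
  comparable, which gives biadditivity.\<close>

lemma monoid_alg_mult_superset:
  assumes "finite K" "finite L" "Poly_Mapping.keys p \<subseteq> K" "Poly_Mapping.keys r \<subseteq> L"
  shows "p \<otimes>\<^bsub>monoid_alg G s\<^esub> r = (\<Sum>k\<in>K. \<Sum>l\<in>L.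
    Poly_Mapping.single (k \<otimes>\<^bsub>G\<^esub> l) (Poly_Mapping.lookup p k * Poly_Mapping.lookup r l))"
proof -
  have "p \<otimes>\<^bsub>monoid_alg G s\<^esub> r = (\<Sum>k\<in>K. \<Sum>l\<in>Poly_Mapping.keys r.
      Poly_Mapping.single (k \<otimes>\<^bsub>G\<^esub> l) (Poly_Mapping.lookup p k * Poly_Mapping.lookup r l))"
    unfolding monoid_alg_def
    by (auto intro!: sum.mono_neutral_left assms sum.neutral simp: in_keys_iff)
  also have "\<dots> = (\<Sum>k\<in>K. \<Sum>l\<in>L.
      Poly_Mapping.single (k \<otimes>\<^bsub>G\<^esub> l) (Poly_Mapping.lookup p k * Poly_Mapping.lookup r l))"
    by (rule sum.cong[OF refl], rule sum.mono_neutral_left) (use assms in \<open>auto simp: in_keys_iff\<close>)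
  finally show ?thesis .
qed

lemma monoid_alg_add_mult:
  "(p + p') \<otimes>\<^bsub>monoid_alg G s\<^esub> r = p \<otimes>\<^bsub>monoid_alg G s\<^esub> r + p' \<otimes>\<^bsub>monoid_alg G s\<^esub> r"
  by (simp add: monoid_alg_mult_superset[of "Poly_Mapping.keys p \<union> Poly_Mapping.keys p'" "Poly_Mapping.keys r"]
      keys_add lookup_add single_add distrib_right sum.distrib)

lemma monoid_alg_mult_add:
  "r \<otimes>\<^bsub>monoid_alg G s\<^esub> (p + p') = r \<otimes>\<^bsub>monoid_alg G s\<^esub> p + r \<otimes>\<^bsub>monoid_alg G s\<^esub> p'"
  by (simp add: monoid_alg_mult_superset[of "Poly_Mapping.keys r" "Poly_Mapping.keys p \<union> Poly_Mapping.keys p'"]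
      keys_add lookup_add single_add distrib_left sum.distrib)

lemma monoid_alg_single_mult_single [simp]:
  "Poly_Mapping.single k c \<otimes>\<^bsub>monoid_alg G s\<^esub> Poly_Mapping.single l d = Poly_Mapping.single (k \<otimes>\<^bsub>G\<^esub> l) (c * d)"
  by (simp add: monoid_alg_mult_superset[of "{k}" "{l}"])

lemma monoid_alg_zero_mult [simp]: "0 \<otimes>\<^bsub>monoid_alg G s\<^esub> p = 0" "p \<otimes>\<^bsub>monoid_alg G s\<^esub> 0 = 0"
  by (simp_all add: monoid_alg_def)

lemma monoid_alg_scale_mult:
  "scale c p \<otimes>\<^bsub>monoid_alg G s\<^esub> r = scale c (p \<otimes>\<^bsub>monoid_alg G s\<^esub> r)"
  "p \<otimes>\<^bsub>monoid_alg G s\<^esub> scale c r = scale c (p \<otimes>\<^bsub>monoid_alg G s\<^esub> r)"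
  by (simp_all add: monoid_alg_mult_superset[of "Poly_Mapping.keys p" "Poly_Mapping.keys r"]
      keys_scale pm.scale_sum_right mult_ac)

lemma monoid_alg_mult_closed:
  assumes "monoid G" "Poly_Mapping.keys p \<subseteq> carrier G" "Poly_Mapping.keys r \<subseteq> carrier G"
  shows "Poly_Mapping.keys (p \<otimes>\<^bsub>monoid_alg G s\<^esub> r) \<subseteq> carrier G"
  using assms(2)
proof (induction p rule: poly_mapping_keys_induct)
  case (single k c)
  interpret monoid G by fact
  from assms(3) show ?case
    by (induction r rule: poly_mapping_keys_induct)
      (use single in \<open>simp_all add: monoid_alg_mult_add keys_add_subset\<close>)
qed (simp_all add: monoid_alg_add_mult keys_add_subset)

lemma monoid_alg_mult_assoc:
  assumes "monoid G" "Poly_Mapping.keys p \<subseteq> carrier G" "Poly_Mapping.keys r \<subseteq> carrier G"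
    "Poly_Mapping.keys t \<subseteq> carrier G"
  shows "p \<otimes>\<^bsub>monoid_alg G s\<^esub> r \<otimes>\<^bsub>monoid_alg G s\<^esub> t = p \<otimes>\<^bsub>monoid_alg G s\<^esub> (r \<otimes>\<^bsub>monoid_alg G s\<^esub> t)"
  using assms(2)
proof (induction p rule: poly_mapping_keys_induct)
  case (single k c)
  from assms(3) show ?case
  proof (induction r rule: poly_mapping_keys_induct)
    case (single l d)
    interpret monoid G by fact
    from assms(4) show ?case
      by (induction t rule: poly_mapping_keys_induct)
        (use single \<open>k \<in> carrier G\<close> in \<open>simp_all add: monoid_alg_mult_add m_assoc mult.assoc\<close>)
  qed (simp_all add: monoid_alg_add_mult monoid_alg_mult_add)
qed (simp_all add: monoid_alg_add_mult)

lemma calgebra_monoid_alg: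
  assumes "monoid G"
  shows "calgebra (monoid_alg G s)"
proof -
  interpret monoid G by fact
  have one: "Poly_Mapping.single \<one>\<^bsub>G\<^esub> 1 \<otimes>\<^bsub>monoid_alg G s\<^esub> p = p \<and> p \<otimes>\<^bsub>monoid_alg G s\<^esub> Poly_Mapping.single \<one>\<^bsub>G\<^esub> 1 = p"
    if "Poly_Mapping.keys p \<subseteq> carrier G" for p
    using that by (induction p rule: poly_mapping_keys_induct)
      (simp_all add: monoid_alg_mult_add monoid_alg_add_mult)
  show ?thesis
    by (rule calgebraI)
      (use assms one in \<open>simp_all add: monoid_alg_mult_closed monoid_alg_mult_assoc monoid_alg_add_mult monoid_alg_mult_add
        monoid_alg_scale_mult keys_add_subset keys_scale[THEN subset_trans] algebra_simps pm.scale_left_distrib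
        pm.scale_right_distrib\<close>)
qed

lemma monoid_alg_star_superset:
  assumes "finite K" "Poly_Mapping.keys p \<subseteq> K"
  shows "star (monoid_alg G s) p = (\<Sum>k\<in>K. Poly_Mapping.single (s k) (cnj (Poly_Mapping.lookup p k)))"
  unfolding monoid_alg_def
  by (simp, rule sum.mono_neutral_left) (use assms in \<open>auto simp: in_keys_iff\<close>)

lemma monoid_alg_star_add:
  "star (monoid_alg G s) (p + r) = star (monoid_alg G s) p + star (monoid_alg G s) r"
  by (simp add: monoid_alg_star_superset[of "Poly_Mapping.keys p \<union> Poly_Mapping.keys r"]
      keys_add lookup_add single_add sum.distrib)

lemma monoid_alg_star_zero [simp]: "star (monoid_alg G s) 0 = 0"
  by (simp add: monoid_alg_def)

lemma monoid_alg_star_single [simp]: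
  "star (monoid_alg G s) (Poly_Mapping.single k c) = Poly_Mapping.single (s k) (cnj c)"
  by (simp add: monoid_alg_star_superset[of "{k}"])

lemma monoid_alg_star_scale:
  "star (monoid_alg G s) (scale c p) = scale (cnj c) (star (monoid_alg G s) p)"
  by (simp add: monoid_alg_star_superset[of "Poly_Mapping.keys p"] keys_scale pm.scale_sum_right)

lemma star_algebra_monoid_alg:
  assumes "monoid G" and cl: "\<And>k. k \<in> carrier G \<Longrightarrow> s k \<in> carrier G"
    and anti: "\<And>k l. k \<in> carrier G \<Longrightarrow> l \<in> carrier G \<Longrightarrow> s (k \<otimes>\<^bsub>G\<^esub> l) = s l \<otimes>\<^bsub>G\<^esub> s k"
    and invol: "\<And>k. k \<in> carrier G \<Longrightarrow> s (s k) = k"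
  shows "star_algebra (monoid_alg G s)"
proof -
  interpret A: calgebra "monoid_alg G s" by (rule calgebra_monoid_alg) fact
  show ?thesis
  proof (intro star_algebra.intro A.module_axioms A.ring_axioms star_algebra_axioms.intro
      A.csmult_mult_left A.csmult_mult_right)
    fix p r assume "p \<in> carrier (monoid_alg G s)" "r \<in> carrier (monoid_alg G s)"
    then have p: "Poly_Mapping.keys p \<subseteq> carrier G" and r: "Poly_Mapping.keys r \<subseteq> carrier G" by simp_all
    from p show "star (monoid_alg G s) (p \<otimes>\<^bsub>monoid_alg G s\<^esub> r) =
        star (monoid_alg G s) r \<otimes>\<^bsub>monoid_alg G s\<^esub> star (monoid_alg G s) p"
    proof (induction p rule: poly_mapping_keys_induct)
      case (single k c)
      from r show ?case
        by (induction r rule: poly_mapping_keys_induct)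
          (use single in \<open>simp_all add: monoid_alg_mult_add monoid_alg_add_mult monoid_alg_star_add anti mult.commute\<close>)
    qed (simp_all add: monoid_alg_mult_add monoid_alg_add_mult monoid_alg_star_add)
  next
    fix p assume "p \<in> carrier (monoid_alg G s)"
    then have p: "Poly_Mapping.keys p \<subseteq> carrier G" by simp
    then have "Poly_Mapping.keys (star (monoid_alg G s) p) \<subseteq> carrier G"
      by (induction p rule: poly_mapping_keys_induct)
        (simp_all add: cl monoid_alg_star_add keys_add_subset)
    then show "star (monoid_alg G s) p \<in> carrier (monoid_alg G s)" by simp
    from p show "star (monoid_alg G s) (star (monoid_alg G s) p) = p"
      by (induction p rule: poly_mapping_keys_induct) (simp_all add: invol monoid_alg_star_add)
  qed (simp_all add: monoid_alg_star_add monoid_alg_star_scale)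
qed

section \<open>Linear extension from a basis\<close>

definition lin_ext :: "'m star_alg \<Rightarrow> ('k \<Rightarrow> 'm) \<Rightarrow> ('k \<Rightarrow>\<^sub>0 complex) \<Rightarrow> 'm" where
  "lin_ext M f p = finsum M (\<lambda>k. Poly_Mapping.lookup p k \<odot>\<^bsub>M\<^esub> f k) (Poly_Mapping.keys p)"

context
  fixes M :: "'m star_alg" and f :: "'k \<Rightarrow> 'm" and K :: "'k set"
  assumes M: "calgebra M" and f: "\<And>k. k \<in> K \<Longrightarrow> f k \<in> carrier M"
begin

interpretation M: calgebra M by (rule M)

lemma lin_ext_superset:
  assumes "finite L" "Poly_Mapping.keys p \<subseteq> L" "L \<subseteq> K"
  shows "lin_ext M f p = finsum M (\<lambda>k. Poly_Mapping.lookup p k \<odot>\<^bsub>M\<^esub> f k) L"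
  unfolding lin_ext_def
  by (rule M.add.finprod_mono_neutral_cong_left) (use assms f in \<open>auto simp: in_keys_iff subset_iff\<close>)

lemma lin_ext_zero: "lin_ext M f 0 = \<zero>\<^bsub>M\<^esub>"
  by (simp add: lin_ext_def)

lemma lin_ext_single: "k \<in> K \<Longrightarrow> lin_ext M f (Poly_Mapping.single k c) = c \<odot>\<^bsub>M\<^esub> f k"
  by (simp add: lin_ext_superset[of "{k}"] f)

lemma lin_ext_closed: "Poly_Mapping.keys p \<subseteq> K \<Longrightarrow> lin_ext M f p \<in> carrier M"
  by (auto simp: lin_ext_def f intro!: M.finsum_closed)

lemma lin_ext_add:
  assumes "Poly_Mapping.keys p \<subseteq> K" "Poly_Mapping.keys r \<subseteq> K"
  shows "lin_ext M f (p + r) = lin_ext M f p \<oplus>\<^bsub>M\<^esub> lin_ext M f r"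
proof -
  let ?L = "Poly_Mapping.keys p \<union> Poly_Mapping.keys r"
  have "lin_ext M f (p + r) = finsum M (\<lambda>k. Poly_Mapping.lookup p k \<odot>\<^bsub>M\<^esub> f k \<oplus>\<^bsub>M\<^esub> Poly_Mapping.lookup r k \<odot>\<^bsub>M\<^esub> f k) ?L"
    unfolding lin_ext_superset[of ?L "p + r", OF _ keys_add, simplified, OF conjI[OF assms]] lookup_add
    by (rule M.finsum_cong') (use assms f in \<open>auto simp: M.csmult_add\<close>)
  also have "\<dots> = lin_ext M f p \<oplus>\<^bsub>M\<^esub> lin_ext M f r"
    using assms f by (subst M.finsum_addf) (auto simp: lin_ext_superset[of ?L])
  finally show ?thesis .
qed

lemma lin_ext_scale:
  assumes "Poly_Mapping.keys p \<subseteq> K"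
  shows "lin_ext M f (scale c p) = c \<odot>\<^bsub>M\<^esub> lin_ext M f p"
  using assms
proof (induction p rule: poly_mapping_keys_induct)
  case (add p r)
  then show ?case
    by (simp add: pm.scale_right_distrib lin_ext_add keys_scale[THEN subset_trans] lin_ext_closed M.csmult_distrib)
qed (simp_all add: lin_ext_zero lin_ext_single f M.csmult_csmult)

text \<open>Universal property of the monoid algebra. For the monoid of words it says that
  evaluating noncommutative polynomials at elements of \<open>M\<close> is multiplicative.\<close>

lemma lin_ext_mult:
  assumes G: "monoid G" "carrier G = K"
    and mult: "\<And>k l. k \<in> K \<Longrightarrow> l \<in> K \<Longrightarrow> f (k \<otimes>\<^bsub>G\<^esub> l) = f k \<otimes>\<^bsub>M\<^esub> f l"
    and p: "Poly_Mapping.keys p \<subseteq> K" and r: "Poly_Mapping.keys r \<subseteq> K"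
  shows "lin_ext M f (p \<otimes>\<^bsub>monoid_alg G s\<^esub> r) = lin_ext M f p \<otimes>\<^bsub>M\<^esub> lin_ext M f r"
proof -
  interpret G: monoid G by fact
  note cl = monoid_alg_mult_closed[OF G(1), unfolded G(2)] G.m_closed[unfolded G(2)]
  from p show ?thesis
  proof (induction p rule: poly_mapping_keys_induct)
    case (single k c)
    from r show ?case
    proof (induction r rule: poly_mapping_keys_induct)
      case (single l d)
      with \<open>k \<in> K\<close> show ?case
        by (simp add: lin_ext_single cl mult f M.csmult_mult_left M.csmult_mult_right M.csmult_csmult mult.commute)
    next
      case (add p r)
      with \<open>k \<in> K\<close> show ?case
        by (simp add: monoid_alg_mult_add lin_ext_add cl lin_ext_closed M.r_distr)
    qed (simp add: lin_ext_zero lin_ext_single \<open>k \<in> K\<close> f)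
  next
    case (add p p')
    with r show ?case
      by (simp add: monoid_alg_add_mult lin_ext_add cl lin_ext_closed M.l_distr)
  qed (simp add: lin_ext_zero r lin_ext_closed)
qed

end

section \<open>Quotients\<close>

lemma quot_alg_simps:
  "carrier (quot_alg A I) = a_rcosets\<^bsub>A\<^esub> I" "one (quot_alg A I) = I +>\<^bsub>A\<^esub> \<one>\<^bsub>A\<^esub>"
  "zero (quot_alg A I) = I" "add (quot_alg A I) = set_add A" "mult (quot_alg A I) = rcoset_mult A I"
  by (simp_all add: quot_alg_def)

context
  fixes A :: "'a star_alg" and I :: "'a set"
  assumes A: "calgebra A" and I: "ideal I A"
begin

interpretation A: calgebra A by (rule A)
interpretation ideal I A by (rule I)

text \<open>A ring ideal is a linear subspace because c x = (c 1) x.\<close>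

lemma ideal_smult_closed: "x \<in> I \<Longrightarrow> c \<odot>\<^bsub>A\<^esub> x \<in> I"
  using I_l_closed[of x "c \<odot>\<^bsub>A\<^esub> \<one>\<^bsub>A\<^esub>"] by (simp add: A.csmult_mult_left)

lemma quot_alg_carrier: "carrier (quot_alg A I) = (\<lambda>x. I +>\<^bsub>A\<^esub> x) ` carrier A"
  by (auto simp: quot_alg_simps A_RCOSETS_def')

lemma quot_alg_mem_coset: "x \<in> carrier A \<Longrightarrow> y \<in> I +>\<^bsub>A\<^esub> x \<longleftrightarrow> y \<in> carrier A \<and> I +>\<^bsub>A\<^esub> y = I +>\<^bsub>A\<^esub> x"
  by (metis a_elemrcos_carrier a_rcos_self a_repr_independence' is_additive_subgroup additive_subgroup.a_subgroup)

text \<open>\<open>quot_alg\<close> defines its scalar action and its star as unions over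
  representatives; all the cosets united are equal. Only additivity of \<open>f\<close> is required,
  so the antilinear star is covered together with the scalar action.\<close>

lemma quot_alg_UN:
  assumes "x \<in> carrier A" "\<And>y. y \<in> carrier A \<Longrightarrow> f y \<in> carrier A"
    and "\<And>y. y \<in> I \<Longrightarrow> f y \<in> I"
    and "\<And>y z. y \<in> carrier A \<Longrightarrow> z \<in> carrier A \<Longrightarrow> f (y \<oplus>\<^bsub>A\<^esub> z) = f y \<oplus>\<^bsub>A\<^esub> f z"
  shows "(\<Union>y\<in>I +>\<^bsub>A\<^esub> x. I +>\<^bsub>A\<^esub> f y) = I +>\<^bsub>A\<^esub> f x"
proof -
  have "I +>\<^bsub>A\<^esub> f y = I +>\<^bsub>A\<^esub> f x" if y: "y \<in> I +>\<^bsub>A\<^esub> x" for y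
  proof -
    obtain i where i: "i \<in> I" "y = i \<oplus>\<^bsub>A\<^esub> x"
      using y by (auto simp: a_r_coset_def')
    have "f y = f i \<oplus>\<^bsub>A\<^esub> f x" using i assms by simp
    then have "f y \<in> I +>\<^bsub>A\<^esub> f x" using assms(3)[OF i(1)] by (auto simp: a_r_coset_def')
    then show ?thesis using quot_alg_mem_coset assms(1,2) by blast
  qed
  then show ?thesis using a_rcos_self[OF assms(1)] by blast
qed

lemma quot_alg_smult: "x \<in> carrier A \<Longrightarrow> c \<odot>\<^bsub>quot_alg A I\<^esub> (I +>\<^bsub>A\<^esub> x) = I +>\<^bsub>A\<^esub> (c \<odot>\<^bsub>A\<^esub> x)"
  by (simp add: quot_alg_def, rule quot_alg_UN) (simp_all add: ideal_smult_closed A.csmult_distrib)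

lemma quot_alg_proj: "alg_hom A (quot_alg A I) (\<lambda>x. I +>\<^bsub>A\<^esub> x)"
  by (intro alg_homI lin_mapI)
    (simp_all add: quot_alg_carrier quot_alg_smult,
     simp_all add: quot_alg_simps rcoset_mult_add a_rcos_sum)

lemma quot_alg_zero: "I +>\<^bsub>A\<^esub> \<zero>\<^bsub>A\<^esub> = \<zero>\<^bsub>quot_alg A I\<^esub>"
  by (simp add: quot_alg_simps a_rcos_const)

lemma quot_alg_proj_eqI:
  assumes x: "x \<in> carrier A" and y: "y \<in> carrier A" and "x \<oplus>\<^bsub>A\<^esub> (- 1) \<odot>\<^bsub>A\<^esub> y \<in> I"
  shows "I +>\<^bsub>A\<^esub> x = I +>\<^bsub>A\<^esub> y"
proof -
  have "x = x \<oplus>\<^bsub>A\<^esub> (- 1) \<odot>\<^bsub>A\<^esub> y \<oplus>\<^bsub>A\<^esub> y"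
    using x y A.csmult_add[of y "- 1" 1] by (simp add: A.a_assoc)
  then have "x \<in> I +>\<^bsub>A\<^esub> y" using assms(3) by (auto simp: a_r_coset_def')
  then show ?thesis using quot_alg_mem_coset y by blast
qed

lemma calgebra_quot_alg: "calgebra (quot_alg A I)"
  by (rule calgebra_image[OF A quot_alg_proj]) (simp_all add: quot_alg_carrier quot_alg_zero)

lemma quot_alg_star:
  assumes "star_algebra A" "\<And>x. x \<in> I \<Longrightarrow> star A x \<in> I"
  shows "star_hom A (quot_alg A I) (\<lambda>x. I +>\<^bsub>A\<^esub> x)"
proof -
  interpret star_algebra A by fact
  have "(\<Union>y\<in>I +>\<^bsub>A\<^esub> x. I +>\<^bsub>A\<^esub> star A y) = I +>\<^bsub>A\<^esub> star A x" if "x \<in> carrier A" for x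
    by (rule quot_alg_UN) (simp_all add: that star_closed star_add assms(2))
  then show ?thesis
    using quot_alg_proj by (simp add: star_hom_def) (simp add: quot_alg_def)
qed

lemma star_algebra_quot_alg:
  assumes "star_algebra A" "\<And>x. x \<in> I \<Longrightarrow> star A x \<in> I"
  shows "star_algebra (quot_alg A I)"
  by (rule star_algebra_image[OF assms(1) quot_alg_star[OF assms]])
    (simp_all add: quot_alg_carrier quot_alg_zero)

text \<open>A linear map that vanishes on \<open>I\<close> is constant on each coset, so the image
  is a singleton and \<open>the_elem\<close> picks the common value.\<close>

lemma quot_alg_lift:
  assumes B: "calgebra B" and f: "lin_map A B f" and ker: "\<And>x. x \<in> I \<Longrightarrow> f x = \<zero>\<^bsub>B\<^esub>"
    and x: "x \<in> carrier A"
  shows "the_elem (f ` (I +>\<^bsub>A\<^esub> x)) = f x"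
proof -
  interpret B: calgebra B by fact
  have "f y = f x" if "y \<in> I +>\<^bsub>A\<^esub> x" for y
    using that x by (auto simp: a_r_coset_def' lin_mapD[OF f] ker)
  then have "f ` (I +>\<^bsub>A\<^esub> x) = {f x}" using a_rcos_self[OF x] by blast
  then show ?thesis by simp
qed

lemma
  assumes B: "calgebra B" and f: "lin_map A B f" and ker: "\<And>x. x \<in> I \<Longrightarrow> f x = \<zero>\<^bsub>B\<^esub>"
  shows quot_alg_lift_lin: "lin_map (quot_alg A I) B (\<lambda>X. the_elem (f ` X))"
    and quot_alg_lift_alg: "alg_hom A B f \<Longrightarrow> alg_hom (quot_alg A I) B (\<lambda>X. the_elem (f ` X))"
proof -
  note h = alg_homD(2,3,5,6)[OF quot_alg_proj, symmetric] quot_alg_lift[OF assms]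
  show l: "lin_map (quot_alg A I) B (\<lambda>X. the_elem (f ` X))"
    by (rule lin_mapI) (auto simp: quot_alg_carrier h lin_mapD[OF f])
  show "alg_hom (quot_alg A I) B (\<lambda>X. the_elem (f ` X))" if "alg_hom A B f"
    by (rule alg_homI[OF l]) (auto simp: quot_alg_carrier h alg_homD[OF that])
qed

end

section \<open>Tensor products of algebras\<close>

definition bilin :: "'a star_alg \<Rightarrow> 'b star_alg \<Rightarrow> 'm star_alg \<Rightarrow> ('a \<Rightarrow> 'b \<Rightarrow> 'm) \<Rightarrow> bool" where
  "bilin A B M f \<longleftrightarrow> (\<forall>a\<in>carrier A. lin_map B M (f a)) \<and> (\<forall>b\<in>carrier B. lin_map A M (\<lambda>a. f a b))"

lemma bilinI:
  assumes "\<And>a. a \<in> carrier A \<Longrightarrow> lin_map B M (f a)" "\<And>b. b \<in> carrier B \<Longrightarrow> lin_map A M (\<lambda>a. f a b)"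
  shows "bilin A B M f"
  using assms by (simp add: bilin_def)

lemma bilinD:
  assumes "bilin A B M f" "a \<in> carrier A" "b \<in> carrier B"
  shows "f a b \<in> carrier M"
    and "a' \<in> carrier A \<Longrightarrow> f (a \<oplus>\<^bsub>A\<^esub> a') b = f a b \<oplus>\<^bsub>M\<^esub> f a' b"
    and "b' \<in> carrier B \<Longrightarrow> f a (b \<oplus>\<^bsub>B\<^esub> b') = f a b \<oplus>\<^bsub>M\<^esub> f a b'"
    and "f (c \<odot>\<^bsub>A\<^esub> a) b = c \<odot>\<^bsub>M\<^esub> f a b"
    and "f a (c \<odot>\<^bsub>B\<^esub> b) = c \<odot>\<^bsub>M\<^esub> f a b"
  using assms by (auto simp: bilin_def lin_map_def)

lemma poly_mapping_diff_scale: "p - r = p + scale (- 1) r"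
  by (rule poly_mapping_eqI) (simp add: lookup_add lookup_minus)

text \<open>The spanning set of \<open>tensor_rels\<close> gets a name so that proofs can
  distinguish the four kinds of relation.\<close>

definition tensor_gens :: "'a star_alg \<Rightarrow> 'b star_alg \<Rightarrow> ('a \<times> 'b \<Rightarrow>\<^sub>0 complex) set" where
  "tensor_gens A B =
    {Poly_Mapping.single (a \<oplus>\<^bsub>A\<^esub> a', b) 1 - Poly_Mapping.single (a, b) 1 - Poly_Mapping.single (a', b) 1
      | a a' b. a \<in> carrier A \<and> a' \<in> carrier A \<and> b \<in> carrier B} \<union>
    {Poly_Mapping.single (a, b \<oplus>\<^bsub>B\<^esub> b') 1 - Poly_Mapping.single (a, b) 1 - Poly_Mapping.single (a, b') 1
      | a b b'. a \<in> carrier A \<and> b \<in> carrier B \<and> b' \<in> carrier B} \<union>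
    {Poly_Mapping.single (c \<odot>\<^bsub>A\<^esub> a, b) 1 - Poly_Mapping.single (a, b) c
      | c a b. a \<in> carrier A \<and> b \<in> carrier B} \<union>
    {Poly_Mapping.single (a, c \<odot>\<^bsub>B\<^esub> b) 1 - Poly_Mapping.single (a, b) c
      | c a b. a \<in> carrier A \<and> b \<in> carrier B}"

lemma tensor_rels_span: "tensor_rels A B = pm_span (tensor_gens A B)"
  by (simp add: tensor_rels_def tensor_gens_def)

lemma tensor_gens_cases [consumes 1, case_names add_left add_right smult_left smult_right]:
  assumes "p \<in> tensor_gens A B"
    and "\<And>a a' b. a \<in> carrier A \<Longrightarrow> a' \<in> carrier A \<Longrightarrow> b \<in> carrier B \<Longrightarrow>
      p = Poly_Mapping.single (a \<oplus>\<^bsub>A\<^esub> a', b) 1 - Poly_Mapping.single (a, b) 1 - Poly_Mapping.single (a', b) 1 \<Longrightarrow> P"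
    and "\<And>a b b'. a \<in> carrier A \<Longrightarrow> b \<in> carrier B \<Longrightarrow> b' \<in> carrier B \<Longrightarrow>
      p = Poly_Mapping.single (a, b \<oplus>\<^bsub>B\<^esub> b') 1 - Poly_Mapping.single (a, b) 1 - Poly_Mapping.single (a, b') 1 \<Longrightarrow> P"
    and "\<And>c a b. a \<in> carrier A \<Longrightarrow> b \<in> carrier B \<Longrightarrow>
      p = Poly_Mapping.single (c \<odot>\<^bsub>A\<^esub> a, b) 1 - Poly_Mapping.single (a, b) c \<Longrightarrow> P"
    and "\<And>c a b. a \<in> carrier A \<Longrightarrow> b \<in> carrier B \<Longrightarrow>
      p = Poly_Mapping.single (a, c \<odot>\<^bsub>B\<^esub> b) 1 - Poly_Mapping.single (a, b) c \<Longrightarrow> P"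
  shows P
  using assms unfolding tensor_gens_def by blast

text \<open>The coefficient \<open>d\<close> is there because multiplying a relation by
  \<open>single (x, y) e\<close> gives \<open>e\<close> times a relation of the same kind.\<close>

lemma tensor_rels_mem:
  fixes d :: complex
  shows "a \<in> carrier A \<Longrightarrow> a' \<in> carrier A \<Longrightarrow> b \<in> carrier B \<Longrightarrow>
      Poly_Mapping.single (a \<oplus>\<^bsub>A\<^esub> a', b) d - Poly_Mapping.single (a, b) d - Poly_Mapping.single (a', b) d \<in> tensor_rels A B"
    and "a \<in> carrier A \<Longrightarrow> b \<in> carrier B \<Longrightarrow> b' \<in> carrier B \<Longrightarrow>
      Poly_Mapping.single (a, b \<oplus>\<^bsub>B\<^esub> b') d - Poly_Mapping.single (a, b) d - Poly_Mapping.single (a, b') d \<in> tensor_rels A B"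
    and "a \<in> carrier A \<Longrightarrow> b \<in> carrier B \<Longrightarrow>
      Poly_Mapping.single (c \<odot>\<^bsub>A\<^esub> a, b) d - Poly_Mapping.single (a, b) (d * c) \<in> tensor_rels A B"
    and "a \<in> carrier A \<Longrightarrow> b \<in> carrier B \<Longrightarrow>
      Poly_Mapping.single (a, c \<odot>\<^bsub>B\<^esub> b) d - Poly_Mapping.single (a, b) (d * c) \<in> tensor_rels A B"
proof -
  have *: "scale d p \<in> tensor_rels A B" if "p \<in> tensor_gens A B" for p
    unfolding tensor_rels_span using that by (intro pm.span_scale pm.span_base)
  show "a \<in> carrier A \<Longrightarrow> a' \<in> carrier A \<Longrightarrow> b \<in> carrier B \<Longrightarrow>
      Poly_Mapping.single (a \<oplus>\<^bsub>A\<^esub> a', b) d - Poly_Mapping.single (a, b) d - Poly_Mapping.single (a', b) d \<in> tensor_rels A B"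
    using *[of "Poly_Mapping.single (a \<oplus>\<^bsub>A\<^esub> a', b) 1 - Poly_Mapping.single (a, b) 1 - Poly_Mapping.single (a', b) 1"]
    by (fastforce simp: pm.scale_right_diff_distrib tensor_gens_def)
  show "a \<in> carrier A \<Longrightarrow> b \<in> carrier B \<Longrightarrow> b' \<in> carrier B \<Longrightarrow>
      Poly_Mapping.single (a, b \<oplus>\<^bsub>B\<^esub> b') d - Poly_Mapping.single (a, b) d - Poly_Mapping.single (a, b') d \<in> tensor_rels A B"
    using *[of "Poly_Mapping.single (a, b \<oplus>\<^bsub>B\<^esub> b') 1 - Poly_Mapping.single (a, b) 1 - Poly_Mapping.single (a, b') 1"]
    by (fastforce simp: pm.scale_right_diff_distrib tensor_gens_def)
  show "a \<in> carrier A \<Longrightarrow> b \<in> carrier B \<Longrightarrow>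
      Poly_Mapping.single (c \<odot>\<^bsub>A\<^esub> a, b) d - Poly_Mapping.single (a, b) (d * c) \<in> tensor_rels A B"
    using *[of "Poly_Mapping.single (c \<odot>\<^bsub>A\<^esub> a, b) 1 - Poly_Mapping.single (a, b) c"]
    by (fastforce simp: pm.scale_right_diff_distrib tensor_gens_def)
  show "a \<in> carrier A \<Longrightarrow> b \<in> carrier B \<Longrightarrow>
      Poly_Mapping.single (a, c \<odot>\<^bsub>B\<^esub> b) d - Poly_Mapping.single (a, b) (d * c) \<in> tensor_rels A B"
    using *[of "Poly_Mapping.single (a, c \<odot>\<^bsub>B\<^esub> b) 1 - Poly_Mapping.single (a, b) c"]
    by (fastforce simp: pm.scale_right_diff_distrib tensor_gens_def)
qed

text \<open>The preimage of a subspace under a semilinear map is a subspace, so the spanning set is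
  enough. The twist \<open>g\<close> is \<open>id\<close> for multiplications and \<open>cnj\<close>
  for the star.\<close>

lemma tensor_rels_image:
  assumes "\<And>p r. h (p + r) = h p + h r" "\<And>c p. h (scale c p) = scale (g c) (h p)" "h 0 = 0"
    and "\<And>p. p \<in> tensor_gens A B \<Longrightarrow> h p \<in> tensor_rels A B" and "p \<in> tensor_rels A B"
  shows "h p \<in> tensor_rels A B"
proof -
  have "pm.subspace {p. h p \<in> tensor_rels A B}"
    unfolding pm.subspace_def using assms(1-3)
    by (auto simp: tensor_rels_span intro: pm.span_add pm.span_scale pm.span_zero)
  then have "tensor_rels A B \<subseteq> {p. h p \<in> tensor_rels A B}"
    unfolding tensor_rels_span using assms(4) by (intro pm.span_minimal) (auto simp: tensor_rels_span)
  with assms(5) show ?thesis by blast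
qed

section \<open>The algebra structure and the universal property of the tensor product\<close>

locale alg_pair = A: calgebra A + B: calgebra B
  for A :: "'a star_alg" and B :: "'b star_alg"
begin

lemma monoid_prod: "Group.monoid (A \<times>\<times> B)"
  by (intro DirProd_monoid A.monoid_axioms B.monoid_axioms)

lemma calgebra_pre_tensor: "calgebra (pre_tensor A B)"
  unfolding pre_tensor_def by (rule calgebra_monoid_alg[OF monoid_prod])

interpretation P: calgebra "pre_tensor A B" by (rule calgebra_pre_tensor)

lemma pre_tensor_simps:
  "carrier (pre_tensor A B) = {p. Poly_Mapping.keys p \<subseteq> carrier A \<times> carrier B}"
  "\<one>\<^bsub>pre_tensor A B\<^esub> = Poly_Mapping.single (\<one>\<^bsub>A\<^esub>, \<one>\<^bsub>B\<^esub>) 1" "\<zero>\<^bsub>pre_tensor A B\<^esub> = 0"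
  "add (pre_tensor A B) = (+)" "smult (pre_tensor A B) = scale"
  "Poly_Mapping.single (a, b) c \<otimes>\<^bsub>pre_tensor A B\<^esub> Poly_Mapping.single (a', b') c' =
    Poly_Mapping.single (a \<otimes>\<^bsub>A\<^esub> a', b \<otimes>\<^bsub>B\<^esub> b') (c * c')"
  "star (pre_tensor A B) (Poly_Mapping.single (a, b) c) = Poly_Mapping.single (star A a, star B b) (cnj c)"
  by (simp_all add: pre_tensor_def)

lemmas pre_tensor_lin = monoid_alg_add_mult monoid_alg_mult_add monoid_alg_scale_mult
  monoid_alg_star_add monoid_alg_star_scale monoid_alg_zero_mult monoid_alg_star_zero

lemma tensor_gens_carrier: "p \<in> tensor_gens A B \<Longrightarrow> Poly_Mapping.keys p \<subseteq> carrier A \<times> carrier B"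
  by (erule tensor_gens_cases)
    (simp_all add: poly_mapping_diff_scale keys_add_subset keys_scale[THEN subset_trans])

lemma tensor_rels_carrier: "p \<in> tensor_rels A B \<Longrightarrow> Poly_Mapping.keys p \<subseteq> carrier A \<times> carrier B"
proof -
  have "pm.subspace {p. Poly_Mapping.keys p \<subseteq> carrier A \<times> carrier B}"
    unfolding pm.subspace_def by (simp add: keys_add_subset keys_scale[THEN subset_trans])
  then have "tensor_rels A B \<subseteq> {p. Poly_Mapping.keys p \<subseteq> carrier A \<times> carrier B}"
    unfolding tensor_rels_span by (intro pm.span_minimal) (auto dest: tensor_gens_carrier)
  then show "p \<in> tensor_rels A B \<Longrightarrow> Poly_Mapping.keys p \<subseteq> carrier A \<times> carrier B" by blast
qed

lemma tensor_rels_mult_single: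
  assumes "x \<in> carrier A" "y \<in> carrier B" "p \<in> tensor_rels A B"
  shows "p \<otimes>\<^bsub>pre_tensor A B\<^esub> Poly_Mapping.single (x, y) e \<in> tensor_rels A B"
proof (rule tensor_rels_image[where g = id, OF _ _ _ _ assms(3)])
  fix p assume "p \<in> tensor_gens A B"
  then show "p \<otimes>\<^bsub>pre_tensor A B\<^esub> Poly_Mapping.single (x, y) e \<in> tensor_rels A B"
  proof (cases rule: tensor_gens_cases)
    case (add_left a a' b)
    then show ?thesis
      using tensor_rels_mem(1)[of "a \<otimes>\<^bsub>A\<^esub> x" A "a' \<otimes>\<^bsub>A\<^esub> x" "b \<otimes>\<^bsub>B\<^esub> y" B e] assms(1,2)
      by (simp add: poly_mapping_diff_scale pre_tensor_def pre_tensor_lin A.l_distr)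
  next
    case (add_right a b b')
    then show ?thesis
      using tensor_rels_mem(2)[of "a \<otimes>\<^bsub>A\<^esub> x" A "b \<otimes>\<^bsub>B\<^esub> y" B "b' \<otimes>\<^bsub>B\<^esub> y" e] assms(1,2)
      by (simp add: poly_mapping_diff_scale pre_tensor_def pre_tensor_lin B.l_distr)
  next
    case (smult_left c a b)
    then show ?thesis
      using tensor_rels_mem(3)[of "a \<otimes>\<^bsub>A\<^esub> x" A "b \<otimes>\<^bsub>B\<^esub> y" B c e] assms(1,2)
      by (simp add: poly_mapping_diff_scale pre_tensor_def pre_tensor_lin A.csmult_mult_left mult.commute)
  next
    case (smult_right c a b)
    then show ?thesis
      using tensor_rels_mem(4)[of "a \<otimes>\<^bsub>A\<^esub> x" A "b \<otimes>\<^bsub>B\<^esub> y" B c e] assms(1,2)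
      by (simp add: poly_mapping_diff_scale pre_tensor_def pre_tensor_lin B.csmult_mult_left mult.commute)
  qed
qed (simp_all add: pre_tensor_def pre_tensor_lin)

lemma tensor_rels_single_mult:
  assumes "x \<in> carrier A" "y \<in> carrier B" "p \<in> tensor_rels A B"
  shows "Poly_Mapping.single (x, y) e \<otimes>\<^bsub>pre_tensor A B\<^esub> p \<in> tensor_rels A B"
proof (rule tensor_rels_image[where g = id, OF _ _ _ _ assms(3)])
  fix p assume "p \<in> tensor_gens A B"
  then show "Poly_Mapping.single (x, y) e \<otimes>\<^bsub>pre_tensor A B\<^esub> p \<in> tensor_rels A B"
  proof (cases rule: tensor_gens_cases)
    case (add_left a a' b)
    then show ?thesis
      using tensor_rels_mem(1)[of "x \<otimes>\<^bsub>A\<^esub> a" A "x \<otimes>\<^bsub>A\<^esub> a'" "y \<otimes>\<^bsub>B\<^esub> b" B e] assms(1,2)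
      by (simp add: poly_mapping_diff_scale pre_tensor_def pre_tensor_lin A.r_distr)
  next
    case (add_right a b b')
    then show ?thesis
      using tensor_rels_mem(2)[of "x \<otimes>\<^bsub>A\<^esub> a" A "y \<otimes>\<^bsub>B\<^esub> b" B "y \<otimes>\<^bsub>B\<^esub> b'" e] assms(1,2)
      by (simp add: poly_mapping_diff_scale pre_tensor_def pre_tensor_lin B.r_distr)
  next
    case (smult_left c a b)
    then show ?thesis
      using tensor_rels_mem(3)[of "x \<otimes>\<^bsub>A\<^esub> a" A "y \<otimes>\<^bsub>B\<^esub> b" B c e] assms(1,2)
      by (simp add: poly_mapping_diff_scale pre_tensor_def pre_tensor_lin A.csmult_mult_right)
  next
    case (smult_right c a b)
    then show ?thesis
      using tensor_rels_mem(4)[of "x \<otimes>\<^bsub>A\<^esub> a" A "y \<otimes>\<^bsub>B\<^esub> b" B c e] assms(1,2)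
      by (simp add: poly_mapping_diff_scale pre_tensor_def pre_tensor_lin B.csmult_mult_right)
  qed
qed (simp_all add: pre_tensor_def pre_tensor_lin)

text \<open>This is what lets the product of the monoid algebra descend to the tensor product.
  Multiplying by basis elements preserves the relations since the products of \<open>A\<close> and
  \<open>B\<close> are bilinear; general multipliers are sums of these.\<close>

lemma ideal_tensor_rels: "ideal (tensor_rels A B) (pre_tensor A B)"
proof (rule idealI)
  show "ring (pre_tensor A B)" by (rule P.ring_axioms)
  show "subgroup (tensor_rels A B) (add_monoid (pre_tensor A B))"
  proof (rule P.add.subgroupI)
    fix p assume p: "p \<in> tensor_rels A B"
    then have "scale (- 1) p = \<ominus>\<^bsub>pre_tensor A B\<^esub> p"
      using P.csmult_minus_one[of p] tensor_rels_carrier by (simp add: pre_tensor_simps)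
    then show "\<ominus>\<^bsub>pre_tensor A B\<^esub> p \<in> tensor_rels A B"
      using p pm.span_scale[of p _ "-1"] by (simp add: tensor_rels_span)
  qed (auto simp: pre_tensor_simps tensor_rels_span[symmetric] dest: tensor_rels_carrier,
      auto simp: tensor_rels_span intro: pm.span_add pm.span_zero)
next
  fix p r assume p: "p \<in> tensor_rels A B" and "r \<in> carrier (pre_tensor A B)"
  then have "Poly_Mapping.keys r \<subseteq> carrier A \<times> carrier B" by (simp add: pre_tensor_simps)
  then have "r \<otimes>\<^bsub>pre_tensor A B\<^esub> p \<in> tensor_rels A B \<and> p \<otimes>\<^bsub>pre_tensor A B\<^esub> r \<in> tensor_rels A B"
  proof (induction r rule: poly_mapping_keys_induct)
    case zero
    show ?case by (simp add: pre_tensor_def tensor_rels_span pm.span_zero)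
  next
    case (single k c)
    then show ?case using tensor_rels_mult_single tensor_rels_single_mult p by (cases k) auto
  next
    case (add r t)
    then show ?case
      unfolding pre_tensor_def tensor_rels_span pre_tensor_lin by (auto intro: pm.span_add)
  qed
  then show "r \<otimes>\<^bsub>pre_tensor A B\<^esub> p \<in> tensor_rels A B" "p \<otimes>\<^bsub>pre_tensor A B\<^esub> r \<in> tensor_rels A B"
    by blast+
qed

sublocale T: calgebra "A \<boxtimes> B"
  unfolding tensor_def by (rule calgebra_quot_alg[OF calgebra_pre_tensor ideal_tensor_rels])

lemma tensor_proj: "alg_hom (pre_tensor A B) (A \<boxtimes> B) (\<lambda>p. tensor_rels A B +>\<^bsub>pre_tensor A B\<^esub> p)"
  unfolding tensor_def by (rule quot_alg_proj[OF calgebra_pre_tensor ideal_tensor_rels])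

lemma tensor_proj_eqI:
  assumes "Poly_Mapping.keys p \<subseteq> carrier A \<times> carrier B" "Poly_Mapping.keys r \<subseteq> carrier A \<times> carrier B"
    and "p - r \<in> tensor_rels A B"
  shows "tensor_rels A B +>\<^bsub>pre_tensor A B\<^esub> p = tensor_rels A B +>\<^bsub>pre_tensor A B\<^esub> r"
  using quot_alg_proj_eqI[OF calgebra_pre_tensor ideal_tensor_rels, of p r] assms
  by (simp add: pre_tensor_simps)

lemma pure_closed [simp, intro]:
  "a \<in> carrier A \<Longrightarrow> b \<in> carrier B \<Longrightarrow> pure_tensor A B a b \<in> carrier (A \<boxtimes> B)"
  unfolding pure_tensor_def by (rule alg_homD(4)[OF tensor_proj]) (simp add: pre_tensor_simps)

lemma pure_mult:
  assumes "a \<in> carrier A" "b \<in> carrier B" "a' \<in> carrier A" "b' \<in> carrier B"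
  shows "pure_tensor A B a b \<otimes>\<^bsub>A \<boxtimes> B\<^esub> pure_tensor A B a' b' = pure_tensor A B (a \<otimes>\<^bsub>A\<^esub> a') (b \<otimes>\<^bsub>B\<^esub> b')"
  unfolding pure_tensor_def using assms
  by (subst alg_homD(3)[OF tensor_proj, symmetric]) (simp_all add: pre_tensor_simps)

lemma pure_one: "\<one>\<^bsub>A \<boxtimes> B\<^esub> = pure_tensor A B \<one>\<^bsub>A\<^esub> \<one>\<^bsub>B\<^esub>"
  unfolding pure_tensor_def using alg_homD(2)[OF tensor_proj] by (simp add: pre_tensor_simps)

lemma pure_scale:
  assumes "a \<in> carrier A" "b \<in> carrier B"
  shows "tensor_rels A B +>\<^bsub>pre_tensor A B\<^esub> Poly_Mapping.single (a, b) c = c \<odot>\<^bsub>A \<boxtimes> B\<^esub> pure_tensor A B a b"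
  using alg_homD(6)[OF tensor_proj, of "Poly_Mapping.single (a, b) 1" c] assms
  by (simp add: pure_tensor_def pre_tensor_simps)

lemma bilin_pure: "bilin A B (A \<boxtimes> B) (pure_tensor A B)"
proof -
  have add: "tensor_rels A B +>\<^bsub>pre_tensor A B\<^esub> Poly_Mapping.single k 1 =
      (tensor_rels A B +>\<^bsub>pre_tensor A B\<^esub> Poly_Mapping.single l 1) \<oplus>\<^bsub>A \<boxtimes> B\<^esub>
      (tensor_rels A B +>\<^bsub>pre_tensor A B\<^esub> Poly_Mapping.single m 1)"
    if "k \<in> carrier A \<times> carrier B" "l \<in> carrier A \<times> carrier B" "m \<in> carrier A \<times> carrier B"
      "Poly_Mapping.single k 1 - Poly_Mapping.single l 1 - Poly_Mapping.single m 1 \<in> tensor_rels A B" for k l m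
    using that alg_homD(5)[OF tensor_proj, of "Poly_Mapping.single l 1" "Poly_Mapping.single m 1"]
      tensor_proj_eqI[of "Poly_Mapping.single k 1" "Poly_Mapping.single l 1 + Poly_Mapping.single m 1"]
    by (simp add: pre_tensor_simps keys_add_subset diff_diff_eq)
  show ?thesis
  proof (intro bilinI lin_mapI)
    fix a b c assume ab: "a \<in> carrier A" "b \<in> carrier B"
    show "pure_tensor A B a (c \<odot>\<^bsub>B\<^esub> b) = c \<odot>\<^bsub>A \<boxtimes> B\<^esub> pure_tensor A B a b"
      using ab tensor_rels_mem(4)[of a A b B c 1]
      unfolding pure_scale[OF ab, symmetric] unfolding pure_tensor_def by (intro tensor_proj_eqI) simp_all
    show "pure_tensor A B (c \<odot>\<^bsub>A\<^esub> a) b = c \<odot>\<^bsub>A \<boxtimes> B\<^esub> pure_tensor A B a b"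
      using ab tensor_rels_mem(3)[of a A b B c 1]
      unfolding pure_scale[OF ab, symmetric] unfolding pure_tensor_def by (intro tensor_proj_eqI) simp_all
  next
    fix a b b' assume "a \<in> carrier A" "b \<in> carrier B" "b' \<in> carrier B"
    then show "pure_tensor A B a (b \<oplus>\<^bsub>B\<^esub> b') = pure_tensor A B a b \<oplus>\<^bsub>A \<boxtimes> B\<^esub> pure_tensor A B a b'"
      unfolding pure_tensor_def by (intro add tensor_rels_mem) simp_all
  next
    fix a a' b assume "b \<in> carrier B" "a \<in> carrier A" "a' \<in> carrier A"
    then show "pure_tensor A B (a \<oplus>\<^bsub>A\<^esub> a') b = pure_tensor A B a b \<oplus>\<^bsub>A \<boxtimes> B\<^esub> pure_tensor A B a' b"
      unfolding pure_tensor_def by (intro add tensor_rels_mem) simp_all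
  qed simp_all
qed

lemmas pure_lin = bilinD(2-5)[OF bilin_pure]

lemma alg_hom_pure_left: "alg_hom A (A \<boxtimes> B) (\<lambda>a. pure_tensor A B a \<one>\<^bsub>B\<^esub>)"
  by (intro alg_homI lin_mapI) (simp_all add: pure_lin pure_one pure_mult)

lemma alg_hom_pure_right: "alg_hom B (A \<boxtimes> B) (\<lambda>b. pure_tensor A B \<one>\<^bsub>A\<^esub> b)"
  by (intro alg_homI lin_mapI) (simp_all add: pure_lin pure_one pure_mult)

lemma tensor_carrier_E:
  assumes "t \<in> carrier (A \<boxtimes> B)"
  obtains p where "Poly_Mapping.keys p \<subseteq> carrier A \<times> carrier B" "t = tensor_rels A B +>\<^bsub>pre_tensor A B\<^esub> p"
  using assms unfolding tensor_def quot_alg_carrier[OF calgebra_pre_tensor ideal_tensor_rels]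
  by (auto simp: pre_tensor_simps)

text \<open>There is no case for scalars or zero: c (a \<otimes> b) = (c a) \<otimes> b is pure
  again, and zero arises as such a multiple with c = 0.\<close>

lemma tensor_induct [consumes 1, case_names pure add]:
  assumes "t \<in> carrier (A \<boxtimes> B)"
    and pure: "\<And>a b. a \<in> carrier A \<Longrightarrow> b \<in> carrier B \<Longrightarrow> P (pure_tensor A B a b)"
    and add: "\<And>t u. t \<in> carrier (A \<boxtimes> B) \<Longrightarrow> u \<in> carrier (A \<boxtimes> B) \<Longrightarrow> P t \<Longrightarrow> P u \<Longrightarrow> P (t \<oplus>\<^bsub>A \<boxtimes> B\<^esub> u)"
  shows "P t"
proof -
  obtain p where p: "Poly_Mapping.keys p \<subseteq> carrier A \<times> carrier B"
    and t: "t = tensor_rels A B +>\<^bsub>pre_tensor A B\<^esub> p"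
    using tensor_carrier_E assms(1) by blast
  have P_single: "P (tensor_rels A B +>\<^bsub>pre_tensor A B\<^esub> Poly_Mapping.single (a, b) c)"
    if "a \<in> carrier A" "b \<in> carrier B" for a b c
    using pure[of "c \<odot>\<^bsub>A\<^esub> a" b] that by (simp add: pure_scale pure_lin)
  from p show ?thesis unfolding t
  proof (induction p rule: poly_mapping_keys_induct)
    case zero
    show ?case using P_single[of "\<zero>\<^bsub>A\<^esub>" "\<zero>\<^bsub>B\<^esub>" 0] by simp
  next
    case (single k c)
    then show ?case using P_single by (cases k) auto
  next
    case (add p r)
    then show ?case
      using assms(3)[OF _ _ add(3,4)] alg_homD(4,5)[OF tensor_proj] by (simp add: pre_tensor_simps)
  qed
qed

lemma
  assumes M: "calgebra M" and f: "bilin A B M f"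
  shows tensor_lift_lin: "lin_map (A \<boxtimes> B) M (tensor_lift M f)"
    and tensor_lift_pure: "a \<in> carrier A \<Longrightarrow> b \<in> carrier B \<Longrightarrow> tensor_lift M f (pure_tensor A B a b) = f a b"
proof -
  interpret M: calgebra M by fact
  let ?\<phi> = "lin_ext M (case_prod f)"
  let ?K = "carrier A \<times> carrier B"
  have fc: "case_prod f k \<in> carrier M" if "k \<in> ?K" for k
    using that bilinD(1)[OF f] by auto
  note L = lin_ext_zero[OF M fc] lin_ext_single[OF M fc] lin_ext_closed[OF M fc]
    lin_ext_add[OF M fc] lin_ext_scale[OF M fc]
  \<comment> \<open>Identifies the map inside \<open>tensor_lift\<close> with a linear extension
    from the basis of pairs, so that well-definedness reduces to its vanishing on the four kinds of
    relation.\<close>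
  have eq: "(\<lambda>p. finsum M (\<lambda>(a, b). Poly_Mapping.lookup p (a, b) \<odot>\<^bsub>M\<^esub> f a b) (Poly_Mapping.keys p)) = ?\<phi>"
    by (simp add: lin_ext_def case_prod_unfold fun_eq_iff)
  have lin: "lin_map (pre_tensor A B) M ?\<phi>"
    by (rule lin_mapI) (simp_all add: pre_tensor_simps L)
  have ker: "?\<phi> p = \<zero>\<^bsub>M\<^esub>" if "p \<in> tensor_rels A B" for p
  proof -
    \<comment> \<open>The support condition is part of the subspace because \<open>?\<phi>\<close>
      is known to be linear only on mappings supported in \<open>?K\<close>, where \<open>f\<close>
      takes values in the carrier of \<open>M\<close>.\<close>
    have "pm.subspace {p. Poly_Mapping.keys p \<subseteq> ?K \<and> ?\<phi> p = \<zero>\<^bsub>M\<^esub>}"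
      unfolding pm.subspace_def by (simp add: L keys_add_subset keys_scale[THEN subset_trans])
    moreover have "?\<phi> p = \<zero>\<^bsub>M\<^esub>" if "p \<in> tensor_gens A B" for p
    proof -
      note cancel = M.csmult_cancel_one(1)
      have cancel2: "x \<oplus>\<^bsub>M\<^esub> y \<oplus>\<^bsub>M\<^esub> - 1 \<odot>\<^bsub>M\<^esub> x \<oplus>\<^bsub>M\<^esub> - 1 \<odot>\<^bsub>M\<^esub> y = \<zero>\<^bsub>M\<^esub>"
        if "x \<in> carrier M" "y \<in> carrier M" for x y
        using that cancel[of "x \<oplus>\<^bsub>M\<^esub> y"] by (simp add: M.csmult_distrib M.a_assoc)
      note * = cancel cancel2
      note s = poly_mapping_diff_scale L keys_add_subset * fc
      from that show ?thesis
      proof (cases rule: tensor_gens_cases)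
        case (add_left a a' b)
        then show ?thesis by (simp add: s bilinD[OF f])
      next
        case (add_right a b b')
        then show ?thesis by (simp add: s bilinD[OF f])
      next
        case (smult_left c a b)
        then show ?thesis using cancel[of "c \<odot>\<^bsub>M\<^esub> f a b"] by (simp add: s bilinD[OF f] M.csmult_csmult)
      next
        case (smult_right c a b)
        then show ?thesis using cancel[of "c \<odot>\<^bsub>M\<^esub> f a b"] by (simp add: s bilinD[OF f] M.csmult_csmult)
      qed
    qed
    ultimately have "tensor_rels A B \<subseteq> {p. Poly_Mapping.keys p \<subseteq> ?K \<and> ?\<phi> p = \<zero>\<^bsub>M\<^esub>}"
      unfolding tensor_rels_span by (intro pm.span_minimal) (auto dest: tensor_gens_carrier)
    with that show ?thesis by blast
  qed
  show "lin_map (A \<boxtimes> B) M (tensor_lift M f)"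
    unfolding tensor_def tensor_lift_def eq
    by (rule quot_alg_lift_lin[OF calgebra_pre_tensor ideal_tensor_rels M lin ker])
  show "tensor_lift M f (pure_tensor A B a b) = f a b" if "a \<in> carrier A" "b \<in> carrier B"
    using that quot_alg_lift[OF calgebra_pre_tensor ideal_tensor_rels M lin ker, of "Poly_Mapping.single (a, b) 1"]
    unfolding tensor_lift_def pure_tensor_def eq by (simp add: pre_tensor_simps L(2) bilinD[OF f])
qed

text \<open>Both sides of the multiplicativity law are biadditive, and pure tensors generate the
  tensor product additively.\<close>

lemma tensor_alg_homI:
  assumes M: "calgebra M" and f: "lin_map (A \<boxtimes> B) M f"
    and one: "f (pure_tensor A B \<one>\<^bsub>A\<^esub> \<one>\<^bsub>B\<^esub>) = \<one>\<^bsub>M\<^esub>"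
    and mult: "\<And>a a' b b'. a \<in> carrier A \<Longrightarrow> a' \<in> carrier A \<Longrightarrow> b \<in> carrier B \<Longrightarrow> b' \<in> carrier B \<Longrightarrow>
      f (pure_tensor A B (a \<otimes>\<^bsub>A\<^esub> a') (b \<otimes>\<^bsub>B\<^esub> b')) = f (pure_tensor A B a b) \<otimes>\<^bsub>M\<^esub> f (pure_tensor A B a' b')"
  shows "alg_hom (A \<boxtimes> B) M f"
proof (rule alg_homI[OF f])
  interpret M: calgebra M by fact
  fix t u assume t: "t \<in> carrier (A \<boxtimes> B)" and u: "u \<in> carrier (A \<boxtimes> B)"
  from t show "f (t \<otimes>\<^bsub>A \<boxtimes> B\<^esub> u) = f t \<otimes>\<^bsub>M\<^esub> f u"
  proof (induction t rule: tensor_induct)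
    case (pure a b)
    from u show ?case
      by (induction u rule: tensor_induct)
        (use pure in \<open>simp_all add: T.r_distr M.r_distr lin_mapD[OF f] pure_mult mult\<close>)
  qed (use u in \<open>simp add: T.l_distr M.l_distr lin_mapD[OF f]\<close>)
qed (simp add: pure_one one)

lemma star_tensor_rels:
  assumes "star_algebra A" "star_algebra B" "p \<in> tensor_rels A B"
  shows "star (pre_tensor A B) p \<in> tensor_rels A B"
proof (rule tensor_rels_image[where g = cnj, OF _ _ _ _ assms(3)])
  interpret A: star_algebra A by fact
  interpret B: star_algebra B by fact
  fix p assume "p \<in> tensor_gens A B"
  then show "star (pre_tensor A B) p \<in> tensor_rels A B"
  proof (cases rule: tensor_gens_cases)
    case (add_left a a' b)
    then show ?thesis
      using tensor_rels_mem(1)[of "star A a" A "star A a'" "star B b" B 1]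
      by (simp add: poly_mapping_diff_scale pre_tensor_def pre_tensor_lin A.star_add A.star_closed B.star_closed)
  next
    case (add_right a b b')
    then show ?thesis
      using tensor_rels_mem(2)[of "star A a" A "star B b" B "star B b'" 1]
      by (simp add: poly_mapping_diff_scale pre_tensor_def pre_tensor_lin B.star_add A.star_closed B.star_closed)
  next
    case (smult_left c a b)
    then show ?thesis
      using tensor_rels_mem(3)[of "star A a" A "star B b" B "cnj c" 1]
      by (simp add: poly_mapping_diff_scale pre_tensor_def pre_tensor_lin A.star_smult A.star_closed B.star_closed)
  next
    case (smult_right c a b)
    then show ?thesis
      using tensor_rels_mem(4)[of "star A a" A "star B b" B "cnj c" 1]
      by (simp add: poly_mapping_diff_scale pre_tensor_def pre_tensor_lin B.star_smult A.star_closed B.star_closed)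
  qed
qed (simp_all add: pre_tensor_def pre_tensor_lin)

lemma
  assumes "star_algebra A" "star_algebra B"
  shows star_algebra_tensor: "star_algebra (A \<boxtimes> B)"
    and star_pure: "a \<in> carrier A \<Longrightarrow> b \<in> carrier B \<Longrightarrow>
      star (A \<boxtimes> B) (pure_tensor A B a b) = pure_tensor A B (star A a) (star B b)"
proof -
  interpret A: star_algebra A by fact
  interpret B: star_algebra B by fact
  have P: "star_algebra (pre_tensor A B)"
    unfolding pre_tensor_def
    by (rule star_algebra_monoid_alg[OF monoid_prod])
      (auto simp: A.star_closed B.star_closed A.star_mult B.star_mult A.star_star B.star_star)
  note Q = calgebra_pre_tensor ideal_tensor_rels P star_tensor_rels[OF assms]
  show "star_algebra (A \<boxtimes> B)"
    unfolding tensor_def by (rule star_algebra_quot_alg[OF Q])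
  have "star_hom (pre_tensor A B) (A \<boxtimes> B) (\<lambda>p. tensor_rels A B +>\<^bsub>pre_tensor A B\<^esub> p)"
    unfolding tensor_def by (rule quot_alg_star[OF Q])
  then show "star (A \<boxtimes> B) (pure_tensor A B a b) = pure_tensor A B (star A a) (star B b)"
    if "a \<in> carrier A" "b \<in> carrier B"
    using that unfolding star_hom_def pure_tensor_def
    by (auto simp: pre_tensor_simps dest: spec[of _ "Poly_Mapping.single (a, b) 1"])
qed

end

section \<open>Functoriality and associativity of tensor products\<close>

lemma
  assumes "calgebra A" "calgebra B" "calgebra C" "calgebra D"
    and f: "lin_map A C f" and g: "lin_map B D g"
  shows tensor_map_pure: "a \<in> carrier A \<Longrightarrow> b \<in> carrier B \<Longrightarrow>
      tensor_map C D f g (pure_tensor A B a b) = pure_tensor C D (f a) (g b)"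
    and tensor_map_alg: "alg_hom A C f \<Longrightarrow> alg_hom B D g \<Longrightarrow> alg_hom (A \<boxtimes> B) (C \<boxtimes> D) (tensor_map C D f g)"
proof -
  interpret AB: alg_pair A B by (intro alg_pair.intro assms)
  interpret CD: alg_pair C D by (intro alg_pair.intro assms)
  have bl: "bilin A B (C \<boxtimes> D) (\<lambda>a b. pure_tensor C D (f a) (g b))"
    by (intro bilinI lin_mapI) (simp_all add: lin_mapD[OF f] lin_mapD[OF g] CD.pure_lin)
  have l: "lin_map (A \<boxtimes> B) (C \<boxtimes> D) (tensor_map C D f g)"
    unfolding tensor_map_def by (rule AB.tensor_lift_lin[OF CD.T.calgebra_axioms bl])
  show p: "tensor_map C D f g (pure_tensor A B a b) = pure_tensor C D (f a) (g b)"
    if "a \<in> carrier A" "b \<in> carrier B" for a b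
    unfolding tensor_map_def by (rule AB.tensor_lift_pure[OF CD.T.calgebra_axioms bl that])
  show "alg_hom (A \<boxtimes> B) (C \<boxtimes> D) (tensor_map C D f g)" if "alg_hom A C f" "alg_hom B D g"
    by (rule AB.tensor_alg_homI[OF CD.T.calgebra_axioms l])
      (simp_all add: p alg_homD[OF that(1)] alg_homD[OF that(2)] CD.pure_one CD.pure_mult)
qed

lemma
  assumes "calgebra A" "calgebra B" "calgebra C"
  shows tensor_assoc_alg: "alg_hom ((A \<boxtimes> B) \<boxtimes> C) (A \<boxtimes> (B \<boxtimes> C)) (tensor_assoc A B C)"
    and tensor_assoc_pure: "a \<in> carrier A \<Longrightarrow> b \<in> carrier B \<Longrightarrow> c \<in> carrier C \<Longrightarrow>
      tensor_assoc A B C (pure_tensor (A \<boxtimes> B) C (pure_tensor A B a b) c) =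
      pure_tensor A (B \<boxtimes> C) a (pure_tensor B C b c)"
proof -
  interpret AB: alg_pair A B by (intro alg_pair.intro assms)
  interpret BC: alg_pair B C by (intro alg_pair.intro assms)
  interpret A_BC: alg_pair A "B \<boxtimes> C" by (intro alg_pair.intro assms BC.T.calgebra_axioms)
  interpret AB_C: alg_pair "A \<boxtimes> B" C by (intro alg_pair.intro assms AB.T.calgebra_axioms)
  note R = A_BC.T.calgebra_axioms
  let ?g = "\<lambda>c a b. pure_tensor A (B \<boxtimes> C) a (pure_tensor B C b c)"
  let ?h = "\<lambda>t c. tensor_lift (A \<boxtimes> (B \<boxtimes> C)) (?g c) t"
  have bl: "bilin A B (A \<boxtimes> (B \<boxtimes> C)) (?g c)" if "c \<in> carrier C" for c
    by (intro bilinI lin_mapI) (simp_all add: that BC.pure_lin A_BC.pure_lin)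
  note l = AB.tensor_lift_lin[OF R bl] and p = AB.tensor_lift_pure[OF R bl]
  note ld = lin_mapD[OF l]
  \<comment> \<open>\<open>?h t c\<close> is a lift in \<open>t\<close> for fixed \<open>c\<close>.
    Its linearity in \<open>c\<close>, which the outer lift needs, is therefore not built in and is
    proved by induction on \<open>t\<close>.\<close>
  have add: "?h t (c \<oplus>\<^bsub>C\<^esub> d) = ?h t c \<oplus>\<^bsub>A \<boxtimes> (B \<boxtimes> C)\<^esub> ?h t d"
    if cd: "c \<in> carrier C" "d \<in> carrier C" and t: "t \<in> carrier (A \<boxtimes> B)" for t c d
    using t by (induction t rule: AB.tensor_induct)
      (use cd in \<open>simp_all add: p ld BC.pure_lin A_BC.pure_lin A_BC.T.a_ac\<close>)
  have smult: "?h t (z \<odot>\<^bsub>C\<^esub> c) = z \<odot>\<^bsub>A \<boxtimes> (B \<boxtimes> C)\<^esub> ?h t c"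
    if c: "c \<in> carrier C" and t: "t \<in> carrier (A \<boxtimes> B)" for t c z
    using t by (induction t rule: AB.tensor_induct)
      (use c in \<open>simp_all add: p ld BC.pure_lin A_BC.pure_lin A_BC.T.csmult_distrib\<close>)
  have bl2: "bilin (A \<boxtimes> B) C (A \<boxtimes> (B \<boxtimes> C)) ?h"
    by (intro bilinI l lin_mapI) (simp_all add: ld add smult)
  have la: "lin_map ((A \<boxtimes> B) \<boxtimes> C) (A \<boxtimes> (B \<boxtimes> C)) (tensor_assoc A B C)"
    unfolding tensor_assoc_def by (rule AB_C.tensor_lift_lin[OF R bl2])
  have pa: "tensor_assoc A B C (pure_tensor (A \<boxtimes> B) C t c) = ?h t c" if "t \<in> carrier (A \<boxtimes> B)" "c \<in> carrier C" for t c
    unfolding tensor_assoc_def by (rule AB_C.tensor_lift_pure[OF R bl2 that])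
  show "tensor_assoc A B C (pure_tensor (A \<boxtimes> B) C (pure_tensor A B a b) c) =
      pure_tensor A (B \<boxtimes> C) a (pure_tensor B C b c)"
    if "a \<in> carrier A" "b \<in> carrier B" "c \<in> carrier C" for a b c
    using that by (simp add: pa p)
  have mult: "?h (t \<otimes>\<^bsub>A \<boxtimes> B\<^esub> u) (c \<otimes>\<^bsub>C\<^esub> d) = ?h t c \<otimes>\<^bsub>A \<boxtimes> (B \<boxtimes> C)\<^esub> ?h u d"
    if t: "t \<in> carrier (A \<boxtimes> B)" and u: "u \<in> carrier (A \<boxtimes> B)" and cd: "c \<in> carrier C" "d \<in> carrier C" for t u c d
    using t
  proof (induction t rule: AB.tensor_induct)
    case (pure a b)
    from u show ?case
      by (induction u rule: AB.tensor_induct)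
        (use pure cd in \<open>simp_all add: p ld AB.pure_mult BC.pure_mult A_BC.pure_mult AB.T.r_distr A_BC.T.r_distr\<close>)
  qed (use u cd in \<open>simp add: ld AB.T.l_distr A_BC.T.l_distr\<close>)
  show "alg_hom ((A \<boxtimes> B) \<boxtimes> C) (A \<boxtimes> (B \<boxtimes> C)) (tensor_assoc A B C)"
    by (rule AB_C.tensor_alg_homI[OF R la])
      (simp_all add: pa mult AB.pure_one p A_BC.pure_one BC.pure_one)
qed

section \<open>The algebras \<open>U\<^sub>q(\<mu>, \<nu>)\<close>\<close>

abbreviation free_gen_monoid :: "gen list monoid" where
  "free_gen_monoid \<equiv> \<lparr>carrier = UNIV, mult = (@), one = []\<rparr>"

lemma monoid_free_gen_monoid: "Group.monoid free_gen_monoid"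
  by (rule monoidI) simp_all

lemma gen_star_gen_star [simp]: "gen_star (gen_star x) = x"
  by (cases x) simp_all

lemma star_algebra_free_alg: "star_algebra free_alg"
  unfolding free_alg_def
  by (rule star_algebra_monoid_alg[OF monoid_free_gen_monoid])
    (simp_all add: rev_map comp_def)

interpretation free: star_algebra free_alg
  by (rule star_algebra_free_alg)

lemma free_alg_simps [simp]:
  "carrier free_alg = UNIV" "\<one>\<^bsub>free_alg\<^esub> = word [] 1" "\<zero>\<^bsub>free_alg\<^esub> = 0"
  "add free_alg = (+)" "smult free_alg = scale"
  "word v c \<otimes>\<^bsub>free_alg\<^esub> word w d = word (v @ w) (c * d)"
  "star free_alg (word v c) = word (rev (map gen_star v)) (cnj c)"
  by (simp_all add: free_alg_def)

text \<open>The presentation read in an arbitrary algebra. The commutator relation is solved for EF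
  and its minus signs are moved into scalars, so that it can serve as a rewrite rule.\<close>

definition Uq_rep :: "'a star_alg \<Rightarrow> real \<Rightarrow> real \<Rightarrow> real \<Rightarrow> (gen \<Rightarrow> 'a) \<Rightarrow> bool" where
  "Uq_rep B q \<mu> \<nu> g \<longleftrightarrow> range g \<subseteq> carrier B \<and>
    g GenKinv \<otimes>\<^bsub>B\<^esub> g GenK = \<one>\<^bsub>B\<^esub> \<and> g GenK \<otimes>\<^bsub>B\<^esub> g GenKinv = \<one>\<^bsub>B\<^esub> \<and>
    g GenK \<otimes>\<^bsub>B\<^esub> g GenE = complex_of_real q \<odot>\<^bsub>B\<^esub> (g GenE \<otimes>\<^bsub>B\<^esub> g GenK) \<and>
    g GenK \<otimes>\<^bsub>B\<^esub> g GenF = complex_of_real (inverse q) \<odot>\<^bsub>B\<^esub> (g GenF \<otimes>\<^bsub>B\<^esub> g GenK) \<and>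
    g GenE \<otimes>\<^bsub>B\<^esub> g GenF = g GenF \<otimes>\<^bsub>B\<^esub> g GenE \<oplus>\<^bsub>B\<^esub>
      (complex_of_real (inverse (q - inverse q) * \<mu>) \<odot>\<^bsub>B\<^esub> (g GenK \<otimes>\<^bsub>B\<^esub> g GenK) \<oplus>\<^bsub>B\<^esub>
       (- complex_of_real (inverse (q - inverse q) * \<nu>)) \<odot>\<^bsub>B\<^esub> (g GenKinv \<otimes>\<^bsub>B\<^esub> g GenKinv))"

lemma ideal_Uq_ideal: "ideal (Uq_ideal q \<mu> \<nu>) free_alg"
  unfolding Uq_ideal_def by (rule free.genideal_ideal) simp

lemma Uq_rels_ideal: "p \<in> Uq_rels q \<mu> \<nu> \<Longrightarrow> p \<in> Uq_ideal q \<mu> \<nu>"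
  unfolding Uq_ideal_def using free.genideal_self by auto

lemma Uq_rels_cases [consumes 1, case_names inv_left inv_right KE KF EF]:
  assumes "r \<in> Uq_rels q \<mu> \<nu>"
  obtains "r = word [GenKinv, GenK] 1 - word [] 1" | "r = word [GenK, GenKinv] 1 - word [] 1"
    | "r = word [GenK, GenE] 1 - word [GenE, GenK] (complex_of_real q)"
    | "r = word [GenK, GenF] 1 - word [GenF, GenK] (complex_of_real (inverse q))"
    | "r = (word [GenE, GenF] 1 - word [GenF, GenE] 1) -
       (word [GenK, GenK] (complex_of_real (inverse (q - inverse q) * \<mu>)) -
        word [GenKinv, GenKinv] (complex_of_real (inverse (q - inverse q) * \<nu>)))"
  using assms unfolding Uq_rels_def Let_def by blast

lemma Uq_ideal_minimal: "ideal I free_alg \<Longrightarrow> Uq_rels q \<mu> \<nu> \<subseteq> I \<Longrightarrow> Uq_ideal q \<mu> \<nu> \<subseteq> I"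
  unfolding Uq_ideal_def by (rule free.genideal_minimal)

lemma Uq_ideal_lin:
  shows "p \<in> Uq_ideal q \<mu> \<nu> \<Longrightarrow> r \<in> Uq_ideal q \<mu> \<nu> \<Longrightarrow> p + r \<in> Uq_ideal q \<mu> \<nu>"
    and "p \<in> Uq_ideal q \<mu> \<nu> \<Longrightarrow> scale c p \<in> Uq_ideal q \<mu> \<nu>"
    and "0 \<in> Uq_ideal q \<mu> \<nu>"
  using additive_subgroup.a_closed[OF ideal.axioms(1)[OF ideal_Uq_ideal], of p q \<mu> \<nu> r]
    ideal_smult_closed[OF free.calgebra_axioms ideal_Uq_ideal, of p q \<mu> \<nu> c]
    additive_subgroup.zero_closed[OF ideal.axioms(1)[OF ideal_Uq_ideal], of q \<mu> \<nu>]
  by simp_all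

text \<open>The preimage of the ideal under the star is again an ideal, so only the relations
  matter. The star exchanges the two inverse relations and fixes the commutator relation. It sends
  KE - q EK to FK - q KF, which is -q times the relation for K and F, and it treats the latter
  likewise.\<close>

lemma star_Uq_ideal:
  assumes "q \<noteq> 0" "p \<in> Uq_ideal q \<mu> \<nu>"
  shows "star free_alg p \<in> Uq_ideal q \<mu> \<nu>"
proof -
  interpret ideal "Uq_ideal q \<mu> \<nu>" free_alg by (rule ideal_Uq_ideal)
  let ?J = "{p. star free_alg p \<in> Uq_ideal q \<mu> \<nu>}"
  have add: "star free_alg (p + r) = star free_alg p + star free_alg r" for p r
    using free.star_add[of p r] by simp
  have smult: "star free_alg (scale c p) = scale (cnj c) (star free_alg p)" for c p
    using free.star_smult[of p c] by simp
  have zero: "star free_alg 0 = 0" using smult[of 0 0] by simp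
  have "subgroup ?J (add_monoid free_alg)"
  proof (rule free.add.subgroupI)
    fix p assume "p \<in> ?J"
    moreover have "\<ominus>\<^bsub>free_alg\<^esub> p = scale (- 1) p" using free.csmult_minus_one[of p] by simp
    ultimately show "\<ominus>\<^bsub>free_alg\<^esub> p \<in> ?J" using Uq_ideal_lin(2)[of _ q \<mu> \<nu> "- 1"] smult[of "- 1" p] by simp
  qed (auto simp: add zero Uq_ideal_lin intro: exI[of _ 0])
  then have "ideal ?J free_alg"
    by (rule idealI[OF free.ring_axioms]) (auto simp: free.star_mult I_l_closed I_r_closed)
  moreover have "Uq_rels q \<mu> \<nu> \<subseteq> ?J"
  proof -
    have "r \<in> ?J" if "r \<in> Uq_rels q \<mu> \<nu>" for r
    proof -
      note m = Uq_rels_ideal[where q = q and \<mu> = \<mu> and \<nu> = \<nu>, unfolded Uq_rels_def Let_def]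
      note s = poly_mapping_diff_scale add smult pm.scale_right_distrib mult.commute
      from that show ?thesis
      proof (cases rule: Uq_rels_cases)
        case inv_left
        then show ?thesis using m[of "word [GenK, GenKinv] 1 - word [] 1"] by (simp add: s)
      next
        case inv_right
        then show ?thesis using m[of "word [GenKinv, GenK] 1 - word [] 1"] by (simp add: s)
      next
        case KE
        then show ?thesis
          using Uq_ideal_lin(2)[OF m[of "word [GenK, GenF] 1 - word [GenF, GenK] (complex_of_real (inverse q))"], of "- complex_of_real q"] \<open>q \<noteq> 0\<close>
          by (simp add: s add.commute)
      next
        case KF
        then show ?thesis
          using Uq_ideal_lin(2)[OF m[of "word [GenK, GenE] 1 - word [GenE, GenK] (complex_of_real q)"], of "- complex_of_real (inverse q)"] \<open>q \<noteq> 0\<close>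
          by (simp add: s add.commute)
      next
        case EF
        then show ?thesis using m[of r] by (simp add: s)
      qed
    qed
    then show ?thesis by blast
  qed
  ultimately show ?thesis using Uq_ideal_minimal assms(2) by blast
qed

section \<open>Generators, relations and the universal property of
  \<open>U_q(\<mu>, \<nu>)\<close>\<close>

lemma star_algebra_Uq: "q \<noteq> 0 \<Longrightarrow> star_algebra (Uq q \<mu> \<nu>)"
  unfolding Uq_def
  by (intro star_algebra_quot_alg free.calgebra_axioms ideal_Uq_ideal star_algebra_free_alg star_Uq_ideal)

lemma calgebra_Uq: "calgebra (Uq q \<mu> \<nu>)"
  unfolding Uq_def by (intro calgebra_quot_alg free.calgebra_axioms ideal_Uq_ideal)

lemma Uq_proj: "alg_hom free_alg (Uq q \<mu> \<nu>) (\<lambda>p. Uq_ideal q \<mu> \<nu> +>\<^bsub>free_alg\<^esub> p)"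
  unfolding Uq_def by (intro quot_alg_proj free.calgebra_axioms ideal_Uq_ideal)

lemma Uq_proj_word_Cons:
  "Uq_ideal q \<mu> \<nu> +>\<^bsub>free_alg\<^esub> word (x # w) c =
    Uq_gen q \<mu> \<nu> x \<otimes>\<^bsub>Uq q \<mu> \<nu>\<^esub> (Uq_ideal q \<mu> \<nu> +>\<^bsub>free_alg\<^esub> word w c)"
  using alg_homD(3)[OF Uq_proj, of "word [x] 1" "word w c"] by (simp add: Uq_gen_def)

lemma Uq_gen_closed [simp, intro]: "Uq_gen q \<mu> \<nu> x \<in> carrier (Uq q \<mu> \<nu>)"
  unfolding Uq_gen_def by (rule alg_homD(4)[OF Uq_proj]) simp

lemma Uq_gen_star: "q \<noteq> 0 \<Longrightarrow> star (Uq q \<mu> \<nu>) (Uq_gen q \<mu> \<nu> x) = Uq_gen q \<mu> \<nu> (gen_star x)"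
  using quot_alg_star[OF free.calgebra_axioms ideal_Uq_ideal star_algebra_free_alg star_Uq_ideal, of q \<mu> \<nu>]
  by (auto simp: star_hom_def Uq_def Uq_gen_def dest: spec[of _ "word [x] 1"])

lemma Uq_proj_word:
  "Uq_ideal q \<mu> \<nu> +>\<^bsub>free_alg\<^esub> word [] c = c \<odot>\<^bsub>Uq q \<mu> \<nu>\<^esub> \<one>\<^bsub>Uq q \<mu> \<nu>\<^esub>"
  "Uq_ideal q \<mu> \<nu> +>\<^bsub>free_alg\<^esub> word [x] c = c \<odot>\<^bsub>Uq q \<mu> \<nu>\<^esub> Uq_gen q \<mu> \<nu> x"
  "Uq_ideal q \<mu> \<nu> +>\<^bsub>free_alg\<^esub> word [x, y] c =
    c \<odot>\<^bsub>Uq q \<mu> \<nu>\<^esub> (Uq_gen q \<mu> \<nu> x \<otimes>\<^bsub>Uq q \<mu> \<nu>\<^esub> Uq_gen q \<mu> \<nu> y)"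
proof -
  interpret U: calgebra "Uq q \<mu> \<nu>" by (rule calgebra_Uq)
  show one: "Uq_ideal q \<mu> \<nu> +>\<^bsub>free_alg\<^esub> word [] c = c \<odot>\<^bsub>Uq q \<mu> \<nu>\<^esub> \<one>\<^bsub>Uq q \<mu> \<nu>\<^esub>"
    using alg_homD(2)[OF Uq_proj, of q \<mu> \<nu>] alg_homD(6)[OF Uq_proj, of "word [] 1" q \<mu> \<nu> c] by simp
  show "Uq_ideal q \<mu> \<nu> +>\<^bsub>free_alg\<^esub> word [x] c = c \<odot>\<^bsub>Uq q \<mu> \<nu>\<^esub> Uq_gen q \<mu> \<nu> x"
    "Uq_ideal q \<mu> \<nu> +>\<^bsub>free_alg\<^esub> word [x, y] c =
    c \<odot>\<^bsub>Uq q \<mu> \<nu>\<^esub> (Uq_gen q \<mu> \<nu> x \<otimes>\<^bsub>Uq q \<mu> \<nu>\<^esub> Uq_gen q \<mu> \<nu> y)"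
    by (simp_all add: Uq_proj_word_Cons one U.csmult_mult_right)
qed

lemma Uq_rep_gen: "Uq_rep (Uq q \<mu> \<nu>) q \<mu> \<nu> (Uq_gen q \<mu> \<nu>)"
proof -
  interpret U: calgebra "Uq q \<mu> \<nu>" by (rule calgebra_Uq)
  note m = Uq_rels_ideal[where q = q and \<mu> = \<mu> and \<nu> = \<nu>, unfolded Uq_rels_def Let_def]
  have e: "Uq_ideal q \<mu> \<nu> +>\<^bsub>free_alg\<^esub> p = Uq_ideal q \<mu> \<nu> +>\<^bsub>free_alg\<^esub> r"
    if "p - r \<in> Uq_ideal q \<mu> \<nu>" for p r
    by (rule quot_alg_proj_eqI[OF free.calgebra_axioms ideal_Uq_ideal])
      (use that in simp_all)
  have a: "Uq_ideal q \<mu> \<nu> +>\<^bsub>free_alg\<^esub> (p + r) =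
      (Uq_ideal q \<mu> \<nu> +>\<^bsub>free_alg\<^esub> p) \<oplus>\<^bsub>Uq q \<mu> \<nu>\<^esub> (Uq_ideal q \<mu> \<nu> +>\<^bsub>free_alg\<^esub> r)" for p r
    using alg_homD(5)[OF Uq_proj, of p r] by simp
  have "Uq_ideal q \<mu> \<nu> +>\<^bsub>free_alg\<^esub> word [GenE, GenF] 1 = Uq_ideal q \<mu> \<nu> +>\<^bsub>free_alg\<^esub>
      (word [GenF, GenE] 1 + (word [GenK, GenK] (complex_of_real (inverse (q - inverse q) * \<mu>)) +
        word [GenKinv, GenKinv] (- complex_of_real (inverse (q - inverse q) * \<nu>))))"
    by (rule e) (use m[of "(word [GenE, GenF] 1 - word [GenF, GenE] 1) -
       (word [GenK, GenK] (complex_of_real (inverse (q - inverse q) * \<mu>)) -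
        word [GenKinv, GenKinv] (complex_of_real (inverse (q - inverse q) * \<nu>)))"] in
        \<open>simp add: single_uminus algebra_simps\<close>)
  moreover have "Uq_ideal q \<mu> \<nu> +>\<^bsub>free_alg\<^esub> word [GenK, GenF] 1 =
      Uq_ideal q \<mu> \<nu> +>\<^bsub>free_alg\<^esub> word [GenF, GenK] (complex_of_real (inverse q))"
    by (intro e m) simp
  moreover have "Uq_ideal q \<mu> \<nu> +>\<^bsub>free_alg\<^esub> word [GenK, GenE] 1 =
      Uq_ideal q \<mu> \<nu> +>\<^bsub>free_alg\<^esub> word [GenE, GenK] (complex_of_real q)"
    by (intro e m) simp
  moreover have "Uq_ideal q \<mu> \<nu> +>\<^bsub>free_alg\<^esub> word [GenK, GenKinv] 1 = Uq_ideal q \<mu> \<nu> +>\<^bsub>free_alg\<^esub> word [] 1"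
    by (intro e m) simp
  moreover have "Uq_ideal q \<mu> \<nu> +>\<^bsub>free_alg\<^esub> word [GenKinv, GenK] 1 = Uq_ideal q \<mu> \<nu> +>\<^bsub>free_alg\<^esub> word [] 1"
    by (intro e m) simp
  ultimately show ?thesis
    unfolding Uq_rep_def by (auto simp: a Uq_proj_word)
qed

text \<open>The rule for checking identities on generators. Its product case allows two arbitrary
  factors, which suits both multiplicative and antimultiplicative maps.\<close>

lemma Uq_induct [consumes 1, case_names one gen mult smult add]:
  assumes "x \<in> carrier (Uq q \<mu> \<nu>)" and one: "P \<one>\<^bsub>Uq q \<mu> \<nu>\<^esub>" and gen: "\<And>g. P (Uq_gen q \<mu> \<nu> g)"
    and mult: "\<And>x y. x \<in> carrier (Uq q \<mu> \<nu>) \<Longrightarrow> y \<in> carrier (Uq q \<mu> \<nu>) \<Longrightarrow> P x \<Longrightarrow> P y \<Longrightarrow> P (x \<otimes>\<^bsub>Uq q \<mu> \<nu>\<^esub> y)"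
    and smult: "\<And>c x. x \<in> carrier (Uq q \<mu> \<nu>) \<Longrightarrow> P x \<Longrightarrow> P (c \<odot>\<^bsub>Uq q \<mu> \<nu>\<^esub> x)"
    and add: "\<And>x y. x \<in> carrier (Uq q \<mu> \<nu>) \<Longrightarrow> y \<in> carrier (Uq q \<mu> \<nu>) \<Longrightarrow> P x \<Longrightarrow> P y \<Longrightarrow> P (x \<oplus>\<^bsub>Uq q \<mu> \<nu>\<^esub> y)"
  shows "P x"
proof -
  interpret U: calgebra "Uq q \<mu> \<nu>" by (rule calgebra_Uq)
  have "\<exists>p. x = Uq_ideal q \<mu> \<nu> +>\<^bsub>free_alg\<^esub> p"
    using assms(1) unfolding Uq_def quot_alg_carrier[OF free.calgebra_axioms ideal_Uq_ideal] by auto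
  then obtain p where x: "x = Uq_ideal q \<mu> \<nu> +>\<^bsub>free_alg\<^esub> p" ..
  have c: "Uq_ideal q \<mu> \<nu> +>\<^bsub>free_alg\<^esub> p \<in> carrier (Uq q \<mu> \<nu>)" for p
    using alg_homD(4)[OF Uq_proj, of p q \<mu> \<nu>] by simp
  have w: "P (Uq_ideal q \<mu> \<nu> +>\<^bsub>free_alg\<^esub> word w d)" for w d
    by (induction w) (auto simp: Uq_proj_word(1) Uq_proj_word_Cons c intro!: smult one mult gen)
  have "Poly_Mapping.keys p \<subseteq> UNIV" by simp
  then show ?thesis unfolding x
  proof (induction p rule: poly_mapping_keys_induct)
    case zero
    show ?case using w[of "[]" 0] by simp
  next
    case (add p r)
    then show ?case
      using assms(6)[OF c c add(3,4)] alg_homD(5)[OF Uq_proj, of p r q \<mu> \<nu>] by simp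
  qed (rule w)
qed

lemma Uq_alg_hom_eqI:
  assumes "alg_hom (Uq q \<mu> \<nu>) B f" "alg_hom (Uq q \<mu> \<nu>) B g"
    and "\<And>x. f (Uq_gen q \<mu> \<nu> x) = g (Uq_gen q \<mu> \<nu> x)" and "x \<in> carrier (Uq q \<mu> \<nu>)"
  shows "f x = g x"
  using assms(4)
  by (induction x rule: Uq_induct) (simp_all add: assms(3) alg_homD[OF assms(1)] alg_homD[OF assms(2)])

text \<open>Applying \<open>f\<close> before or after the star gives two antilinear
  antimultiplicative maps, so agreement on generators propagates.\<close>

lemma Uq_star_homI:
  assumes "q \<noteq> 0" "star_algebra B" and f: "alg_hom (Uq q \<mu> \<nu>) B f"
    and g: "\<And>x. f (Uq_gen q \<mu> \<nu> (gen_star x)) = star B (f (Uq_gen q \<mu> \<nu> x))"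
  shows "star_hom (Uq q \<mu> \<nu>) B f"
proof -
  interpret U: star_algebra "Uq q \<mu> \<nu>" by (rule star_algebra_Uq[OF assms(1)])
  interpret B: star_algebra B by fact
  note h = alg_homD[OF f]
  have "f (star (Uq q \<mu> \<nu>) x) = star B (f x)" if "x \<in> carrier (Uq q \<mu> \<nu>)" for x
    using that
    by (induction x rule: Uq_induct)
      (simp_all add: h U.star_one B.star_one Uq_gen_star[OF assms(1)] g U.star_mult U.star_add U.star_smult U.star_closed
        B.star_mult B.star_add B.star_smult)
  then show ?thesis using f by (simp add: star_hom_def)
qed

text \<open>Universal property of the presentation: the kernel of the evaluation of words at
  \<open>g\<close> is an ideal that contains the relations, hence the ideal they generate.\<close>

lemma Uq_lift:
  assumes B: "calgebra B" and g: "Uq_rep B q \<mu> \<nu> g"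
  obtains f where "alg_hom (Uq q \<mu> \<nu>) B f" "\<And>x. f (Uq_gen q \<mu> \<nu> x) = g x"
proof -
  interpret B: calgebra B by fact
  have gc [simp]: "g x \<in> carrier B" for x
    using g by (auto simp: Uq_rep_def)
  let ?W = "\<lambda>w. foldr (\<lambda>x y. g x \<otimes>\<^bsub>B\<^esub> y) w \<one>\<^bsub>B\<^esub>"
  let ?h = "lin_ext B ?W"
  have W: "?W w \<in> carrier B" for w by (induction w) simp_all
  have W_append: "?W (v @ w) = ?W v \<otimes>\<^bsub>B\<^esub> ?W w" for v w
    by (induction v) (simp_all add: W B.m_assoc)
  note L = lin_ext_single[OF B W, where K = UNIV] lin_ext_closed[OF B W, where K = UNIV]
    lin_ext_add[OF B W, where K = UNIV] lin_ext_scale[OF B W, where K = UNIV]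
  have hom: "alg_hom free_alg B ?h"
  proof (intro alg_homI lin_mapI)
    show "?h (p \<otimes>\<^bsub>free_alg\<^esub> r) = ?h p \<otimes>\<^bsub>B\<^esub> ?h r" for p r
      unfolding free_alg_def
      by (rule lin_ext_mult[OF B W monoid_free_gen_monoid, where K = UNIV]) (simp_all add: W_append del: foldr_append)
  qed (simp_all add: L)
  note cancel = B.csmult_cancel_one(1)
  have "ring_hom_ring free_alg B ?h"
    using hom by (intro ring_hom_ringI2 free.ring_axioms B.ring_axioms) (simp add: alg_hom_def)
  then have "ideal (a_kernel free_alg B ?h) free_alg" by (rule ring_hom_ring.kernel_is_ideal)
  moreover have "Uq_rels q \<mu> \<nu> \<subseteq> a_kernel free_alg B ?h"
  proof -
    have "?h r = \<zero>\<^bsub>B\<^esub>" if "r \<in> Uq_rels q \<mu> \<nu>" for r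
    proof -
      note s = poly_mapping_diff_scale L B.r_one
      from that show ?thesis
      proof (cases rule: Uq_rels_cases)
        case inv_left
        then show ?thesis using g cancel by (simp add: s Uq_rep_def)
      next
        case inv_right
        then show ?thesis using g cancel by (simp add: s Uq_rep_def)
      next
        case KE
        then show ?thesis
          using g cancel[of "complex_of_real q \<odot>\<^bsub>B\<^esub> (g GenE \<otimes>\<^bsub>B\<^esub> g GenK)"] by (simp add: s Uq_rep_def B.csmult_csmult)
      next
        case KF
        then show ?thesis
          using g cancel[of "complex_of_real (inverse q) \<odot>\<^bsub>B\<^esub> (g GenF \<otimes>\<^bsub>B\<^esub> g GenK)"] by (simp add: s Uq_rep_def B.csmult_csmult)
      next
        case EF
        have rel: "g GenE \<otimes>\<^bsub>B\<^esub> g GenF = g GenF \<otimes>\<^bsub>B\<^esub> g GenE \<oplus>\<^bsub>B\<^esub>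
      (complex_of_real (inverse (q - inverse q) * \<mu>) \<odot>\<^bsub>B\<^esub> (g GenK \<otimes>\<^bsub>B\<^esub> g GenK) \<oplus>\<^bsub>B\<^esub>
       (- complex_of_real (inverse (q - inverse q) * \<nu>)) \<odot>\<^bsub>B\<^esub> (g GenKinv \<otimes>\<^bsub>B\<^esub> g GenKinv))"
          using g unfolding Uq_rep_def by blast
        define a b where ab: "a = complex_of_real (inverse (q - inverse q) * \<mu>)" "b = complex_of_real (inverse (q - inverse q) * \<nu>)"
        \<comment> \<open>All terms but EF are collected under a single scalar -1. Rewriting EF by
          \<open>rel\<close> then leaves y + (-1) y.\<close>
        have "?h r = g GenE \<otimes>\<^bsub>B\<^esub> g GenF \<oplus>\<^bsub>B\<^esub> - 1 \<odot>\<^bsub>B\<^esub> (g GenF \<otimes>\<^bsub>B\<^esub> g GenE \<oplus>\<^bsub>B\<^esub>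
            (a \<odot>\<^bsub>B\<^esub> (g GenK \<otimes>\<^bsub>B\<^esub> g GenK) \<oplus>\<^bsub>B\<^esub> (- b) \<odot>\<^bsub>B\<^esub> (g GenKinv \<otimes>\<^bsub>B\<^esub> g GenKinv)))"
          unfolding EF ab[symmetric]
          by (simp add: s pm.scale_right_distrib B.csmult_distrib B.csmult_csmult B.a_assoc)
        also have "\<dots> = \<zero>\<^bsub>B\<^esub>"
          unfolding ab rel by (rule cancel) simp
        finally show ?thesis .
      qed
    qed
    then show ?thesis by (auto simp: a_kernel_def')
  qed
  ultimately have "Uq_ideal q \<mu> \<nu> \<subseteq> a_kernel free_alg B ?h" by (rule Uq_ideal_minimal)
  then have ker: "?h p = \<zero>\<^bsub>B\<^esub>" if "p \<in> Uq_ideal q \<mu> \<nu>" for p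
    using that by (auto simp: a_kernel_def')
  note Q = free.calgebra_axioms ideal_Uq_ideal B alg_homD(1)[OF hom] ker
  show thesis
  proof (rule that)
    show "alg_hom (Uq q \<mu> \<nu>) B (\<lambda>X. the_elem (?h ` X))"
      unfolding Uq_def by (rule quot_alg_lift_alg[OF Q hom])
    show "the_elem (?h ` Uq_gen q \<mu> \<nu> x) = g x" for x
      unfolding Uq_gen_def using quot_alg_lift[OF Q, of q \<mu> \<nu> "word [x] 1"] by (simp add: L)
  qed
qed

section \<open>Non-triviality\<close>

text \<open>A Verma module: on the span of \<open>e\<^sub>0, e\<^sub>1, \<dots>\<close>, let \<open>K e\<^sub>n = q\<^bsup>-n\<^esup> e\<^sub>n\<close>, \<open>F e\<^sub>n = e\<^sub>n\<^sub>+\<^sub>1\<close>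
  and \<open>E e\<^sub>n = c\<^sub>n e\<^sub>n\<^sub>-\<^sub>1\<close>, where the commutation relation of \<open>E\<close> and \<open>F\<close> prescribes
  the increments of \<open>c\<close>. The operators are written on coefficient sequences.\<close>

definition End_alg :: "((nat \<Rightarrow> complex) \<Rightarrow> nat \<Rightarrow> complex) star_alg" where
  "End_alg = \<lparr>carrier = {f. (\<forall>u v. f (\<lambda>n. u n + v n) = (\<lambda>n. f u n + f v n)) \<and> (\<forall>c u. f (\<lambda>n. c * u n) = (\<lambda>n. c * f u n))},
     mult = (\<circ>), one = id, zero = (\<lambda>_ _. 0), add = (\<lambda>f g v n. f v n + g v n),
     smult = (\<lambda>c f v n. c * f v n), star = id\<rparr>"

lemma calgebra_End_alg: "calgebra End_alg"
  by (rule calgebraI) (auto simp: End_alg_def algebra_simps)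

lemma Uq_nontrivial:
  assumes "q \<noteq> 0"
  shows "\<one>\<^bsub>Uq q \<mu> \<nu>\<^esub> \<noteq> \<zero>\<^bsub>Uq q \<mu> \<nu>\<^esub>"
proof
  assume eq: "\<one>\<^bsub>Uq q \<mu> \<nu>\<^esub> = \<zero>\<^bsub>Uq q \<mu> \<nu>\<^esub>"
  let ?lam = "inverse (q - inverse q)"
  define c :: "nat \<Rightarrow> complex" where
    "c n = (\<Sum>k<n. complex_of_real (?lam * \<mu>) * (complex_of_real (inverse q) ^ k)\<^sup>2 -
      complex_of_real (?lam * \<nu>) * (complex_of_real q ^ k)\<^sup>2)" for n
  \<comment> \<open>The index shift reflects the passage to coefficients: E sends
    \<open>e_(n+1)\<close> to \<open>c (n+1) e_n\<close>, so coefficient n of E v involves v at n +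
    1, while F moves coefficients up by one.\<close>
  define g :: "gen \<Rightarrow> (nat \<Rightarrow> complex) \<Rightarrow> nat \<Rightarrow> complex" where
    "g x = (case x of GenK \<Rightarrow> (\<lambda>v n. complex_of_real (inverse q) ^ n * v n)
      | GenKinv \<Rightarrow> (\<lambda>v n. complex_of_real q ^ n * v n)
      | GenE \<Rightarrow> (\<lambda>v n. c (Suc n) * v (Suc n))
      | GenF \<Rightarrow> (\<lambda>v n. case n of 0 \<Rightarrow> 0 | Suc m \<Rightarrow> v m))" for x
  have "range g \<subseteq> carrier End_alg"
  proof safe
    fix x show "g x \<in> carrier End_alg"
      by (cases x) (auto simp: g_def End_alg_def fun_eq_iff algebra_simps split: nat.split)
  qed
  moreover have "g GenE \<otimes>\<^bsub>End_alg\<^esub> g GenF = g GenF \<otimes>\<^bsub>End_alg\<^esub> g GenE \<oplus>\<^bsub>End_alg\<^esub>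
      (complex_of_real (?lam * \<mu>) \<odot>\<^bsub>End_alg\<^esub> (g GenK \<otimes>\<^bsub>End_alg\<^esub> g GenK) \<oplus>\<^bsub>End_alg\<^esub>
       (- complex_of_real (?lam * \<nu>)) \<odot>\<^bsub>End_alg\<^esub> (g GenKinv \<otimes>\<^bsub>End_alg\<^esub> g GenKinv))"
  proof (intro ext)
    fix v n
    have step: "c (Suc n) = c n + (complex_of_real (?lam * \<mu>) * (complex_of_real (inverse q) ^ n)\<^sup>2 -
      complex_of_real (?lam * \<nu>) * (complex_of_real q ^ n)\<^sup>2)"
      by (simp add: c_def)
    \<comment> \<open>At n = 0 the left side vanishes by the definition of F and the right side
      because \<open>c 0\<close> is an empty sum. This is the condition that E annihilates the
      vector \<open>e_0\<close>.\<close>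
    have FE: "(case n of 0 \<Rightarrow> 0 | Suc m \<Rightarrow> c (Suc m) * v (Suc m)) = c n * v n"
      by (cases n) (simp_all add: c_def)
    show "(g GenE \<otimes>\<^bsub>End_alg\<^esub> g GenF) v n = (g GenF \<otimes>\<^bsub>End_alg\<^esub> g GenE \<oplus>\<^bsub>End_alg\<^esub>
      (complex_of_real (?lam * \<mu>) \<odot>\<^bsub>End_alg\<^esub> (g GenK \<otimes>\<^bsub>End_alg\<^esub> g GenK) \<oplus>\<^bsub>End_alg\<^esub>
       (- complex_of_real (?lam * \<nu>)) \<odot>\<^bsub>End_alg\<^esub> (g GenKinv \<otimes>\<^bsub>End_alg\<^esub> g GenKinv))) v n"
      by (simp add: End_alg_def g_def FE step) (simp add: power2_eq_square algebra_simps)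
  qed
  ultimately have "Uq_rep End_alg q \<mu> \<nu> g"
    unfolding Uq_rep_def using assms
    by (auto simp: End_alg_def g_def fun_eq_iff field_simps split: nat.split)
  then obtain f where f: "alg_hom (Uq q \<mu> \<nu>) End_alg f"
    using Uq_lift[OF calgebra_End_alg] by blast
  have "\<one>\<^bsub>End_alg\<^esub> = \<zero>\<^bsub>End_alg\<^esub>"
    using eq alg_homD(2)[OF f] lin_map_zero[OF calgebra_Uq calgebra_End_alg alg_homD(1)[OF f]] by simp
  then have "id = (\<lambda>(v :: nat \<Rightarrow> complex) n. 0)" by (simp add: End_alg_def)
  from fun_cong[OF fun_cong[OF this, of "\<lambda>_. 1"]] show False by simp
qed

section \<open>Comultiplication\<close>

lemma Uq_repD:
  assumes "Uq_rep B q \<mu> \<nu> g"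
  shows "g x \<in> carrier B"
    and "g GenKinv \<otimes>\<^bsub>B\<^esub> g GenK = \<one>\<^bsub>B\<^esub>" "g GenK \<otimes>\<^bsub>B\<^esub> g GenKinv = \<one>\<^bsub>B\<^esub>"
    and "g GenK \<otimes>\<^bsub>B\<^esub> g GenE = complex_of_real q \<odot>\<^bsub>B\<^esub> (g GenE \<otimes>\<^bsub>B\<^esub> g GenK)"
    and "g GenK \<otimes>\<^bsub>B\<^esub> g GenF = complex_of_real (inverse q) \<odot>\<^bsub>B\<^esub> (g GenF \<otimes>\<^bsub>B\<^esub> g GenK)"
    and "g GenE \<otimes>\<^bsub>B\<^esub> g GenF = g GenF \<otimes>\<^bsub>B\<^esub> g GenE \<oplus>\<^bsub>B\<^esub>
      (complex_of_real (inverse (q - inverse q) * \<mu>) \<odot>\<^bsub>B\<^esub> (g GenK \<otimes>\<^bsub>B\<^esub> g GenK) \<oplus>\<^bsub>B\<^esub>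
       (- complex_of_real (inverse (q - inverse q) * \<nu>)) \<odot>\<^bsub>B\<^esub> (g GenKinv \<otimes>\<^bsub>B\<^esub> g GenKinv))"
  using assms unfolding Uq_rep_def by blast+

text \<open>Multiplying K x = c x K by the inverse of K on both sides turns the factor c into its
  inverse.\<close>

lemma Uq_rep_inv_comm:
  assumes "calgebra B" "Uq_rep B q \<mu> \<nu> g" "q \<noteq> 0"
  shows "g GenKinv \<otimes>\<^bsub>B\<^esub> g GenE = complex_of_real (inverse q) \<odot>\<^bsub>B\<^esub> (g GenE \<otimes>\<^bsub>B\<^esub> g GenKinv)"
    and "g GenKinv \<otimes>\<^bsub>B\<^esub> g GenF = complex_of_real q \<odot>\<^bsub>B\<^esub> (g GenF \<otimes>\<^bsub>B\<^esub> g GenKinv)"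
proof -
  interpret B: calgebra B by fact
  note r = Uq_repD[OF assms(2)]
  have *: "g GenKinv \<otimes>\<^bsub>B\<^esub> x = inverse c \<odot>\<^bsub>B\<^esub> (x \<otimes>\<^bsub>B\<^esub> g GenKinv)"
    if x: "x \<in> carrier B" and c: "c \<noteq> 0" and eq: "g GenK \<otimes>\<^bsub>B\<^esub> x = c \<odot>\<^bsub>B\<^esub> (x \<otimes>\<^bsub>B\<^esub> g GenK)" for x c
  proof -
    have "g GenKinv \<otimes>\<^bsub>B\<^esub> x = g GenKinv \<otimes>\<^bsub>B\<^esub> (inverse c \<odot>\<^bsub>B\<^esub> (c \<odot>\<^bsub>B\<^esub> (x \<otimes>\<^bsub>B\<^esub> g GenK))) \<otimes>\<^bsub>B\<^esub> g GenKinv"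
      using x c r(1) by (simp add: B.csmult_csmult B.m_assoc r(3))
    also have "\<dots> = inverse c \<odot>\<^bsub>B\<^esub> ((g GenKinv \<otimes>\<^bsub>B\<^esub> g GenK) \<otimes>\<^bsub>B\<^esub> x \<otimes>\<^bsub>B\<^esub> g GenKinv)"
      unfolding eq[symmetric] using x r(1)
      by (simp add: B.csmult_mult_left B.csmult_mult_right B.m_assoc)
    finally show ?thesis using x r(1) by (simp add: r(2))
  qed
  show "g GenKinv \<otimes>\<^bsub>B\<^esub> g GenE = complex_of_real (inverse q) \<odot>\<^bsub>B\<^esub> (g GenE \<otimes>\<^bsub>B\<^esub> g GenKinv)"
    using *[OF r(1) _ r(4)] assms(3) by simp
  show "g GenKinv \<otimes>\<^bsub>B\<^esub> g GenF = complex_of_real q \<odot>\<^bsub>B\<^esub> (g GenF \<otimes>\<^bsub>B\<^esub> g GenKinv)"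
    using *[OF r(1) _ r(5)] assms(3) by simp
qed

lemmas Uq_gen_simps =
  Uq_repD(2-5)[OF Uq_rep_gen] Uq_rep_inv_comm[OF calgebra_Uq Uq_rep_gen]

text \<open>\<open>Uq_Delta\<close> is prescribed on E and K only. The value on F is forced by F =
  E*, the one on the inverse of K by uniqueness of inverses; since K is self-adjoint, F follows the
  same formula as E.\<close>

definition Delta_gen :: "real \<Rightarrow> real \<Rightarrow> real \<Rightarrow> real \<Rightarrow> gen \<Rightarrow> (Uq_elem \<times> Uq_elem \<Rightarrow>\<^sub>0 complex) set" where
  "Delta_gen q \<mu> \<upsilon> \<nu> x = (let A = Uq q \<mu> \<upsilon>; B = Uq q \<upsilon> \<nu> in
    if x \<in> {GenK, GenKinv} then pure_tensor A B (Uq_gen q \<mu> \<upsilon> x) (Uq_gen q \<upsilon> \<nu> x)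
    else pure_tensor A B (Uq_gen q \<mu> \<upsilon> x) (Uq_gen q \<upsilon> \<nu> GenK) \<oplus>\<^bsub>A \<boxtimes> B\<^esub>
      pure_tensor A B (Uq_gen q \<mu> \<upsilon> GenKinv) (Uq_gen q \<upsilon> \<nu> x))"

text \<open>The mixed terms E \<otimes> K and K^-1 \<otimes> F commute, as their factors q and 1/q
  cancel, and so do those with E and F exchanged. Hence the commutator of the images of E and F is
  [E, F] \<otimes> K^2 + K^-2 \<otimes> [E, F], in which the contributions of the middle index
  \<upsilon> cancel.\<close>

lemma Uq_rep_Delta_gen:
  assumes "q \<noteq> 0"
  shows "Uq_rep (Uq q \<mu> \<upsilon> \<boxtimes> Uq q \<upsilon> \<nu>) q \<mu> \<nu> (Delta_gen q \<mu> \<upsilon> \<nu>)"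
proof -
  let ?A = "Uq q \<mu> \<upsilon>" and ?B = "Uq q \<upsilon> \<nu>"
  let ?a = "Uq_gen q \<mu> \<upsilon>" and ?b = "Uq_gen q \<upsilon> \<nu>"
  let ?T = "?A \<boxtimes> ?B" and ?D = "Delta_gen q \<mu> \<upsilon> \<nu>"
  let ?p = "pure_tensor ?A ?B"
  interpret alg_pair ?A ?B by (intro alg_pair.intro calgebra_Uq)
  note s = Delta_gen_def Let_def pure_mult pure_lin T.l_distr T.r_distr T.csmult_distrib T.csmult_csmult
    A.csmult_closed B.csmult_closed Uq_gen_simps assms
  have "range ?D \<subseteq> carrier ?T"
    by (auto simp: Delta_gen_def Let_def)
  moreover have "?D GenKinv \<otimes>\<^bsub>?T\<^esub> ?D GenK = \<one>\<^bsub>?T\<^esub>" "?D GenK \<otimes>\<^bsub>?T\<^esub> ?D GenKinv = \<one>\<^bsub>?T\<^esub>"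
    by (simp_all add: s pure_one)
  moreover have "?D GenK \<otimes>\<^bsub>?T\<^esub> ?D GenE = complex_of_real q \<odot>\<^bsub>?T\<^esub> (?D GenE \<otimes>\<^bsub>?T\<^esub> ?D GenK)"
    by (simp add: s)
  moreover have "?D GenK \<otimes>\<^bsub>?T\<^esub> ?D GenF = complex_of_real (inverse q) \<odot>\<^bsub>?T\<^esub> (?D GenF \<otimes>\<^bsub>?T\<^esub> ?D GenK)"
    by (simp add: s)
  moreover have "?D GenE \<otimes>\<^bsub>?T\<^esub> ?D GenF = ?D GenF \<otimes>\<^bsub>?T\<^esub> ?D GenE \<oplus>\<^bsub>?T\<^esub>
      (complex_of_real (inverse (q - inverse q) * \<mu>) \<odot>\<^bsub>?T\<^esub> (?D GenK \<otimes>\<^bsub>?T\<^esub> ?D GenK) \<oplus>\<^bsub>?T\<^esub>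
       (- complex_of_real (inverse (q - inverse q) * \<nu>)) \<odot>\<^bsub>?T\<^esub> (?D GenKinv \<otimes>\<^bsub>?T\<^esub> ?D GenKinv))"
  proof -
    define a b c where abc: "a = complex_of_real (inverse (q - inverse q) * \<mu>)"
      "b = complex_of_real (inverse (q - inverse q) * \<upsilon>)" "c = complex_of_real (inverse (q - inverse q) * \<nu>)"
    \<comment> \<open>The term K^-2 \<otimes> K^2, which carries \<upsilon>: with coefficient -b
      from the left factor and b from the right one.\<close>
    let ?W = "?p (?a GenKinv \<otimes>\<^bsub>?A\<^esub> ?a GenKinv) (?b GenK \<otimes>\<^bsub>?B\<^esub> ?b GenK)"
    note EF = Uq_repD(6)[OF Uq_rep_gen, of q \<mu> \<upsilon>, folded abc] Uq_repD(6)[OF Uq_rep_gen, of q \<upsilon> \<nu>, folded abc]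
    have "?D GenE \<otimes>\<^bsub>?T\<^esub> ?D GenF = ?D GenF \<otimes>\<^bsub>?T\<^esub> ?D GenE \<oplus>\<^bsub>?T\<^esub>
      (a \<odot>\<^bsub>?T\<^esub> (?D GenK \<otimes>\<^bsub>?T\<^esub> ?D GenK) \<oplus>\<^bsub>?T\<^esub> (- c) \<odot>\<^bsub>?T\<^esub> (?D GenKinv \<otimes>\<^bsub>?T\<^esub> ?D GenKinv)) \<oplus>\<^bsub>?T\<^esub>
      (b \<odot>\<^bsub>?T\<^esub> ?W \<oplus>\<^bsub>?T\<^esub> (- b) \<odot>\<^bsub>?T\<^esub> ?W)"
      by (simp add: s EF T.a_ac)
    then show ?thesis
      unfolding abc[symmetric] by (simp add: T.csmult_cancel Delta_gen_def Let_def)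
  qed
  ultimately show ?thesis unfolding Uq_rep_def by blast
qed

context
  fixes q \<mu> \<upsilon> \<nu> :: real
  assumes q: "q \<noteq> 0"
begin

interpretation alg_pair "Uq q \<mu> \<upsilon>" "Uq q \<upsilon> \<nu>" by (intro alg_pair.intro calgebra_Uq)

lemma star_algebra_Uq_tensor: "star_algebra (Uq q \<mu> \<upsilon> \<boxtimes> Uq q \<upsilon> \<nu>)"
  by (intro star_algebra_tensor star_algebra_Uq q)

lemma Uq_Delta_ex:
  obtains f where "star_hom (Uq q \<mu> \<nu>) (Uq q \<mu> \<upsilon> \<boxtimes> Uq q \<upsilon> \<nu>) f"
    "\<And>x. f (Uq_gen q \<mu> \<nu> x) = Delta_gen q \<mu> \<upsilon> \<nu> x"
proof -
  interpret S: star_algebra "Uq q \<mu> \<upsilon> \<boxtimes> Uq q \<upsilon> \<nu>" by (rule star_algebra_Uq_tensor)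
  obtain f where f: "alg_hom (Uq q \<mu> \<nu>) (Uq q \<mu> \<upsilon> \<boxtimes> Uq q \<upsilon> \<nu>) f"
    and g: "\<And>x. f (Uq_gen q \<mu> \<nu> x) = Delta_gen q \<mu> \<upsilon> \<nu> x"
    using Uq_lift[OF T.calgebra_axioms Uq_rep_Delta_gen[OF q]] by blast
  have "star_hom (Uq q \<mu> \<nu>) (Uq q \<mu> \<upsilon> \<boxtimes> Uq q \<upsilon> \<nu>) f"
  proof (rule Uq_star_homI[OF q S.star_algebra_axioms f])
    fix x show "f (Uq_gen q \<mu> \<nu> (gen_star x)) = star (Uq q \<mu> \<upsilon> \<boxtimes> Uq q \<upsilon> \<nu>) (f (Uq_gen q \<mu> \<nu> x))"
      by (cases x) (simp_all add: g Delta_gen_def Let_def S.star_add star_pure star_algebra_Uq Uq_gen_star q)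
  qed
  with g that show thesis by blast
qed

text \<open>Uniqueness on the two generators that \<open>Uq_Delta\<close> does not mention: the
  image of the inverse of K is an inverse of the image of K, and the image of F is the star of the
  image of E.\<close>

lemma star_hom_Delta_genI:
  assumes f: "star_hom (Uq q \<mu> \<nu>) (Uq q \<mu> \<upsilon> \<boxtimes> Uq q \<upsilon> \<nu>) f"
    and E: "f (Uq_gen q \<mu> \<nu> GenE) = Delta_gen q \<mu> \<upsilon> \<nu> GenE"
    and K: "f (Uq_gen q \<mu> \<nu> GenK) = Delta_gen q \<mu> \<upsilon> \<nu> GenK"
  shows "f (Uq_gen q \<mu> \<nu> x) = Delta_gen q \<mu> \<upsilon> \<nu> x"
proof (cases x)
  interpret S: star_algebra "Uq q \<mu> \<upsilon> \<boxtimes> Uq q \<upsilon> \<nu>" by (rule star_algebra_Uq_tensor)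
  let ?T = "Uq q \<mu> \<upsilon> \<boxtimes> Uq q \<upsilon> \<nu>" and ?D = "Delta_gen q \<mu> \<upsilon> \<nu>"
  have h: "alg_hom (Uq q \<mu> \<nu>) ?T f" using f by (simp add: star_hom_def)
  {
    case GenKinv
    note r = Uq_repD[OF Uq_rep_Delta_gen[OF q, of \<mu> \<upsilon> \<nu>]]
    have fc: "f (Uq_gen q \<mu> \<nu> GenKinv) \<in> carrier ?T" by (rule alg_homD(4)[OF h]) simp
    have "f (Uq_gen q \<mu> \<nu> GenKinv) = f (Uq_gen q \<mu> \<nu> GenKinv) \<otimes>\<^bsub>?T\<^esub> (?D GenK \<otimes>\<^bsub>?T\<^esub> ?D GenKinv)"
      using fc by (simp add: r(3))
    also have "\<dots> = f (Uq_gen q \<mu> \<nu> GenKinv \<otimes>\<^bsub>Uq q \<mu> \<nu>\<^esub> Uq_gen q \<mu> \<nu> GenK) \<otimes>\<^bsub>?T\<^esub> ?D GenKinv"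
      using fc r(1) by (simp add: T.m_assoc alg_homD(3)[OF h] K)
    also have "\<dots> = ?D GenKinv"
      using r(1) by (simp add: Uq_gen_simps alg_homD(2)[OF h])
    finally show ?thesis using GenKinv by simp
  next
    case GenF
    have "f (Uq_gen q \<mu> \<nu> GenF) = star ?T (f (Uq_gen q \<mu> \<nu> GenE))"
      using f Uq_gen_star[OF q, of \<mu> \<nu> GenE] by (metis Uq_gen_closed gen_star.simps(3) star_hom_def)
    then show ?thesis
      using GenF by (simp add: E Delta_gen_def Let_def S.star_add star_pure star_algebra_Uq Uq_gen_star q)
  }
qed (use E K in simp_all)

text \<open>Discharges the definite description in \<open>Uq_Delta\<close>. Generators determine the
  map on the carrier, and extensionality fixes it elsewhere; the lifted map is restricted to the
  carrier accordingly.\<close>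

lemma
  shows star_hom_Uq_Delta: "star_hom (Uq q \<mu> \<nu>) (Uq q \<mu> \<upsilon> \<boxtimes> Uq q \<upsilon> \<nu>) (Uq_Delta q \<mu> \<upsilon> \<nu>)"
    and Uq_Delta_gen: "Uq_Delta q \<mu> \<upsilon> \<nu> (Uq_gen q \<mu> \<nu> x) = Delta_gen q \<mu> \<upsilon> \<nu> x"
proof -
  interpret U: star_algebra "Uq q \<mu> \<nu>" by (rule star_algebra_Uq[OF q])
  let ?T = "Uq q \<mu> \<upsilon> \<boxtimes> Uq q \<upsilon> \<nu>"
  let ?P = "\<lambda>f. f \<in> extensional (carrier (Uq q \<mu> \<nu>)) \<and> star_hom (Uq q \<mu> \<nu>) ?T f \<and>
    f (Uq_gen q \<mu> \<nu> GenE) = Delta_gen q \<mu> \<upsilon> \<nu> GenE \<and> f (Uq_gen q \<mu> \<nu> GenK) = Delta_gen q \<mu> \<upsilon> \<nu> GenK"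
  have D: "Uq_Delta q \<mu> \<upsilon> \<nu> = (THE f. ?P f)"
    by (simp add: Uq_Delta_def Delta_gen_def Let_def)
  have "\<exists>!f. ?P f"
  proof (rule ex_ex1I)
    obtain f where f: "star_hom (Uq q \<mu> \<nu>) ?T f" "\<And>x. f (Uq_gen q \<mu> \<nu> x) = Delta_gen q \<mu> \<upsilon> \<nu> x"
      using Uq_Delta_ex by blast
    then have "?P (restrict f (carrier (Uq q \<mu> \<nu>)))"
      by (auto simp: star_hom_def alg_hom_def lin_map_def ring_hom_def U.star_closed Pi_iff)
    then show "\<exists>f. ?P f" by blast
  next
    fix f g assume f: "?P f" and g: "?P g"
    show "f = g"
    proof (rule extensionalityI[of _ "carrier (Uq q \<mu> \<nu>)"])
      fix x assume "x \<in> carrier (Uq q \<mu> \<nu>)"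
      then show "f x = g x"
      proof (rule Uq_alg_hom_eqI[rotated 3])
        show "alg_hom (Uq q \<mu> \<nu>) ?T f" "alg_hom (Uq q \<mu> \<nu>) ?T g"
          using f g by (simp_all add: star_hom_def)
        show "f (Uq_gen q \<mu> \<nu> y) = g (Uq_gen q \<mu> \<nu> y)" for y
          using f g star_hom_Delta_genI[of f y] star_hom_Delta_genI[of g y] by simp
      qed
    qed (use f g in auto)
  qed
  from theI'[OF this] have P: "?P (Uq_Delta q \<mu> \<upsilon> \<nu>)" unfolding D .
  then show "star_hom (Uq q \<mu> \<nu>) ?T (Uq_Delta q \<mu> \<upsilon> \<nu>)"
    "Uq_Delta q \<mu> \<upsilon> \<nu> (Uq_gen q \<mu> \<nu> x) = Delta_gen q \<mu> \<upsilon> \<nu> x"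
    using star_hom_Delta_genI by blast+
qed

lemma alg_hom_Uq_Delta: "alg_hom (Uq q \<mu> \<nu>) (Uq q \<mu> \<upsilon> \<boxtimes> Uq q \<upsilon> \<nu>) (Uq_Delta q \<mu> \<upsilon> \<nu>)"
  using star_hom_Uq_Delta by (simp add: star_hom_def)

end

text \<open>Four free indices make this one statement serve everywhere: coassociativity in the Hopf
  algebras, both comodule axioms, and the compatibility of the two coactions, which is the case
  \<upsilon> = \<mu>, \<rho> = \<nu>. Both sides are homomorphisms, so generators suffice.\<close>

lemma Uq_Delta_coassoc:
  assumes q: "q \<noteq> 0" and "x \<in> carrier (Uq q \<mu> \<nu>)"
  shows "tensor_map (Uq q \<mu> \<upsilon>) (Uq q \<upsilon> \<rho> \<boxtimes> Uq q \<rho> \<nu>) id (Uq_Delta q \<upsilon> \<rho> \<nu>) (Uq_Delta q \<mu> \<upsilon> \<nu> x) =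
    tensor_assoc (Uq q \<mu> \<upsilon>) (Uq q \<upsilon> \<rho>) (Uq q \<rho> \<nu>)
      (tensor_map (Uq q \<mu> \<upsilon> \<boxtimes> Uq q \<upsilon> \<rho>) (Uq q \<rho> \<nu>) (Uq_Delta q \<mu> \<upsilon> \<rho>) id (Uq_Delta q \<mu> \<rho> \<nu> x))"
    (is "?l x = ?r x")
proof -
  let ?A = "Uq q \<mu> \<upsilon>" and ?B = "Uq q \<upsilon> \<rho>" and ?C = "Uq q \<rho> \<nu>"
  interpret AB: alg_pair ?A ?B by (intro alg_pair.intro calgebra_Uq)
  interpret BC: alg_pair ?B ?C by (intro alg_pair.intro calgebra_Uq)
  interpret A_BC: alg_pair ?A "?B \<boxtimes> ?C" by (intro alg_pair.intro calgebra_Uq BC.T.calgebra_axioms)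
  interpret AB_C: alg_pair "?A \<boxtimes> ?B" ?C by (intro alg_pair.intro calgebra_Uq AB.T.calgebra_axioms)
  interpret A_U: alg_pair ?A "Uq q \<upsilon> \<nu>" by (intro alg_pair.intro calgebra_Uq)
  interpret U_C: alg_pair "Uq q \<mu> \<rho>" ?C by (intro alg_pair.intro calgebra_Uq)
  note D = alg_hom_Uq_Delta[OF q]
  note c = calgebra_Uq AB.T.calgebra_axioms BC.T.calgebra_axioms
  note m1 = tensor_map_alg[OF c(1) c(1) c(1) BC.T.calgebra_axioms lin_map_id alg_homD(1)[OF D] alg_hom_id D]
  note m2 = tensor_map_alg[OF c(1) c(1) AB.T.calgebra_axioms c(1) alg_homD(1)[OF D] lin_map_id D alg_hom_id]
  note p = tensor_map_pure[OF c(1) c(1) c(1) BC.T.calgebra_axioms lin_map_id alg_homD(1)[OF D]]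
    tensor_map_pure[OF c(1) c(1) AB.T.calgebra_axioms c(1) alg_homD(1)[OF D] lin_map_id]
    tensor_assoc_pure[OF c(1) c(1) c(1)]
  note h = alg_homD[OF m1] alg_homD[OF m2] alg_homD[OF tensor_assoc_alg[OF c(1) c(1) c(1)]]
  show "?l x = ?r x"
  proof (rule Uq_alg_hom_eqI[OF _ _ _ assms(2)])
    show "alg_hom (Uq q \<mu> \<nu>) (?A \<boxtimes> (?B \<boxtimes> ?C)) ?l"
      by (rule alg_hom_comp[OF D m1])
    show "alg_hom (Uq q \<mu> \<nu>) (?A \<boxtimes> (?B \<boxtimes> ?C)) ?r"
      by (rule alg_hom_comp[OF alg_hom_comp[OF D m2] tensor_assoc_alg]) (rule calgebra_Uq)+
    show "?l (Uq_gen q \<mu> \<nu> y) = ?r (Uq_gen q \<mu> \<nu> y)" for y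
      by (cases y) (simp_all add: Uq_Delta_gen[OF q] Delta_gen_def Let_def id_def h[unfolded id_def] p[unfolded id_def]
          A_BC.pure_lin AB_C.pure_lin A_BC.T.a_ac)
  qed
qed

section \<open>Counit and antipode\<close>

lemma calgebra_complex_alg: "calgebra complex_alg"
  by (rule calgebraI) (simp_all add: algebra_simps)

definition gen_counit :: "gen \<Rightarrow> complex" where
  "gen_counit x = (if x \<in> {GenK, GenKinv} then 1 else 0)"

text \<open>With E and F sent to 0 and K to 1, the commutator relation becomes 0 = \<lambda>(\<mu> -
  \<mu>), which is where equality of the two indices enters.\<close>

lemma Uq_counit_ex:
  obtains \<epsilon> where "alg_hom (Uq q \<mu> \<mu>) complex_alg \<epsilon>" "\<And>x. \<epsilon> (Uq_gen q \<mu> \<mu> x) = gen_counit x"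
proof -
  have "Uq_rep complex_alg q \<mu> \<mu> gen_counit"
    by (simp add: Uq_rep_def gen_counit_def)
  then show thesis using that by (auto elim: Uq_lift[OF calgebra_complex_alg])
qed

text \<open>Scalars are central, so h \<otimes> a maps to \<epsilon>(h) a multiplicatively. The
  composite with \<Delta> is then an endomorphism, which is compared with the identity on
  generators.\<close>

lemma Uq_counit_left:
  assumes q: "q \<noteq> 0" and e: "alg_hom (Uq q \<mu> \<mu>) complex_alg \<epsilon>" "\<And>x. \<epsilon> (Uq_gen q \<mu> \<mu> x) = gen_counit x"
    and x: "x \<in> carrier (Uq q \<mu> \<nu>)"
  shows "tensor_lift (Uq q \<mu> \<nu>) (\<lambda>h a. \<epsilon> h \<odot>\<^bsub>Uq q \<mu> \<nu>\<^esub> a) (Uq_Delta q \<mu> \<mu> \<nu> x) = x"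
proof -
  let ?H = "Uq q \<mu> \<mu>" and ?A = "Uq q \<mu> \<nu>"
  let ?f = "tensor_lift ?A (\<lambda>h a. \<epsilon> h \<odot>\<^bsub>?A\<^esub> a)"
  interpret alg_pair ?H ?A by (intro alg_pair.intro calgebra_Uq)
  note h = alg_homD[OF e(1), simplified]
  have bl: "bilin ?H ?A ?A (\<lambda>h a. \<epsilon> h \<odot>\<^bsub>?A\<^esub> a)"
    by (intro bilinI lin_mapI) (simp_all add: h B.csmult_add B.csmult_distrib B.csmult_csmult mult.commute)
  note l = tensor_lift_lin[OF calgebra_Uq bl] and p = tensor_lift_pure[OF calgebra_Uq bl]
  have "alg_hom (?H \<boxtimes> ?A) ?A ?f"
    by (rule tensor_alg_homI[OF calgebra_Uq l])
      (simp_all add: p h B.csmult_mult_left B.csmult_mult_right B.csmult_csmult mult.commute)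
  then have "alg_hom ?A ?A (\<lambda>x. ?f (Uq_Delta q \<mu> \<mu> \<nu> x))"
    by (rule alg_hom_comp[OF alg_hom_Uq_Delta[OF q]])
  then show ?thesis
  proof (rule Uq_alg_hom_eqI[where g = id, simplified, OF _ alg_hom_id _ x])
    show "?f (Uq_Delta q \<mu> \<mu> \<nu> (Uq_gen q \<mu> \<nu> y)) = Uq_gen q \<mu> \<nu> y" for y
      by (cases y) (simp_all add: Uq_Delta_gen[OF q] Delta_gen_def Let_def lin_mapD[OF l] p e(2) gen_counit_def)
  qed
qed

lemma Uq_counit_right:
  assumes q: "q \<noteq> 0" and e: "alg_hom (Uq q \<nu> \<nu>) complex_alg \<epsilon>" "\<And>x. \<epsilon> (Uq_gen q \<nu> \<nu> x) = gen_counit x"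
    and x: "x \<in> carrier (Uq q \<mu> \<nu>)"
  shows "tensor_lift (Uq q \<mu> \<nu>) (\<lambda>a h. \<epsilon> h \<odot>\<^bsub>Uq q \<mu> \<nu>\<^esub> a) (Uq_Delta q \<mu> \<nu> \<nu> x) = x"
proof -
  let ?H = "Uq q \<nu> \<nu>" and ?A = "Uq q \<mu> \<nu>"
  let ?f = "tensor_lift ?A (\<lambda>a h. \<epsilon> h \<odot>\<^bsub>?A\<^esub> a)"
  interpret alg_pair ?A ?H by (intro alg_pair.intro calgebra_Uq)
  note h = alg_homD[OF e(1), simplified]
  have bl: "bilin ?A ?H ?A (\<lambda>a h. \<epsilon> h \<odot>\<^bsub>?A\<^esub> a)"
    by (intro bilinI lin_mapI) (simp_all add: h A.csmult_add A.csmult_distrib A.csmult_csmult mult.commute)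
  note l = tensor_lift_lin[OF calgebra_Uq bl] and p = tensor_lift_pure[OF calgebra_Uq bl]
  have "alg_hom (?A \<boxtimes> ?H) ?A ?f"
    by (rule tensor_alg_homI[OF calgebra_Uq l])
      (simp_all add: p h A.csmult_mult_left A.csmult_mult_right A.csmult_csmult mult.commute)
  then have "alg_hom ?A ?A (\<lambda>x. ?f (Uq_Delta q \<mu> \<nu> \<nu> x))"
    by (rule alg_hom_comp[OF alg_hom_Uq_Delta[OF q]])
  then show ?thesis
  proof (rule Uq_alg_hom_eqI[where g = id, simplified, OF _ alg_hom_id _ x])
    show "?f (Uq_Delta q \<mu> \<nu> \<nu> (Uq_gen q \<mu> \<nu> y)) = Uq_gen q \<mu> \<nu> y" for y
      by (cases y) (simp_all add: Uq_Delta_gen[OF q] Delta_gen_def Let_def lin_mapD[OF l] p e(2) gen_counit_def)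
  qed
qed

text \<open>Turns antihomomorphisms into homomorphisms, so that \<open>Uq_lift\<close> can produce
  the antipode.\<close>

definition op_alg :: "'a star_alg \<Rightarrow> 'a star_alg" where
  "op_alg A = A\<lparr>mult := (\<lambda>x y. y \<otimes>\<^bsub>A\<^esub> x)\<rparr>"

lemma op_alg_simps [simp]:
  "carrier (op_alg A) = carrier A" "one (op_alg A) = one A" "zero (op_alg A) = zero A"
  "add (op_alg A) = add A" "smult (op_alg A) = smult A" "x \<otimes>\<^bsub>op_alg A\<^esub> y = y \<otimes>\<^bsub>A\<^esub> x"
  by (simp_all add: op_alg_def)

lemma calgebra_op_alg:
  assumes "calgebra A"
  shows "calgebra (op_alg A)"
proof -
  interpret calgebra A by fact
  show ?thesis
    by (rule calgebraI)
      (simp_all add: m_assoc l_distr r_distr csmult_add csmult_distrib csmult_csmult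
        csmult_mult_left csmult_mult_right a_ac)
qed

text \<open>The constants are forced by S(h1) h2 = \<epsilon>(h) 1. On E it reads S(E) K + K E = 0,
  and KE = q EK gives S(E) = -q E; on F the commutation factor is 1/q instead.\<close>

definition antipode_gen :: "real \<Rightarrow> real \<Rightarrow> real \<Rightarrow> gen \<Rightarrow> Uq_elem" where
  "antipode_gen q \<mu> \<nu> x = (case x of GenK \<Rightarrow> Uq_gen q \<nu> \<mu> GenKinv | GenKinv \<Rightarrow> Uq_gen q \<nu> \<mu> GenK
    | GenE \<Rightarrow> (- complex_of_real q) \<odot>\<^bsub>Uq q \<nu> \<mu>\<^esub> Uq_gen q \<nu> \<mu> GenE
    | GenF \<Rightarrow> (- complex_of_real (inverse q)) \<odot>\<^bsub>Uq q \<nu> \<mu>\<^esub> Uq_gen q \<nu> \<mu> GenF)"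

lemma Uq_antipode_ex:
  assumes "q \<noteq> 0"
  obtains S where "alg_hom (Uq q \<mu> \<nu>) (op_alg (Uq q \<nu> \<mu>)) S"
    "\<And>x. S (Uq_gen q \<mu> \<nu> x) = antipode_gen q \<mu> \<nu> x"
proof -
  interpret U: calgebra "Uq q \<nu> \<mu>" by (rule calgebra_Uq)
  let ?U = "Uq q \<nu> \<mu>" and ?g = "Uq_gen q \<nu> \<mu>"
  define a b where ab: "a = complex_of_real (inverse (q - inverse q) * \<mu>)"
      "b = complex_of_real (inverse (q - inverse q) * \<nu>)"
  note EF = Uq_repD(6)[OF Uq_rep_gen, of q \<nu> \<mu>, folded ab]
  \<comment> \<open>The relation that the images must satisfy in the opposite algebra: the scalars
    -q and -1/q multiply to 1, and the commutator relation of \<open>U_q(\<nu>, \<mu>)\<close>,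
    solved for FE, is exactly the one for (\<mu>, \<nu>) with K and its inverse exchanged.\<close>
  have "?g GenF \<otimes>\<^bsub>?U\<^esub> ?g GenE = ?g GenE \<otimes>\<^bsub>?U\<^esub> ?g GenF \<oplus>\<^bsub>?U\<^esub>
     (a \<odot>\<^bsub>?U\<^esub> (?g GenKinv \<otimes>\<^bsub>?U\<^esub> ?g GenKinv) \<oplus>\<^bsub>?U\<^esub> (- b) \<odot>\<^bsub>?U\<^esub> (?g GenK \<otimes>\<^bsub>?U\<^esub> ?g GenK))"
  proof -
    have "?g GenE \<otimes>\<^bsub>?U\<^esub> ?g GenF \<oplus>\<^bsub>?U\<^esub>
       (a \<odot>\<^bsub>?U\<^esub> (?g GenKinv \<otimes>\<^bsub>?U\<^esub> ?g GenKinv) \<oplus>\<^bsub>?U\<^esub> (- b) \<odot>\<^bsub>?U\<^esub> (?g GenK \<otimes>\<^bsub>?U\<^esub> ?g GenK)) =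
      ?g GenF \<otimes>\<^bsub>?U\<^esub> ?g GenE \<oplus>\<^bsub>?U\<^esub>
       ((b \<odot>\<^bsub>?U\<^esub> (?g GenK \<otimes>\<^bsub>?U\<^esub> ?g GenK) \<oplus>\<^bsub>?U\<^esub> (- b) \<odot>\<^bsub>?U\<^esub> (?g GenK \<otimes>\<^bsub>?U\<^esub> ?g GenK)) \<oplus>\<^bsub>?U\<^esub>
        (a \<odot>\<^bsub>?U\<^esub> (?g GenKinv \<otimes>\<^bsub>?U\<^esub> ?g GenKinv) \<oplus>\<^bsub>?U\<^esub> (- a) \<odot>\<^bsub>?U\<^esub> (?g GenKinv \<otimes>\<^bsub>?U\<^esub> ?g GenKinv)))"
      by (simp add: EF U.a_ac)
    then show ?thesis by (simp add: U.csmult_cancel)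
  qed
  then have "Uq_rep (op_alg ?U) q \<mu> \<nu> (antipode_gen q \<mu> \<nu>)"
    unfolding Uq_rep_def ab[symmetric] using assms
    by (auto simp: antipode_gen_def U.csmult_mult_left U.csmult_mult_right U.csmult_csmult Uq_gen_simps
        split: gen.split)
  then show thesis using that by (auto elim: Uq_lift[OF calgebra_op_alg[OF calgebra_Uq]])
qed

text \<open>The next two lemmas replace the usual antipode calculations in Sweedler notation: an
  identity \<open>\<Phi>(\<Delta>(h)) = z(h)\<close> with \<open>\<Phi>(a \<otimes> b)\<close> of the form \<open>l r\<close>, where \<open>r\<close> is antimultiplicative
  in \<open>a \<otimes> b\<close>, needs to be checked on generators only as soon as \<open>z\<close> commutes with \<open>r\<close>.\<close>

context
  fixes A :: "'a star_alg" and B :: "'b star_alg" and M :: "'m star_alg" and q \<mu> \<nu> :: real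
    and \<Delta> :: "Uq_elem \<Rightarrow> ('a \<times> 'b \<Rightarrow>\<^sub>0 complex) set" and \<Phi> z l r
  assumes calg: "calgebra A" "calgebra B" "calgebra M"
    and D: "alg_hom (Uq q \<mu> \<nu>) (A \<boxtimes> B) \<Delta>"
    and P: "lin_map (A \<boxtimes> B) M \<Phi>" and P_one: "\<Phi> (pure_tensor A B \<one>\<^bsub>A\<^esub> \<one>\<^bsub>B\<^esub>) = \<one>\<^bsub>M\<^esub>"
    and z: "alg_hom (Uq q \<mu> \<nu>) M z"
    and cl: "\<And>a b. a \<in> carrier A \<Longrightarrow> b \<in> carrier B \<Longrightarrow> l a b \<in> carrier M"
      "\<And>a b. a \<in> carrier A \<Longrightarrow> b \<in> carrier B \<Longrightarrow> r a b \<in> carrier M"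
    and comm: "\<And>a b h. a \<in> carrier A \<Longrightarrow> b \<in> carrier B \<Longrightarrow> h \<in> carrier (Uq q \<mu> \<nu>) \<Longrightarrow>
      r a b \<otimes>\<^bsub>M\<^esub> z h = z h \<otimes>\<^bsub>M\<^esub> r a b"
    and gen: "\<And>x. \<Phi> (\<Delta> (Uq_gen q \<mu> \<nu> x)) = z (Uq_gen q \<mu> \<nu> x)"
begin

interpretation alg_pair A B by (intro alg_pair.intro calg)
interpretation M: calgebra M by (rule calg)

lemma Uq_sandwich_left:
  assumes pure: "\<And>a b. a \<in> carrier A \<Longrightarrow> b \<in> carrier B \<Longrightarrow> \<Phi> (pure_tensor A B a b) = r a b \<otimes>\<^bsub>M\<^esub> l a b"
    and mult: "\<And>a b x y. a \<in> carrier A \<Longrightarrow> b \<in> carrier B \<Longrightarrow> x \<in> carrier A \<Longrightarrow> y \<in> carrier B \<Longrightarrow>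
      \<Phi> (pure_tensor A B (x \<otimes>\<^bsub>A\<^esub> a) (y \<otimes>\<^bsub>B\<^esub> b)) = r a b \<otimes>\<^bsub>M\<^esub> \<Phi> (pure_tensor A B x y) \<otimes>\<^bsub>M\<^esub> l a b"
    and h: "h \<in> carrier (Uq q \<mu> \<nu>)"
  shows "\<Phi> (\<Delta> h) = z h"
  using h
proof (induction h rule: Uq_induct)
  case (mult x y)
  note Px = lin_mapD[OF P]
  \<comment> \<open>Linearity extends \<open>mult\<close> from pure tensors to all \<open>t\<close>,
    so that \<open>t = \<Delta> x\<close> is allowed, where the induction hypothesis gives the value
    z x.\<close>
  have 1: "\<Phi> (t \<otimes>\<^bsub>A \<boxtimes> B\<^esub> pure_tensor A B a b) = r a b \<otimes>\<^bsub>M\<^esub> \<Phi> t \<otimes>\<^bsub>M\<^esub> l a b"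
    if "t \<in> carrier (A \<boxtimes> B)" and ab: "a \<in> carrier A" "b \<in> carrier B" for t a b
    using that(1) by (induction t rule: tensor_induct)
      (use ab in \<open>simp_all add: pure_mult assms(2) Px T.l_distr M.l_distr M.r_distr cl\<close>)
  \<comment> \<open>For u = a \<otimes> b the value is r z(x) l; commuting z x past r turns it into
    z(x) r l = z(x) \<Phi>(u).\<close>
  have "\<Phi> (\<Delta> x \<otimes>\<^bsub>A \<boxtimes> B\<^esub> u) = z x \<otimes>\<^bsub>M\<^esub> \<Phi> u" if "u \<in> carrier (A \<boxtimes> B)" for u
    using that
  proof (induction u rule: tensor_induct)
    case (pure a b)
    then show ?case
      using mult(1,3) by (simp add: 1 assms(1) alg_homD(4)[OF D] alg_homD(4)[OF z] cl comm M.m_assoc[symmetric])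
  qed (use mult(1) in \<open>simp add: Px T.r_distr M.r_distr alg_homD(4)[OF D] alg_homD(4)[OF z]\<close>)
  then show ?case using mult by (simp add: alg_homD(3,4)[OF D] alg_homD(3)[OF z])
qed (simp_all add: gen alg_homD[OF D] alg_homD[OF z] lin_mapD[OF P] pure_one P_one)

lemma Uq_sandwich_right:
  assumes pure: "\<And>a b. a \<in> carrier A \<Longrightarrow> b \<in> carrier B \<Longrightarrow> \<Phi> (pure_tensor A B a b) = l a b \<otimes>\<^bsub>M\<^esub> r a b"
    and mult: "\<And>a b x y. a \<in> carrier A \<Longrightarrow> b \<in> carrier B \<Longrightarrow> x \<in> carrier A \<Longrightarrow> y \<in> carrier B \<Longrightarrow>
      \<Phi> (pure_tensor A B (a \<otimes>\<^bsub>A\<^esub> x) (b \<otimes>\<^bsub>B\<^esub> y)) = l a b \<otimes>\<^bsub>M\<^esub> \<Phi> (pure_tensor A B x y) \<otimes>\<^bsub>M\<^esub> r a b"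
    and h: "h \<in> carrier (Uq q \<mu> \<nu>)"
  shows "\<Phi> (\<Delta> h) = z h"
  using h
proof (induction h rule: Uq_induct)
  case (mult x y)
  note Px = lin_mapD[OF P]
  have 1: "\<Phi> (pure_tensor A B a b \<otimes>\<^bsub>A \<boxtimes> B\<^esub> t) = l a b \<otimes>\<^bsub>M\<^esub> \<Phi> t \<otimes>\<^bsub>M\<^esub> r a b"
    if "t \<in> carrier (A \<boxtimes> B)" and ab: "a \<in> carrier A" "b \<in> carrier B" for t a b
    using that(1) by (induction t rule: tensor_induct)
      (use ab in \<open>simp_all add: pure_mult assms(2) Px T.r_distr M.l_distr M.r_distr cl\<close>)
  have "\<Phi> (u \<otimes>\<^bsub>A \<boxtimes> B\<^esub> \<Delta> y) = \<Phi> u \<otimes>\<^bsub>M\<^esub> z y" if "u \<in> carrier (A \<boxtimes> B)" for u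
    using that
  proof (induction u rule: tensor_induct)
    case (pure a b)
    then show ?case
      using mult(2,4) by (simp add: 1 assms(1) alg_homD(4)[OF D] alg_homD(4)[OF z] cl comm M.m_assoc)
  qed (use mult(2) in \<open>simp add: Px T.l_distr M.l_distr alg_homD(4)[OF D] alg_homD(4)[OF z]\<close>)
  then show ?case using mult by (simp add: alg_homD(3,4)[OF D] alg_homD(3)[OF z])
qed (simp_all add: gen alg_homD[OF D] alg_homD[OF z] lin_mapD[OF P] pure_one P_one)

end

lemma alg_hom_scalar:
  assumes "calgebra A" "alg_hom H complex_alg \<epsilon>"
  shows "alg_hom H A (\<lambda>h. \<epsilon> h \<odot>\<^bsub>A\<^esub> \<one>\<^bsub>A\<^esub>)"
proof -
  interpret calgebra A by fact
  note e = alg_homD[OF assms(2), simplified]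
  show ?thesis
    by (intro alg_homI lin_mapI)
      (simp_all add: e csmult_add csmult_csmult csmult_mult_left csmult_mult_right mult.commute)
qed

lemma Uq_antipode:
  assumes q: "q \<noteq> 0"
    and e: "alg_hom (Uq q \<mu> \<mu>) complex_alg \<epsilon>" "\<And>x. \<epsilon> (Uq_gen q \<mu> \<mu> x) = gen_counit x"
    and S: "alg_hom (Uq q \<mu> \<mu>) (op_alg (Uq q \<mu> \<mu>)) S" "\<And>x. S (Uq_gen q \<mu> \<mu> x) = antipode_gen q \<mu> \<mu> x"
    and h: "h \<in> carrier (Uq q \<mu> \<mu>)"
  shows "tensor_lift (Uq q \<mu> \<mu>) (\<lambda>x y. S x \<otimes>\<^bsub>Uq q \<mu> \<mu>\<^esub> y) (Uq_Delta q \<mu> \<mu> \<mu> h) =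
      \<epsilon> h \<odot>\<^bsub>Uq q \<mu> \<mu>\<^esub> \<one>\<^bsub>Uq q \<mu> \<mu>\<^esub>"
    and "tensor_lift (Uq q \<mu> \<mu>) (\<lambda>x y. x \<otimes>\<^bsub>Uq q \<mu> \<mu>\<^esub> S y) (Uq_Delta q \<mu> \<mu> \<mu> h) =
      \<epsilon> h \<odot>\<^bsub>Uq q \<mu> \<mu>\<^esub> \<one>\<^bsub>Uq q \<mu> \<mu>\<^esub>"
proof -
  let ?H = "Uq q \<mu> \<mu>"
  interpret alg_pair ?H ?H by (intro alg_pair.intro calgebra_Uq)
  note s = alg_homD[OF S(1), simplified]
  note ec = alg_homD(4)[OF e(1), simplified]
  note c = calgebra_Uq[of q \<mu> \<mu>]
  note Z = alg_hom_scalar[OF c e(1)]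
  have bl: "bilin ?H ?H ?H (\<lambda>x y. S x \<otimes>\<^bsub>?H\<^esub> y)" and br: "bilin ?H ?H ?H (\<lambda>x y. x \<otimes>\<^bsub>?H\<^esub> S y)"
    by (intro bilinI lin_mapI; simp add: s A.l_distr A.r_distr A.csmult_mult_left A.csmult_mult_right)+
  note pl = tensor_lift_lin[OF c bl] tensor_lift_pure[OF c bl]
  note pr = tensor_lift_lin[OF c br] tensor_lift_pure[OF c br]
  note simps = Uq_Delta_gen[OF q] Delta_gen_def Let_def S(2) e(2) antipode_gen_def gen_counit_def
    A.csmult_mult_left A.csmult_mult_right A.csmult_csmult Uq_gen_simps q A.csmult_cancels
  show "tensor_lift ?H (\<lambda>x y. S x \<otimes>\<^bsub>?H\<^esub> y) (Uq_Delta q \<mu> \<mu> \<mu> h) = \<epsilon> h \<odot>\<^bsub>?H\<^esub> \<one>\<^bsub>?H\<^esub>"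
  \<comment> \<open>Here z(h) = \<epsilon>(h) 1 is central, so it commutes with every value of
    S.\<close>
  proof (rule Uq_sandwich_left[OF c c c alg_hom_Uq_Delta[OF q] pl(1) _ Z, where l = "\<lambda>x y. y" and r = "\<lambda>x y. S x"])
    show "tensor_lift ?H (\<lambda>x y. S x \<otimes>\<^bsub>?H\<^esub> y) (Uq_Delta q \<mu> \<mu> \<mu> (Uq_gen q \<mu> \<mu> x)) =
        \<epsilon> (Uq_gen q \<mu> \<mu> x) \<odot>\<^bsub>?H\<^esub> \<one>\<^bsub>?H\<^esub>" for x
      by (cases x) (simp_all add: simps lin_mapD[OF pl(1)] pl(2))
  qed (simp_all add: pl s h A.csmult_mult_left A.csmult_mult_right A.m_assoc)
  show "tensor_lift ?H (\<lambda>x y. x \<otimes>\<^bsub>?H\<^esub> S y) (Uq_Delta q \<mu> \<mu> \<mu> h) = \<epsilon> h \<odot>\<^bsub>?H\<^esub> \<one>\<^bsub>?H\<^esub>"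
  proof (rule Uq_sandwich_right[OF c c c alg_hom_Uq_Delta[OF q] pr(1) _ Z, where l = "\<lambda>x y. x" and r = "\<lambda>x y. S y"])
    show "tensor_lift ?H (\<lambda>x y. x \<otimes>\<^bsub>?H\<^esub> S y) (Uq_Delta q \<mu> \<mu> \<mu> (Uq_gen q \<mu> \<mu> x)) =
        \<epsilon> (Uq_gen q \<mu> \<mu> x) \<odot>\<^bsub>?H\<^esub> \<one>\<^bsub>?H\<^esub>" for x
      by (cases x) (simp_all add: simps lin_mapD[OF pr(1)] pr(2))
  qed (simp_all add: pr s h A.csmult_mult_left A.csmult_mult_right A.m_assoc)
qed

lemma is_counit_Uq:
  assumes "q \<noteq> 0" "alg_hom (Uq q \<mu> \<mu>) complex_alg \<epsilon>" "\<And>x. \<epsilon> (Uq_gen q \<mu> \<mu> x) = gen_counit x"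
  shows "is_counit (Uq q \<mu> \<mu>) (Uq_Delta q \<mu> \<mu> \<mu>) \<epsilon>"
  unfolding is_counit_def using assms Uq_counit_left[OF assms] Uq_counit_right[OF assms] by blast

lemma hopf_star_algebra_Uq:
  assumes q: "q \<noteq> 0"
  shows "hopf_star_algebra (Uq q \<mu> \<mu>) (Uq_Delta q \<mu> \<mu> \<mu>)"
proof -
  obtain \<epsilon> where e: "alg_hom (Uq q \<mu> \<mu>) complex_alg \<epsilon>" "\<And>x. \<epsilon> (Uq_gen q \<mu> \<mu> x) = gen_counit x"
    using Uq_counit_ex by blast
  obtain S where S: "alg_hom (Uq q \<mu> \<mu>) (op_alg (Uq q \<mu> \<mu>)) S" "\<And>x. S (Uq_gen q \<mu> \<mu> x) = antipode_gen q \<mu> \<mu> x"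
    using Uq_antipode_ex[OF q] by blast
  have "lin_map (Uq q \<mu> \<mu>) (Uq q \<mu> \<mu>) S"
    using alg_homD(1)[OF S(1)] by (simp add: lin_map_def)
  then have "is_antipode (Uq q \<mu> \<mu>) (Uq_Delta q \<mu> \<mu> \<mu>) \<epsilon> S"
    unfolding is_antipode_def using Uq_antipode[OF q e S] by blast
  then show ?thesis
    unfolding hopf_star_algebra_def
    using star_algebra_Uq[OF q] star_hom_Uq_Delta[OF q] Uq_Delta_coassoc[OF q] is_counit_Uq[OF q e] by blast
qed

lemma left_comodule_Uq:
  assumes q: "q \<noteq> 0"
  shows "left_comodule_star_algebra (Uq q \<mu> \<mu>) (Uq_Delta q \<mu> \<mu> \<mu>) (Uq q \<mu> \<nu>) (Uq_Delta q \<mu> \<mu> \<nu>)"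
proof -
  obtain \<epsilon> where e: "alg_hom (Uq q \<mu> \<mu>) complex_alg \<epsilon>" "\<And>x. \<epsilon> (Uq_gen q \<mu> \<mu> x) = gen_counit x"
    using Uq_counit_ex by blast
  then show ?thesis
    unfolding left_comodule_star_algebra_def
    using star_hom_Uq_Delta[OF q] Uq_Delta_coassoc[OF q] is_counit_Uq[OF q e] Uq_counit_left[OF q e] by blast
qed

lemma right_comodule_Uq:
  assumes q: "q \<noteq> 0"
  shows "right_comodule_star_algebra (Uq q \<nu> \<nu>) (Uq_Delta q \<nu> \<nu> \<nu>) (Uq q \<mu> \<nu>) (Uq_Delta q \<mu> \<nu> \<nu>)"
proof -
  obtain \<epsilon> where e: "alg_hom (Uq q \<nu> \<nu>) complex_alg \<epsilon>" "\<And>x. \<epsilon> (Uq_gen q \<nu> \<nu> x) = gen_counit x"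
    using Uq_counit_ex by blast
  then show ?thesis
    unfolding right_comodule_star_algebra_def
    using star_hom_Uq_Delta[OF q] Uq_Delta_coassoc[OF q] is_counit_Uq[OF q e] Uq_counit_right[OF q e] by blast
qed

section \<open>Galois maps\<close>

text \<open>The map \<open>\<gamma> = (S \<otimes> \<iota>) \<Delta>\<close> is multiplicative only as a map into \<open>A\<^sup>o\<^sup>p \<otimes> A\<close>, but the Galois maps
  involve the product of \<open>A \<otimes> A\<close>; both algebras have the same underlying vector space.\<close>

lemma tensor_cong_module:
  assumes "carrier A' = carrier A" "add A' = add A" "smult A' = smult A"
    and "carrier B' = carrier B" "add B' = add B" "smult B' = smult B"
  shows "carrier (A' \<boxtimes> B') = carrier (A \<boxtimes> B)" "add (A' \<boxtimes> B') = add (A \<boxtimes> B)"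
    "smult (A' \<boxtimes> B') = smult (A \<boxtimes> B)" "pure_tensor A' B' = pure_tensor A B"
proof -
  have rels: "tensor_rels A' B' = tensor_rels A B"
    by (simp add: tensor_rels_def assms)
  have pre: "carrier (pre_tensor A' B') = carrier (pre_tensor A B)" "add (pre_tensor A' B') = add (pre_tensor A B)"
    "smult (pre_tensor A' B') = smult (pre_tensor A B)"
    by (simp_all add: pre_tensor_def assms)
  have coset: "I +>\<^bsub>pre_tensor A' B'\<^esub> p = I +>\<^bsub>pre_tensor A B\<^esub> p" for I p
    by (simp add: a_r_coset_def' pre)
  show "carrier (A' \<boxtimes> B') = carrier (A \<boxtimes> B)" "add (A' \<boxtimes> B') = add (A \<boxtimes> B)"
    "smult (A' \<boxtimes> B') = smult (A \<boxtimes> B)" "pure_tensor A' B' = pure_tensor A B"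
    by (simp_all add: tensor_def quot_alg_simps(1) quot_alg_def set_add_def' A_RCOSETS_def' pre coset rels
        pure_tensor_def fun_eq_iff)
qed

text \<open>The domain of \<open>\<delta>\<close> is kept general so that the inverse is an instance
  too: it is the same construction applied to \<gamma> in place of the coaction.\<close>

definition right_galois :: "'a star_alg \<Rightarrow> 'c star_alg \<Rightarrow> ('b \<Rightarrow> ('a \<times> 'c \<Rightarrow>\<^sub>0 complex) set) \<Rightarrow>
    ('a \<times> 'b \<Rightarrow>\<^sub>0 complex) set \<Rightarrow> ('a \<times> 'c \<Rightarrow>\<^sub>0 complex) set" where
  "right_galois A C \<delta> = tensor_lift (A \<boxtimes> C) (\<lambda>x y. pure_tensor A C x \<one>\<^bsub>C\<^esub> \<otimes>\<^bsub>A \<boxtimes> C\<^esub> \<delta> y)"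

definition left_galois :: "'a star_alg \<Rightarrow> 'c star_alg \<Rightarrow> ('b \<Rightarrow> ('c \<times> 'a \<Rightarrow>\<^sub>0 complex) set) \<Rightarrow>
    ('b \<times> 'a \<Rightarrow>\<^sub>0 complex) set \<Rightarrow> ('c \<times> 'a \<Rightarrow>\<^sub>0 complex) set" where
  "left_galois A C \<delta> = tensor_lift (C \<boxtimes> A) (\<lambda>x y. \<delta> x \<otimes>\<^bsub>C \<boxtimes> A\<^esub> pure_tensor C A \<one>\<^bsub>C\<^esub> y)"

lemma
  assumes "calgebra A" "calgebra B" "calgebra C" and d: "lin_map B (A \<boxtimes> C) \<delta>"
  shows right_galois_lin: "lin_map (A \<boxtimes> B) (A \<boxtimes> C) (right_galois A C \<delta>)"
    and right_galois_pure: "a \<in> carrier A \<Longrightarrow> b \<in> carrier B \<Longrightarrow>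
      right_galois A C \<delta> (pure_tensor A B a b) = pure_tensor A C a \<one>\<^bsub>C\<^esub> \<otimes>\<^bsub>A \<boxtimes> C\<^esub> \<delta> b"
proof -
  interpret AB: alg_pair A B by (intro alg_pair.intro assms)
  interpret AC: alg_pair A C by (intro alg_pair.intro assms)
  have bl: "bilin A B (A \<boxtimes> C) (\<lambda>x y. pure_tensor A C x \<one>\<^bsub>C\<^esub> \<otimes>\<^bsub>A \<boxtimes> C\<^esub> \<delta> y)"
    by (intro bilinI lin_mapI)
      (simp_all add: lin_mapD[OF d] AC.pure_lin AC.T.l_distr AC.T.r_distr AC.T.csmult_mult_left AC.T.csmult_mult_right)
  show "lin_map (A \<boxtimes> B) (A \<boxtimes> C) (right_galois A C \<delta>)"
    "a \<in> carrier A \<Longrightarrow> b \<in> carrier B \<Longrightarrow>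
      right_galois A C \<delta> (pure_tensor A B a b) = pure_tensor A C a \<one>\<^bsub>C\<^esub> \<otimes>\<^bsub>A \<boxtimes> C\<^esub> \<delta> b"
    unfolding right_galois_def
    using AB.tensor_lift_lin[OF AC.T.calgebra_axioms bl] AB.tensor_lift_pure[OF AC.T.calgebra_axioms bl] by simp_all
qed

lemma
  assumes "calgebra A" "calgebra B" "calgebra C" and d: "lin_map B (C \<boxtimes> A) \<delta>"
  shows left_galois_lin: "lin_map (B \<boxtimes> A) (C \<boxtimes> A) (left_galois A C \<delta>)"
    and left_galois_pure: "a \<in> carrier A \<Longrightarrow> b \<in> carrier B \<Longrightarrow>
      left_galois A C \<delta> (pure_tensor B A b a) = \<delta> b \<otimes>\<^bsub>C \<boxtimes> A\<^esub> pure_tensor C A \<one>\<^bsub>C\<^esub> a"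
proof -
  interpret BA: alg_pair B A by (intro alg_pair.intro assms)
  interpret CA: alg_pair C A by (intro alg_pair.intro assms)
  have bl: "bilin B A (C \<boxtimes> A) (\<lambda>x y. \<delta> x \<otimes>\<^bsub>C \<boxtimes> A\<^esub> pure_tensor C A \<one>\<^bsub>C\<^esub> y)"
    by (intro bilinI lin_mapI)
      (simp_all add: lin_mapD[OF d] CA.pure_lin CA.T.l_distr CA.T.r_distr CA.T.csmult_mult_left CA.T.csmult_mult_right)
  show "lin_map (B \<boxtimes> A) (C \<boxtimes> A) (left_galois A C \<delta>)"
    "a \<in> carrier A \<Longrightarrow> b \<in> carrier B \<Longrightarrow>
      left_galois A C \<delta> (pure_tensor B A b a) = \<delta> b \<otimes>\<^bsub>C \<boxtimes> A\<^esub> pure_tensor C A \<one>\<^bsub>C\<^esub> a"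
    unfolding left_galois_def
    using BA.tensor_lift_lin[OF CA.T.calgebra_axioms bl] BA.tensor_lift_pure[OF CA.T.calgebra_axioms bl] by simp_all
qed

text \<open>Maps of this form are left \<open>A\<close>-linear, so a composite is the identity as
  soon as it fixes every 1 \<otimes> x. The hypotheses on \<delta> and \<gamma> have the same shape,
  hence the lemma applies to both composites.\<close>

lemma right_galois_inverse:
  assumes c: "calgebra A" "calgebra B" "calgebra C"
    and d: "lin_map B (A \<boxtimes> C) \<delta>" and g: "lin_map C (A \<boxtimes> B) \<gamma>"
    and inv: "\<And>x. x \<in> carrier C \<Longrightarrow> right_galois A C \<delta> (\<gamma> x) = pure_tensor A C \<one>\<^bsub>A\<^esub> x"
    and t: "t \<in> carrier (A \<boxtimes> C)"
  shows "right_galois A C \<delta> (right_galois A B \<gamma> t) = t"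
proof -
  interpret AB: alg_pair A B by (intro alg_pair.intro c)
  interpret AC: alg_pair A C by (intro alg_pair.intro c)
  note D = right_galois_lin[OF c d] right_galois_pure[OF c d]
  note G = right_galois_lin[OF c(1,3,2) g] right_galois_pure[OF c(1,3,2) g]
  have lin: "right_galois A C \<delta> (pure_tensor A B x \<one>\<^bsub>B\<^esub> \<otimes>\<^bsub>A \<boxtimes> B\<^esub> u) = pure_tensor A C x \<one>\<^bsub>C\<^esub> \<otimes>\<^bsub>A \<boxtimes> C\<^esub> right_galois A C \<delta> u"
    if "u \<in> carrier (A \<boxtimes> B)" and x: "x \<in> carrier A" for u x
    using that(1)
  proof (induction u rule: AB.tensor_induct)
    case (pure a b)
    have "pure_tensor A C (x \<otimes>\<^bsub>A\<^esub> a) \<one>\<^bsub>C\<^esub> = pure_tensor A C x \<one>\<^bsub>C\<^esub> \<otimes>\<^bsub>A \<boxtimes> C\<^esub> pure_tensor A C a \<one>\<^bsub>C\<^esub>"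
      using pure x by (simp add: AC.pure_mult)
    with pure x show ?case
      by (simp add: AB.pure_mult D lin_mapD(1)[OF d] AC.T.m_assoc)
  qed (use x in \<open>simp add: AB.T.r_distr AC.T.r_distr lin_mapD[OF D(1)]\<close>)
  from t show ?thesis
    by (induction t rule: AC.tensor_induct)
      (simp_all add: G(2) lin inv lin_mapD[OF g] AC.pure_mult lin_mapD[OF D(1)] lin_mapD[OF G(1)])
qed

lemma left_galois_inverse:
  assumes c: "calgebra A" "calgebra B" "calgebra C"
    and d: "lin_map B (C \<boxtimes> A) \<delta>" and g: "lin_map C (B \<boxtimes> A) \<gamma>"
    and inv: "\<And>x. x \<in> carrier C \<Longrightarrow> left_galois A C \<delta> (\<gamma> x) = pure_tensor C A x \<one>\<^bsub>A\<^esub>"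
    and t: "t \<in> carrier (C \<boxtimes> A)"
  shows "left_galois A C \<delta> (left_galois A B \<gamma> t) = t"
proof -
  interpret BA: alg_pair B A by (intro alg_pair.intro c)
  interpret CA: alg_pair C A by (intro alg_pair.intro c)
  note D = left_galois_lin[OF c d] left_galois_pure[OF c d]
  note G = left_galois_lin[OF c(1,3,2) g] left_galois_pure[OF c(1,3,2) g]
  have lin: "left_galois A C \<delta> (u \<otimes>\<^bsub>B \<boxtimes> A\<^esub> pure_tensor B A \<one>\<^bsub>B\<^esub> x) = left_galois A C \<delta> u \<otimes>\<^bsub>C \<boxtimes> A\<^esub> pure_tensor C A \<one>\<^bsub>C\<^esub> x"
    if "u \<in> carrier (B \<boxtimes> A)" and x: "x \<in> carrier A" for u x
    using that(1)
  proof (induction u rule: BA.tensor_induct)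
    case (pure b a)
    have "pure_tensor C A \<one>\<^bsub>C\<^esub> (a \<otimes>\<^bsub>A\<^esub> x) = pure_tensor C A \<one>\<^bsub>C\<^esub> a \<otimes>\<^bsub>C \<boxtimes> A\<^esub> pure_tensor C A \<one>\<^bsub>C\<^esub> x"
      using pure x by (simp add: CA.pure_mult)
    with pure x show ?case
      by (simp add: BA.pure_mult D lin_mapD(1)[OF d] CA.T.m_assoc)
  qed (use x in \<open>simp add: BA.T.l_distr CA.T.l_distr lin_mapD[OF D(1)]\<close>)
  from t show ?thesis
    by (induction t rule: CA.tensor_induct)
      (simp_all add: G(2) lin inv lin_mapD[OF g] CA.pure_mult lin_mapD[OF D(1)] lin_mapD[OF G(1)])
qed

text \<open>S is taken from \<open>U_q(\<nu>, \<mu>)\<close> to \<open>U_q(\<mu>, \<nu>)\<close>: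
  splitting h in \<open>U_q(\<nu>, \<nu>)\<close> through the middle index \<mu> puts its first leg
  in the domain of S, so both legs of \<gamma>(h) lie in \<open>?A\<close>.\<close>

lemma Uq_right_galois:
  assumes q: "q \<noteq> 0"
  shows "bij_betw (right_galois (Uq q \<mu> \<nu>) (Uq q \<nu> \<nu>) (Uq_Delta q \<mu> \<nu> \<nu>))
    (carrier (Uq q \<mu> \<nu> \<boxtimes> Uq q \<mu> \<nu>)) (carrier (Uq q \<mu> \<nu> \<boxtimes> Uq q \<nu> \<nu>))"
proof -
  let ?A = "Uq q \<mu> \<nu>" and ?H = "Uq q \<nu> \<nu>" and ?B = "Uq q \<nu> \<mu>"
  let ?C = "op_alg ?A \<boxtimes> ?A"
  obtain S where S: "alg_hom ?B (op_alg ?A) S" and S_gen: "\<And>x. S (Uq_gen q \<nu> \<mu> x) = antipode_gen q \<nu> \<mu> x"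
    using Uq_antipode_ex[OF q] by blast
  note c = calgebra_Uq calgebra_op_alg[OF calgebra_Uq]
  note Cc = tensor_cong_module[of "op_alg ?A" ?A ?A ?A, simplified]
  interpret AA: alg_pair ?A ?A by (intro alg_pair.intro c)
  interpret AH: alg_pair ?A ?H by (intro alg_pair.intro c)
  interpret BA: alg_pair ?B ?A by (intro alg_pair.intro c)
  interpret C: alg_pair "op_alg ?A" ?A by (intro alg_pair.intro c)
  let ?\<delta> = "Uq_Delta q \<mu> \<nu> \<nu>" and ?\<Delta> = "Uq_Delta q \<nu> \<mu> \<nu>"
  let ?s = "tensor_map (op_alg ?A) ?A S id"
  define \<gamma> where "\<gamma> = (\<lambda>h. ?s (?\<Delta> h))"
  note d = alg_hom_Uq_Delta[OF q, of \<mu> \<nu> \<nu>] and D = alg_hom_Uq_Delta[OF q, of \<nu> \<nu> \<mu>]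
  note dl = alg_homD(1)[OF d]
  note s = alg_homD[OF S, simplified]
  have sa: "alg_hom (?B \<boxtimes> ?A) ?C ?s"
    by (rule tensor_map_alg[OF c(1) c(1) c(2) c(1) alg_homD(1)[OF S] lin_map_id S alg_hom_id])
  have sp: "?s (pure_tensor ?B ?A b a) = pure_tensor ?A ?A (S b) a" if "b \<in> carrier ?B" "a \<in> carrier ?A" for a b
    using tensor_map_pure[OF c(1) c(1) c(2) c(1) alg_homD(1)[OF S] lin_map_id that] by (simp add: Cc)
  have g: "alg_hom ?H ?C \<gamma>"
    unfolding \<gamma>_def by (rule alg_hom_comp[OF D sa])
  have gl: "lin_map ?H (?A \<boxtimes> ?A) \<gamma>" and sl: "lin_map (?B \<boxtimes> ?A) (?A \<boxtimes> ?A) ?s"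
    using alg_homD(1)[OF g] alg_homD(1)[OF sa] by (simp_all add: lin_map_def Cc)
  note K = right_galois_lin[OF c(1) c(1) c(1) dl] right_galois_pure[OF c(1) c(1) c(1) dl]
  note L = right_galois_lin[OF c(1) c(1) c(1) gl] right_galois_pure[OF c(1) c(1) c(1) gl]
  \<comment> \<open>In Sweedler notation, S(h1) h2 \<otimes> h3 = 1 \<otimes> h. The sandwiching
    factor S(b) \<otimes> 1 and 1 \<otimes> h live in different legs and therefore commute.\<close>
  have 1: "right_galois ?A ?H ?\<delta> (\<gamma> h) = pure_tensor ?A ?H \<one>\<^bsub>?A\<^esub> h" if "h \<in> carrier ?H" for h
    unfolding \<gamma>_def
  proof (rule Uq_sandwich_left[OF c(1) c(1) AH.T.calgebra_axioms D lin_map_comp[OF sl K(1)] _ AH.alg_hom_pure_right,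
        where l = "\<lambda>b a. ?\<delta> a" and r = "\<lambda>b a. pure_tensor ?A ?H (S b) \<one>\<^bsub>?H\<^esub>"])
    show "right_galois ?A ?H ?\<delta> (?s (?\<Delta> (Uq_gen q \<nu> \<nu> x))) = pure_tensor ?A ?H \<one>\<^bsub>?A\<^esub> (Uq_gen q \<nu> \<nu> x)" for x
      by (cases x) (simp_all add: Uq_Delta_gen[OF q] Delta_gen_def Let_def lin_mapD[OF sl] sp S_gen antipode_gen_def
        lin_mapD[OF K(1)] K(2) AA.pure_lin AH.pure_lin AH.pure_mult Uq_gen_simps q
        AH.T.l_distr AH.T.r_distr AH.T.csmult_mult_left AH.T.csmult_mult_right AH.T.csmult_csmult
        AH.T.csmult_distrib AH.T.csmult_cancels AH.T.a_assoc)
    show "right_galois ?A ?H ?\<delta> (?s (pure_tensor ?B ?A (x \<otimes>\<^bsub>?B\<^esub> a) (y \<otimes>\<^bsub>?A\<^esub> b))) =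
        pure_tensor ?A ?H (S a) \<one>\<^bsub>?H\<^esub> \<otimes>\<^bsub>?A \<boxtimes> ?H\<^esub> right_galois ?A ?H ?\<delta> (?s (pure_tensor ?B ?A x y)) \<otimes>\<^bsub>?A \<boxtimes> ?H\<^esub> ?\<delta> b"
      if "a \<in> carrier ?B" "b \<in> carrier ?A" "x \<in> carrier ?B" "y \<in> carrier ?A" for a b x y
    proof -
      have "pure_tensor ?A ?H (S a \<otimes>\<^bsub>?A\<^esub> S x) \<one>\<^bsub>?H\<^esub> = pure_tensor ?A ?H (S a) \<one>\<^bsub>?H\<^esub> \<otimes>\<^bsub>?A \<boxtimes> ?H\<^esub> pure_tensor ?A ?H (S x) \<one>\<^bsub>?H\<^esub>"
        using that by (simp add: AH.pure_mult s)
      then show ?thesis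
        using that by (simp add: sp s K(2) alg_homD[OF d] AH.T.m_assoc)
    qed
  qed (use that in \<open>simp_all add: sp s K(2) alg_homD[OF d] AH.pure_mult AH.pure_one\<close>)
  \<comment> \<open>In Sweedler notation, h1 S(h2) \<otimes> h3 = 1 \<otimes> h.\<close>
  have 2: "right_galois ?A ?A \<gamma> (?\<delta> h) = pure_tensor ?A ?A \<one>\<^bsub>?A\<^esub> h" if "h \<in> carrier ?A" for h
  proof -
    \<comment> \<open>Only in \<open>?C\<close> is \<gamma> multiplicative. Reversing the product of
      the first leg rewrites (a \<otimes> 1) \<gamma>(b) as the product of \<gamma>(b) and a
      \<otimes> 1 in \<open>?C\<close>, in which a \<otimes> 1 is antimultiplicative in a: the form
      of \<open>Uq_sandwich_right\<close>.\<close>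
    have Lp: "right_galois ?A ?A \<gamma> (pure_tensor ?A ?H a b) = \<gamma> b \<otimes>\<^bsub>?C\<^esub> pure_tensor ?A ?A a \<one>\<^bsub>?A\<^esub>"
      if "a \<in> carrier ?A" "b \<in> carrier ?H" for a b
    proof -
      have "pure_tensor ?A ?A a \<one>\<^bsub>?A\<^esub> \<otimes>\<^bsub>?A \<boxtimes> ?A\<^esub> u = u \<otimes>\<^bsub>?C\<^esub> pure_tensor ?A ?A a \<one>\<^bsub>?A\<^esub>"
        if "u \<in> carrier (?A \<boxtimes> ?A)" for u
        using that
      proof (induction u rule: AA.tensor_induct)
        case (pure x y)
        then show ?case
          using \<open>a \<in> carrier ?A\<close> C.pure_mult[of x y a "\<one>\<^bsub>?A\<^esub>"] by (simp add: AA.pure_mult Cc)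
      next
        case (add t u)
        then show ?case
          using \<open>a \<in> carrier ?A\<close> C.T.l_distr[of t u "pure_tensor ?A ?A a \<one>\<^bsub>?A\<^esub>"] by (simp add: AA.T.r_distr Cc)
      qed
      then show ?thesis using that by (simp add: L(2) lin_mapD[OF gl])
    qed
    have LC: "lin_map (?A \<boxtimes> ?H) ?C (right_galois ?A ?A \<gamma>)"
      using L(1) by (simp add: lin_map_def Cc)
    have zC: "alg_hom ?A ?C (\<lambda>h. pure_tensor ?A ?A \<one>\<^bsub>?A\<^esub> h)"
      using C.alg_hom_pure_right by (simp add: Cc)
    note gC = alg_homD[OF g, unfolded Cc]
    note pC = C.pure_mult[unfolded Cc, simplified]
    show ?thesis
    proof (rule Uq_sandwich_right[OF c(1) c(1) C.T.calgebra_axioms d LC _ zC,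
          where l = "\<lambda>a b. \<gamma> b" and r = "\<lambda>a b. pure_tensor ?A ?A a \<one>\<^bsub>?A\<^esub>"])
      show "right_galois ?A ?A \<gamma> (?\<delta> (Uq_gen q \<mu> \<nu> x)) = pure_tensor ?A ?A \<one>\<^bsub>?A\<^esub> (Uq_gen q \<mu> \<nu> x)" for x
        by (cases x) (simp_all add: Uq_Delta_gen[OF q] Delta_gen_def Let_def lin_mapD[OF L(1)] L(2) fun_cong[OF \<gamma>_def]
          lin_mapD[OF sl] sp S_gen antipode_gen_def AA.pure_lin AA.pure_mult Uq_gen_simps q
          AA.T.l_distr AA.T.r_distr AA.T.csmult_mult_left AA.T.csmult_mult_right AA.T.csmult_csmult
          AA.T.csmult_distrib AA.T.csmult_cancels AA.T.a_assoc)
      show "right_galois ?A ?A \<gamma> (pure_tensor ?A ?H (a \<otimes>\<^bsub>?A\<^esub> x) (b \<otimes>\<^bsub>?H\<^esub> y)) =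
          \<gamma> b \<otimes>\<^bsub>?C\<^esub> right_galois ?A ?A \<gamma> (pure_tensor ?A ?H x y) \<otimes>\<^bsub>?C\<^esub> pure_tensor ?A ?A a \<one>\<^bsub>?A\<^esub>"
        if "a \<in> carrier ?A" "b \<in> carrier ?H" "x \<in> carrier ?A" "y \<in> carrier ?H" for a b x y
      proof -
        have "pure_tensor ?A ?A (a \<otimes>\<^bsub>?A\<^esub> x) \<one>\<^bsub>?A\<^esub> = pure_tensor ?A ?A x \<one>\<^bsub>?A\<^esub> \<otimes>\<^bsub>?C\<^esub> pure_tensor ?A ?A a \<one>\<^bsub>?A\<^esub>"
          using that by (simp add: pC)
        then show ?thesis
          using that by (simp add: Lp gC C.T.m_assoc C.T.m_closed[unfolded Cc] Cc)
      qed
      show "right_galois ?A ?A \<gamma> (pure_tensor ?A ?H \<one>\<^bsub>?A\<^esub> \<one>\<^bsub>?H\<^esub>) = \<one>\<^bsub>?C\<^esub>"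
        using C.T.r_one[of "\<one>\<^bsub>?C\<^esub>"] by (simp add: Lp gC(2) C.pure_one Cc)
    qed (use that in \<open>simp_all add: Lp gC pC Cc\<close>)
  qed
  show ?thesis
  proof (rule bij_betw_byWitness[where f' = "right_galois ?A ?A \<gamma>"])
    show "\<forall>t\<in>carrier (?A \<boxtimes> ?A). right_galois ?A ?A \<gamma> (right_galois ?A ?H ?\<delta> t) = t"
      using right_galois_inverse[OF c(1) c(1) c(1) gl dl 2] by blast
    show "\<forall>t\<in>carrier (?A \<boxtimes> ?H). right_galois ?A ?H ?\<delta> (right_galois ?A ?A \<gamma> t) = t"
      using right_galois_inverse[OF c(1) c(1) c(1) dl gl 1] by blast
  qed (use lin_mapD(1)[OF K(1)] lin_mapD(1)[OF L(1)] in blast)+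
qed

text \<open>The mirror image: S now acts on the second leg, so the opposite product goes there and
  the two sandwich lemmas exchange roles.\<close>

lemma Uq_left_galois:
  assumes q: "q \<noteq> 0"
  shows "bij_betw (left_galois (Uq q \<mu> \<nu>) (Uq q \<mu> \<mu>) (Uq_Delta q \<mu> \<mu> \<nu>))
    (carrier (Uq q \<mu> \<nu> \<boxtimes> Uq q \<mu> \<nu>)) (carrier (Uq q \<mu> \<mu> \<boxtimes> Uq q \<mu> \<nu>))"
proof -
  let ?A = "Uq q \<mu> \<nu>" and ?H = "Uq q \<mu> \<mu>" and ?B = "Uq q \<nu> \<mu>"
  let ?C = "?A \<boxtimes> op_alg ?A"
  obtain S where S: "alg_hom ?B (op_alg ?A) S" and S_gen: "\<And>x. S (Uq_gen q \<nu> \<mu> x) = antipode_gen q \<nu> \<mu> x"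
    using Uq_antipode_ex[OF q] by blast
  note c = calgebra_Uq calgebra_op_alg[OF calgebra_Uq]
  note Cc = tensor_cong_module[of ?A ?A "op_alg ?A" ?A, simplified]
  interpret AA: alg_pair ?A ?A by (intro alg_pair.intro c)
  interpret HA: alg_pair ?H ?A by (intro alg_pair.intro c)
  interpret AB: alg_pair ?A ?B by (intro alg_pair.intro c)
  interpret C: alg_pair ?A "op_alg ?A" by (intro alg_pair.intro c)
  let ?\<delta> = "Uq_Delta q \<mu> \<mu> \<nu>" and ?\<Delta> = "Uq_Delta q \<mu> \<nu> \<mu>"
  let ?s = "tensor_map ?A (op_alg ?A) id S"
  define \<gamma> where "\<gamma> = (\<lambda>h. ?s (?\<Delta> h))"
  note d = alg_hom_Uq_Delta[OF q, of \<mu> \<nu> \<mu>] and D = alg_hom_Uq_Delta[OF q, of \<mu> \<mu> \<nu>]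
  note dl = alg_homD(1)[OF d]
  note s = alg_homD[OF S, simplified]
  have sa: "alg_hom (?A \<boxtimes> ?B) ?C ?s"
    by (rule tensor_map_alg[OF c(1) c(1) c(1) c(2) lin_map_id alg_homD(1)[OF S] alg_hom_id S])
  have sp: "?s (pure_tensor ?A ?B a b) = pure_tensor ?A ?A a (S b)" if "a \<in> carrier ?A" "b \<in> carrier ?B" for a b
    using tensor_map_pure[OF c(1) c(1) c(1) c(2) lin_map_id alg_homD(1)[OF S] that] by (simp add: Cc)
  have g: "alg_hom ?H ?C \<gamma>"
    unfolding \<gamma>_def by (rule alg_hom_comp[OF D sa])
  have gl: "lin_map ?H (?A \<boxtimes> ?A) \<gamma>" and sl: "lin_map (?A \<boxtimes> ?B) (?A \<boxtimes> ?A) ?s"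
    using alg_homD(1)[OF g] alg_homD(1)[OF sa] by (simp_all add: lin_map_def Cc)
  note K = left_galois_lin[OF c(1) c(1) c(1) dl] left_galois_pure[OF c(1) c(1) c(1) dl]
  note L = left_galois_lin[OF c(1) c(1) c(1) gl] left_galois_pure[OF c(1) c(1) c(1) gl]
  \<comment> \<open>In Sweedler notation, h1 \<otimes> h2 S(h3) = h \<otimes> 1.\<close>
  have 1: "left_galois ?A ?H ?\<delta> (\<gamma> h) = pure_tensor ?H ?A h \<one>\<^bsub>?A\<^esub>" if "h \<in> carrier ?H" for h
    unfolding \<gamma>_def
  proof (rule Uq_sandwich_right[OF c(1) c(1) HA.T.calgebra_axioms D lin_map_comp[OF sl K(1)] _ HA.alg_hom_pure_left,
        where l = "\<lambda>a b. ?\<delta> a" and r = "\<lambda>a b. pure_tensor ?H ?A \<one>\<^bsub>?H\<^esub> (S b)"])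
    show "left_galois ?A ?H ?\<delta> (?s (?\<Delta> (Uq_gen q \<mu> \<mu> x))) = pure_tensor ?H ?A (Uq_gen q \<mu> \<mu> x) \<one>\<^bsub>?A\<^esub>" for x
      by (cases x) (simp_all add: Uq_Delta_gen[OF q] Delta_gen_def Let_def lin_mapD[OF sl] sp S_gen antipode_gen_def
        lin_mapD[OF K(1)] K(2) AA.pure_lin HA.pure_lin HA.pure_mult Uq_gen_simps q
        HA.T.l_distr HA.T.r_distr HA.T.csmult_mult_left HA.T.csmult_mult_right HA.T.csmult_csmult
        HA.T.csmult_distrib HA.T.csmult_cancels HA.T.a_assoc)
    show "left_galois ?A ?H ?\<delta> (?s (pure_tensor ?A ?B (a \<otimes>\<^bsub>?A\<^esub> x) (b \<otimes>\<^bsub>?B\<^esub> y))) =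
        ?\<delta> a \<otimes>\<^bsub>?H \<boxtimes> ?A\<^esub> left_galois ?A ?H ?\<delta> (?s (pure_tensor ?A ?B x y)) \<otimes>\<^bsub>?H \<boxtimes> ?A\<^esub> pure_tensor ?H ?A \<one>\<^bsub>?H\<^esub> (S b)"
      if "a \<in> carrier ?A" "b \<in> carrier ?B" "x \<in> carrier ?A" "y \<in> carrier ?B" for a b x y
    proof -
      have "pure_tensor ?H ?A \<one>\<^bsub>?H\<^esub> (S y \<otimes>\<^bsub>?A\<^esub> S b) = pure_tensor ?H ?A \<one>\<^bsub>?H\<^esub> (S y) \<otimes>\<^bsub>?H \<boxtimes> ?A\<^esub> pure_tensor ?H ?A \<one>\<^bsub>?H\<^esub> (S b)"
        using that by (simp add: HA.pure_mult s)
      then show ?thesis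
        using that by (simp add: sp s K(2) alg_homD[OF d] HA.T.m_assoc)
    qed
  qed (use that in \<open>simp_all add: sp s K(2) alg_homD[OF d] HA.pure_mult HA.pure_one\<close>)
  \<comment> \<open>In Sweedler notation, h1 \<otimes> S(h2) h3 = h \<otimes> 1.\<close>
  have 2: "left_galois ?A ?A \<gamma> (?\<delta> h) = pure_tensor ?A ?A h \<one>\<^bsub>?A\<^esub>" if "h \<in> carrier ?A" for h
  proof -
    have Lp: "left_galois ?A ?A \<gamma> (pure_tensor ?H ?A b a) = pure_tensor ?A ?A \<one>\<^bsub>?A\<^esub> a \<otimes>\<^bsub>?C\<^esub> \<gamma> b"
      if "a \<in> carrier ?A" "b \<in> carrier ?H" for a b
    proof -
      have "u \<otimes>\<^bsub>?A \<boxtimes> ?A\<^esub> pure_tensor ?A ?A \<one>\<^bsub>?A\<^esub> a = pure_tensor ?A ?A \<one>\<^bsub>?A\<^esub> a \<otimes>\<^bsub>?C\<^esub> u"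
        if "u \<in> carrier (?A \<boxtimes> ?A)" for u
        using that
      proof (induction u rule: AA.tensor_induct)
        case (pure x y)
        then show ?case
          using \<open>a \<in> carrier ?A\<close> C.pure_mult[of "\<one>\<^bsub>?A\<^esub>" a x y] by (simp add: AA.pure_mult Cc)
      next
        case (add t u)
        then show ?case
          using \<open>a \<in> carrier ?A\<close> C.T.r_distr[of t u "pure_tensor ?A ?A \<one>\<^bsub>?A\<^esub> a"] by (simp add: AA.T.l_distr Cc)
      qed
      then show ?thesis using that by (simp add: L(2) lin_mapD[OF gl])
    qed
    have LC: "lin_map (?H \<boxtimes> ?A) ?C (left_galois ?A ?A \<gamma>)"
      using L(1) by (simp add: lin_map_def Cc)
    have zC: "alg_hom ?A ?C (\<lambda>h. pure_tensor ?A ?A h \<one>\<^bsub>?A\<^esub>)"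
      using C.alg_hom_pure_left by (simp add: Cc)
    note gC = alg_homD[OF g, unfolded Cc]
    note pC = C.pure_mult[unfolded Cc, simplified]
    show ?thesis
    proof (rule Uq_sandwich_left[OF c(1) c(1) C.T.calgebra_axioms d LC _ zC,
          where l = "\<lambda>b a. \<gamma> b" and r = "\<lambda>b a. pure_tensor ?A ?A \<one>\<^bsub>?A\<^esub> a"])
      show "left_galois ?A ?A \<gamma> (?\<delta> (Uq_gen q \<mu> \<nu> x)) = pure_tensor ?A ?A (Uq_gen q \<mu> \<nu> x) \<one>\<^bsub>?A\<^esub>" for x
        by (cases x) (simp_all add: Uq_Delta_gen[OF q] Delta_gen_def Let_def lin_mapD[OF L(1)] L(2) fun_cong[OF \<gamma>_def]
          lin_mapD[OF sl] sp S_gen antipode_gen_def AA.pure_lin AA.pure_mult Uq_gen_simps q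
          AA.T.l_distr AA.T.r_distr AA.T.csmult_mult_left AA.T.csmult_mult_right AA.T.csmult_csmult
          AA.T.csmult_distrib AA.T.csmult_cancels AA.T.a_assoc)
      show "left_galois ?A ?A \<gamma> (pure_tensor ?H ?A (x \<otimes>\<^bsub>?H\<^esub> a) (y \<otimes>\<^bsub>?A\<^esub> b)) =
          pure_tensor ?A ?A \<one>\<^bsub>?A\<^esub> b \<otimes>\<^bsub>?C\<^esub> left_galois ?A ?A \<gamma> (pure_tensor ?H ?A x y) \<otimes>\<^bsub>?C\<^esub> \<gamma> a"
        if "a \<in> carrier ?H" "b \<in> carrier ?A" "x \<in> carrier ?H" "y \<in> carrier ?A" for a b x y
      proof -
        have "pure_tensor ?A ?A \<one>\<^bsub>?A\<^esub> (y \<otimes>\<^bsub>?A\<^esub> b) = pure_tensor ?A ?A \<one>\<^bsub>?A\<^esub> b \<otimes>\<^bsub>?C\<^esub> pure_tensor ?A ?A \<one>\<^bsub>?A\<^esub> y"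
          using that by (simp add: pC)
        then show ?thesis
          using that by (simp add: Lp gC C.T.m_assoc C.T.m_closed[unfolded Cc] Cc)
      qed
      show "left_galois ?A ?A \<gamma> (pure_tensor ?H ?A \<one>\<^bsub>?H\<^esub> \<one>\<^bsub>?A\<^esub>) = \<one>\<^bsub>?C\<^esub>"
        using C.T.r_one[of "\<one>\<^bsub>?C\<^esub>"] by (simp add: Lp gC(2) C.pure_one Cc)
    qed (use that in \<open>simp_all add: Lp gC pC Cc\<close>)
  qed
  show ?thesis
  proof (rule bij_betw_byWitness[where f' = "left_galois ?A ?A \<gamma>"])
    show "\<forall>t\<in>carrier (?A \<boxtimes> ?A). left_galois ?A ?A \<gamma> (left_galois ?A ?H ?\<delta> t) = t"
      using left_galois_inverse[OF c(1) c(1) c(1) gl dl 2] by blast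
    show "\<forall>t\<in>carrier (?H \<boxtimes> ?A). left_galois ?A ?H ?\<delta> (left_galois ?A ?A \<gamma> t) = t"
      using left_galois_inverse[OF c(1) c(1) c(1) dl gl 1] by blast
  qed (use lin_mapD(1)[OF K(1)] lin_mapD(1)[OF L(1)] in blast)+
qed

theorem proposition1p6:
  fixes q \<mu> \<nu> :: real
  assumes "0 < q" and "q < 1"
  shows "bi_star_galois_object
    (Uq q \<mu> \<mu>) (Uq_Delta q \<mu> \<mu> \<mu>) (Uq q \<nu> \<nu>) (Uq_Delta q \<nu> \<nu> \<nu>)
    (Uq q \<mu> \<nu>) (Uq_Delta q \<mu> \<mu> \<nu>) (Uq_Delta q \<mu> \<nu> \<nu>)"
proof -
  have q: "q \<noteq> 0" using assms(1) by simp
  show ?thesis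
    unfolding bi_star_galois_object_def
    using hopf_star_algebra_Uq[OF q] star_algebra_Uq[OF q] Uq_nontrivial[OF q] left_comodule_Uq[OF q]
      right_comodule_Uq[OF q] Uq_right_galois[OF q, unfolded right_galois_def]
      Uq_left_galois[OF q, unfolded left_galois_def] Uq_Delta_coassoc[OF q]
    by blast
qed

end
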